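(* Let $A$ be a self-adjoint operator with an infinite matrix representation $A_\infty$ and let $v\in\ell^2_0$. Let the finite approximations be $[A_n]_{i,j}=[A_\infty]_{i,j}$ and $[v_n]_i=[v]_i$ for $i,j=0,1,\ldots,n$. Let $f:\mathbb{R}\to\mathbb{R}$ be Riemann--Stieltjes integrable with respect to $A$ and linearly bounded, that is, for all $x\in\mathbb{R}$, $|f(x)|\le a+b|x|$ for some positive $a$ and $b$. Then, as $n\to\infty$, $$\begin{bmatrix}f(A_n)v_n\\0\end{bmatrix}\to f(A_\infty)v\quad\text{in }\ell^2.$$
   Context: $\ell^2$ is the Hilbert space of absolutely square-summable sequences (indexed from $0$), $e_i$ are its standard basis vectors, and $\ell^2_0\subset\ell^2$ is the space of finite linear combinations of the $e_i$. A self-adjoint operator $A$ on a Hilbert space has an infinite matrix representation with respect to an orthonormal basis $\phi_0,\phi_1,\ldots$ of that space if $\phi_i$ lies in the domain of $A$ (i.e. $\|A\phi_i\|<\infty$) for all $i$. The matrix is $[A_\infty]_{i,j}=\langle\phi_i,A\phi_j\rangle$. By standing convention, $A_\infty$ is then regarded as an operator on $\ell^2$ acting by matrix multiplication with domain $D(A_\infty)=\{v\in\ell^2:\|A_\infty v\|<\infty\}$, this operator is self-adjoint, and it is identified with $A$ under the isomorphism $v\mapsto\sum_i v_i\phi_i$ (so that $D(A_\infty)$ corresponds to $D(A)$). Let $E(t)$ be the (right-continuous) spectral family of $A$. A function $f$ is Riemann--Stieltjes integrable on $[a,b]$ with respect to a non-decreasing $\rho$ if the sums $\sum_kf(\xi_k)(\rho(t_k)-\rho(t_{k-1}))$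 converge for all partitions $a=t_0<\dots<t_n=b$ with mesh tending to $0$ and any $\xi_k\in[t_{k-1},t_k]$. $f$ is Riemann--Stieltjes integrable with respect to the self-adjoint operator $A$ if, over every finite interval with endpoints that are not eigenvalues of $A$, it is Riemann--Stieltjes integrable with respect to $\|E(t)\phi\|^2$ for all $\phi$ in the Hilbert space. *)

theory Defs
  imports "HOL-Analysis.Elementary_Topology" "HOL-Analysis.L2_Norm"
    "Jordan_Normal_Form.Schur_Decomposition"
begin

section \<open>Complex Hilbert spaces\<close>

text \<open>The inner product is linear in its second argument. Completeness comes from class
  \<open>banach\<close>; positive definiteness follows from the norm axiom.\<close>

class chilbert_space = banach +
  fixes scaleC :: "complex \<Rightarrow> 'a \<Rightarrow> 'a"  (infixr "*\<^sub>C" 75)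
    and cinner :: "'a \<Rightarrow> 'a \<Rightarrow> complex"
  assumes scaleC_of_real: "complex_of_real r *\<^sub>C x = r *\<^sub>R x"
    and scaleC_add_right: "c *\<^sub>C (x + y) = c *\<^sub>C x + c *\<^sub>C y"
    and scaleC_add_left: "(c + d) *\<^sub>C x = c *\<^sub>C x + d *\<^sub>C x"
    and scaleC_scaleC: "c *\<^sub>C d *\<^sub>C x = (c * d) *\<^sub>C x"
    and cinner_commute: "cinner x y = cnj (cinner y x)"
    and cinner_add_right: "cinner x (y + z) = cinner x y + cinner x z"
    and cinner_scaleC_right: "cinner x (c *\<^sub>C y) = c * cinner x y"
    and norm_eq_sqrt_cinner: "norm x = sqrt (Re (cinner x x))"

section \<open>The Hilbert space of square-summable sequences\<close>

typedef ell2 = "{x :: nat \<Rightarrow> complex. summable (\<lambda>i. (cmod (x i))\<^sup>2)}"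
  morphisms coord Abs_ell2
  by (rule exI[of _ "\<lambda>_. 0"]) simp

setup_lifting type_definition_ell2

lemma summable_coord: "summable (\<lambda>i. (cmod (coord x i))\<^sup>2)"
  using coord[of x] by simp

lemma ell2_bounded_L2_set:
  assumes "\<And>n. L2_set (\<lambda>i. cmod (x i)) {..<n} \<le> B"
  shows "summable (\<lambda>i. (cmod (x i))\<^sup>2)" and "sqrt (\<Sum>i. (cmod (x i))\<^sup>2) \<le> B"
proof -
  have B: "0 \<le> B" using assms[of 0] by simp
  have *: "(\<Sum>i<n. (cmod (x i))\<^sup>2) \<le> B\<^sup>2" for n
    using assms[of n] by (simp add: L2_set_def sqrt_le_D)
  show s: "summable (\<lambda>i. (cmod (x i))\<^sup>2)"
    by (rule summableI_nonneg_bounded[OF _ *]) simp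
  have "(\<Sum>i. (cmod (x i))\<^sup>2) \<le> B\<^sup>2"
    by (rule suminf_le_const[OF s *])
  then show "sqrt (\<Sum>i. (cmod (x i))\<^sup>2) \<le> B"
    using B by (simp add: real_le_lsqrt suminf_nonneg s)
qed

lemma ell2_L2_set_le:
  assumes "summable (\<lambda>i. (cmod (x i))\<^sup>2)"
  shows "L2_set (\<lambda>i. cmod (x i)) {..<n} \<le> sqrt (\<Sum>i. (cmod (x i))\<^sup>2)"
  unfolding L2_set_def using assms by (auto intro!: real_sqrt_le_mono sum_le_suminf)

lemma ell2_triangle_aux:
  assumes x: "summable (\<lambda>i. (cmod (x i))\<^sup>2)" and y: "summable (\<lambda>i. (cmod (y i))\<^sup>2)"
  shows "L2_set (\<lambda>i. cmod (x i + y i)) {..<n}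
    \<le> sqrt (\<Sum>i. (cmod (x i))\<^sup>2) + sqrt (\<Sum>i. (cmod (y i))\<^sup>2)"
proof -
  have "L2_set (\<lambda>i. cmod (x i + y i)) {..<n} \<le> L2_set (\<lambda>i. cmod (x i) + cmod (y i)) {..<n}"
    by (rule L2_set_mono) (auto simp: norm_triangle_ineq)
  also have "\<dots> \<le> L2_set (\<lambda>i. cmod (x i)) {..<n} + L2_set (\<lambda>i. cmod (y i)) {..<n}"
    by (rule L2_set_triangle_ineq)
  finally show ?thesis using ell2_L2_set_le[OF x, of n] ell2_L2_set_le[OF y, of n] by linarith
qed

lemma summable_cinner_ell2:
  assumes x: "summable (\<lambda>i. (cmod (x i))\<^sup>2)" and y: "summable (\<lambda>i. (cmod (y i))\<^sup>2)"
  shows "summable (\<lambda>i. cnj (x i) * y i)"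
proof (rule summable_comparison_test[OF _ summable_add[OF x y]], intro exI allI impI)
  fix i
  have "2 * (cmod (x i) * cmod (y i)) \<le> (cmod (x i))\<^sup>2 + (cmod (y i))\<^sup>2"
    using sum_squares_bound[of "cmod (x i)" "cmod (y i)"] by (simp add: mult.assoc)
  moreover have "0 \<le> cmod (x i) * cmod (y i)" by simp
  ultimately show "cmod (cnj (x i) * y i) \<le> (cmod (x i))\<^sup>2 + (cmod (y i))\<^sup>2"
    unfolding norm_mult complex_mod_cnj by linarith
qed

instantiation ell2 :: real_normed_vector
begin

lift_definition zero_ell2 :: ell2 is "\<lambda>_. 0" by simp
lift_definition plus_ell2 :: "ell2 \<Rightarrow> ell2 \<Rightarrow> ell2" is "\<lambda>x y i. x i + y i"
  by (rule ell2_bounded_L2_set(1)[OF ell2_triangle_aux])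
lift_definition uminus_ell2 :: "ell2 \<Rightarrow> ell2" is "\<lambda>x i. - x i" by simp
lift_definition minus_ell2 :: "ell2 \<Rightarrow> ell2 \<Rightarrow> ell2" is "\<lambda>x y i. x i - y i"
  subgoal for x y
    using ell2_bounded_L2_set(1)[OF ell2_triangle_aux, of x "\<lambda>i. - y i"] by simp
  done
lift_definition scaleR_ell2 :: "real \<Rightarrow> ell2 \<Rightarrow> ell2" is "\<lambda>r x i. complex_of_real r * x i"
  by (simp add: norm_mult power_mult_distrib summable_mult)
lift_definition norm_ell2 :: "ell2 \<Rightarrow> real" is "\<lambda>x. sqrt (\<Sum>i. (cmod (x i))\<^sup>2)" .

definition dist_ell2 :: "ell2 \<Rightarrow> ell2 \<Rightarrow> real" where "dist_ell2 x y = norm (x - y)"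
definition sgn_ell2 :: "ell2 \<Rightarrow> ell2" where "sgn_ell2 x = inverse (norm x) *\<^sub>R x"
definition uniformity_ell2 :: "(ell2 \<times> ell2) filter" where
  "uniformity_ell2 = (INF e\<in>{0<..}. principal {(x, y). dist x y < e})"
definition open_ell2 :: "ell2 set \<Rightarrow> bool" where
  "open_ell2 U \<longleftrightarrow> (\<forall>x\<in>U. \<forall>\<^sub>F (x', y) in uniformity. x' = x \<longrightarrow> y \<in> U)"

instance
proof
  fix x y z :: ell2 and a b :: real and U :: "ell2 set"
  show "x + y + z = x + (y + z)" by transfer (simp add: add.assoc)
  show "x + y = y + x" by transfer (simp add: add.commute)
  show "0 + x = x" by transfer simp
  show "- x + x = 0" by transfer simp
  show "x - y = x + - y" by transfer simp
  show "a *\<^sub>R (x + y) = a *\<^sub>R x + a *\<^sub>R y" by transfer (simp add: algebra_simps)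
  show "(a + b) *\<^sub>R x = a *\<^sub>R x + b *\<^sub>R x" by transfer (simp add: algebra_simps)
  show "a *\<^sub>R b *\<^sub>R x = (a * b) *\<^sub>R x" by transfer (simp add: algebra_simps)
  show "1 *\<^sub>R x = x" by transfer simp
  show "dist x y = norm (x - y)" by (rule dist_ell2_def)
  show "sgn x = inverse (norm x) *\<^sub>R x" by (rule sgn_ell2_def)
  show "uniformity = (INF e\<in>{0<..}. principal {(x :: ell2, y). dist x y < e})"
    by (rule uniformity_ell2_def)
  show "open U \<longleftrightarrow> (\<forall>x\<in>U. \<forall>\<^sub>F (x', y) in uniformity. x' = x \<longrightarrow> y \<in> U)"
    by (rule open_ell2_def)
  show "norm x = 0 \<longleftrightarrow> x = 0"
    by transfer (auto simp: suminf_eq_zero_iff)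
  show "norm (x + y) \<le> norm x + norm y"
    by transfer (rule ell2_bounded_L2_set(2)[OF ell2_triangle_aux])
  show "norm (a *\<^sub>R x) = \<bar>a\<bar> * norm x"
    by transfer (simp add: norm_mult power_mult_distrib suminf_mult real_sqrt_mult)
qed

end

lemma L2_set_coord_le: "L2_set (\<lambda>i. cmod (coord x i)) {..<n} \<le> norm x"
  unfolding norm_ell2.rep_eq by (rule ell2_L2_set_le[OF summable_coord])

lemma cmod_coord_le: "cmod (coord x i) \<le> norm x"
proof -
  have "cmod (coord x i) \<le> L2_set (\<lambda>i. cmod (coord x i)) {..<Suc i}"
    by (rule member_le_L2_set) auto
  then show ?thesis using L2_set_coord_le[of x "Suc i"] by linarith
qed

instance ell2 :: banach
proof
  fix X :: "nat \<Rightarrow> ell2"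
  assume X: "Cauchy X"
  have "Cauchy (\<lambda>k. coord (X k) i)" for i
  proof (rule metric_CauchyI)
    fix e :: real assume "0 < e"
    then obtain M where M: "dist (X m) (X n) < e" if "m \<ge> M" "n \<ge> M" for m n
      using metric_CauchyD[OF X] by blast
    have "dist (coord (X m) i) (coord (X n) i) \<le> dist (X m) (X n)" for m n
      using cmod_coord_le[of "X m - X n" i] by (simp add: dist_norm minus_ell2.rep_eq)
    then show "\<exists>M. \<forall>m\<ge>M. \<forall>n\<ge>M. dist (coord (X m) i) (coord (X n) i) < e"
      using M by (meson le_less_trans)
  qed
  then have "\<forall>i. \<exists>l. (\<lambda>k. coord (X k) i) \<longlonglongrightarrow> l"
    by (simp add: Cauchy_convergent_iff convergent_def)
  then obtain l where l: "\<And>i. (\<lambda>k. coord (X k) i) \<longlonglongrightarrow> l i" by metis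
  have bd: "L2_set (\<lambda>i. cmod (coord (X m) i - l i)) {..<N} \<le> e"
    if M: "\<And>m n. m \<ge> M \<Longrightarrow> n \<ge> M \<Longrightarrow> dist (X m) (X n) < e" and m: "m \<ge> M" for e M m N
  proof (rule tendsto_upperbound)
    show "(\<lambda>k. L2_set (\<lambda>i. cmod (coord (X m) i - coord (X k) i)) {..<N})
      \<longlonglongrightarrow> L2_set (\<lambda>i. cmod (coord (X m) i - l i)) {..<N}"
      unfolding L2_set_def by (intro tendsto_intros l)
    have "L2_set (\<lambda>i. cmod (coord (X m) i - coord (X k) i)) {..<N} \<le> e" if "k \<ge> M" for k
      using L2_set_coord_le[of "X m - X k" N] M[OF m that] by (simp add: dist_norm minus_ell2.rep_eq)
    then show "\<forall>\<^sub>F k in sequentially.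
        L2_set (\<lambda>i. cmod (coord (X m) i - coord (X k) i)) {..<N} \<le> e"
      by (rule eventually_sequentiallyI)
  qed simp
  obtain M1 where M1: "\<And>m n. m \<ge> M1 \<Longrightarrow> n \<ge> M1 \<Longrightarrow> dist (X m) (X n) < 1"
    using metric_CauchyD[OF X, of 1] by auto
  have d: "summable (\<lambda>i. (cmod (coord (X M1) i - l i))\<^sup>2)"
    by (rule ell2_bounded_L2_set(1)[OF bd[OF M1]]) auto
  have "summable (\<lambda>i. (cmod (coord (X M1) i + - (coord (X M1) i - l i)))\<^sup>2)"
    by (rule ell2_bounded_L2_set(1)[OF ell2_triangle_aux[OF summable_coord]])
      (use d in \<open>simp add: norm_minus_commute\<close>)
  then have sl: "summable (\<lambda>i. (cmod (l i))\<^sup>2)" by simp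
  have "X \<longlonglongrightarrow> Abs_ell2 l"
  proof (rule metric_LIMSEQ_I)
    fix e :: real assume "0 < e"
    then obtain M where M: "\<And>m n. m \<ge> M \<Longrightarrow> n \<ge> M \<Longrightarrow> dist (X m) (X n) < e / 2"
      using metric_CauchyD[OF X, of "e / 2"] by auto
    have "dist (X m) (Abs_ell2 l) \<le> e / 2" if "m \<ge> M" for m
      using ell2_bounded_L2_set(2)[OF bd[OF M that]]
      by (simp add: dist_norm norm_ell2.rep_eq minus_ell2.rep_eq Abs_ell2_inverse sl)
    then show "\<exists>M. \<forall>m\<ge>M. dist (X m) (Abs_ell2 l) < e"
      using \<open>0 < e\<close> by (intro exI[of _ M]) fastforce
  qed
  then show "convergent X" by (rule convergentI)
qed

instantiation ell2 :: chilbert_space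
begin

lift_definition scaleC_ell2 :: "complex \<Rightarrow> ell2 \<Rightarrow> ell2" is "\<lambda>c x i. c * x i"
  by (simp add: norm_mult power_mult_distrib summable_mult)
lift_definition cinner_ell2 :: "ell2 \<Rightarrow> ell2 \<Rightarrow> complex" is "\<lambda>x y. \<Sum>i. cnj (x i) * y i" .

instance
proof
  fix x y z :: ell2 and c d :: complex and r :: real
  show "complex_of_real r *\<^sub>C x = r *\<^sub>R x" by transfer simp
  show "c *\<^sub>C (x + y) = c *\<^sub>C x + c *\<^sub>C y" by transfer (simp add: algebra_simps)
  show "(c + d) *\<^sub>C x = c *\<^sub>C x + d *\<^sub>C x" by transfer (simp add: algebra_simps)
  show "c *\<^sub>C d *\<^sub>C x = (c * d) *\<^sub>C x" by transfer (simp add: algebra_simps)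
  show "cinner x y = cnj (cinner y x)"
  proof transfer
    fix x y :: "nat \<Rightarrow> complex"
    assume "summable (\<lambda>i. (cmod (x i))\<^sup>2)" "summable (\<lambda>i. (cmod (y i))\<^sup>2)"
    then have "(\<lambda>i. cnj (y i) * x i) sums (\<Sum>i. cnj (y i) * x i)"
      by (intro summable_sums summable_cinner_ell2)
    then have "(\<lambda>i. cnj (cnj (y i) * x i)) sums cnj (\<Sum>i. cnj (y i) * x i)"
      by (simp only: sums_cnj)
    then show "(\<Sum>i. cnj (x i) * y i) = cnj (\<Sum>i. cnj (y i) * x i)"
      by (simp add: sums_iff mult.commute)
  qed
  show "cinner x (y + z) = cinner x y + cinner x z"
    by transfer (simp add: distrib_left suminf_add summable_cinner_ell2)
  show "cinner x (c *\<^sub>C y) = c * cinner x y"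
    by transfer (subst suminf_mult[OF summable_cinner_ell2, symmetric], auto simp: mult.left_commute)
  show "norm x = sqrt (Re (cinner x x))"
  proof transfer
    fix x :: "nat \<Rightarrow> complex"
    assume s: "summable (\<lambda>i. (cmod (x i))\<^sup>2)"
    have "Re (\<Sum>i. cnj (x i) * x i) = (\<Sum>i. Re (cnj (x i) * x i))"
      using s by (intro Re_suminf summable_cinner_ell2)
    also have "\<dots> = (\<Sum>i. (cmod (x i))\<^sup>2)"
      by (simp add: cmod_def power2_eq_square)
    finally show "sqrt (\<Sum>i. (cmod (x i))\<^sup>2) = sqrt (Re (\<Sum>i. cnj (x i) * x i))" by simp
  qed
qed

end

lift_definition ell2_basis :: "nat \<Rightarrow> ell2" is "\<lambda>i j. if j = i then 1 else 0"
  subgoal for i by (rule summable_finite[of "{i}"]) auto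
  done

definition ell2_0 :: "ell2 set" where
  "ell2_0 = {v. \<exists>c n. v = (\<Sum>i<n. c i *\<^sub>C ell2_basis i)}"

lift_definition ell2_of_vec :: "complex vec \<Rightarrow> ell2" is
  "\<lambda>w i. if i < dim_vec w then vec_index w i else 0"
  subgoal for w by (rule summable_finite[of "{..<dim_vec w}"]) auto
  done

section \<open>Unbounded operators\<close>

text \<open>An operator is given by its domain \<open>D\<close> and a total function \<open>A\<close> whose values outside \<open>D\<close>
  are irrelevant. The adjoint is represented by its graph.\<close>

definition clinear_on :: "'h::chilbert_space set \<Rightarrow> ('h \<Rightarrow> 'h) \<Rightarrow> bool" where
  "clinear_on D A \<longleftrightarrow> 0 \<in> D \<and>
     (\<forall>x\<in>D. \<forall>y\<in>D. x + y \<in> D \<and> A (x + y) = A x + A y) \<and>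
     (\<forall>c. \<forall>x\<in>D. c *\<^sub>C x \<in> D \<and> A (c *\<^sub>C x) = c *\<^sub>C A x)"

definition adjoint_graph :: "'h::chilbert_space set \<Rightarrow> ('h \<Rightarrow> 'h) \<Rightarrow> ('h \<times> 'h) set" where
  "adjoint_graph D A = {(y, z). \<forall>x\<in>D. cinner y (A x) = cinner z x}"

definition selfadjoint :: "'h::chilbert_space set \<Rightarrow> ('h \<Rightarrow> 'h) \<Rightarrow> bool" where
  "selfadjoint D A \<longleftrightarrow>
     clinear_on D A \<and> closure D = UNIV \<and> adjoint_graph D A = (\<lambda>x. (x, A x)) ` D"

definition eigenvalue_on :: "'h::chilbert_space set \<Rightarrow> ('h \<Rightarrow> 'h) \<Rightarrow> real \<Rightarrow> bool" where
  "eigenvalue_on D A l \<longleftrightarrow> (\<exists>x\<in>D. x \<noteq> 0 \<and> A x = l *\<^sub>R x)"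

section \<open>Riemann--Stieltjes integrals\<close>

text \<open>The integrator may be vector valued, so that the same notion covers integration with respect
  to \<open>t \<mapsto> \<parallel>E(t)x\<parallel>\<^sup>2\<close> and with respect to \<open>t \<mapsto> E(t)x\<close>.\<close>

definition has_RS_integral ::
    "(real \<Rightarrow> real) \<Rightarrow> (real \<Rightarrow> 'b::real_normed_vector) \<Rightarrow> real \<Rightarrow> real \<Rightarrow> 'b \<Rightarrow> bool" where
  "has_RS_integral f g a b I \<longleftrightarrow>
     (\<forall>\<epsilon>>0. \<exists>\<delta>>0. \<forall>n t \<xi>.
        t 0 = a \<and> t n = b \<and>
        (\<forall>k<n. t k < t (Suc k) \<and> t (Suc k) - t k < \<delta> \<and> t k \<le> \<xi> k \<and> \<xi> k \<le> t (Suc k)) \<longrightarrow>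
        norm ((\<Sum>k<n. f (\<xi> k) *\<^sub>R (g (t (Suc k)) - g (t k))) - I) < \<epsilon>)"

definition RS_integrable :: "(real \<Rightarrow> real) \<Rightarrow> (real \<Rightarrow> real) \<Rightarrow> real \<Rightarrow> real \<Rightarrow> bool" where
  "RS_integrable f \<rho> a b \<longleftrightarrow> (\<exists>I. has_RS_integral f \<rho> a b I)"

section \<open>Spectral families and functions of self-adjoint operators\<close>

definition orthogonal_projection :: "('h::chilbert_space \<Rightarrow> 'h) \<Rightarrow> bool" where
  "orthogonal_projection P \<longleftrightarrow>
     clinear_on UNIV P \<and> (\<forall>x. P (P x) = P x) \<and> (\<forall>x y. cinner (P x) y = cinner x (P y))"

definition spectral_family :: "(real \<Rightarrow> 'h::chilbert_space \<Rightarrow> 'h) \<Rightarrow> bool" where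
  "spectral_family E \<longleftrightarrow>
     (\<forall>t. orthogonal_projection (E t)) \<and>
     (\<forall>s t x. s \<le> t \<longrightarrow> E s (E t x) = E s x) \<and>
     (\<forall>t x. ((\<lambda>s. E s x) \<longlongrightarrow> E t x) (at_right t)) \<and>
     (\<forall>x. ((\<lambda>t. E t x) \<longlongrightarrow> 0) at_bot) \<and>
     (\<forall>x. ((\<lambda>t. E t x) \<longlongrightarrow> x) at_top)"

text \<open>\<open>has_spectral_integral E f x y\<close>: the vector \<open>x\<close> is in the domain of the operator
  \<open>\<integral> f(t) dE(t)\<close>, which maps it to \<open>y\<close>. The integral over the real line is improper, the
  limit being taken in the norm as the endpoints go to \<open>-\<infinity>\<close> and \<open>\<infinity>\<close> independently.\<close>

definition has_spectral_integral ::
    "(real \<Rightarrow> 'h::chilbert_space \<Rightarrow> 'h) \<Rightarrow> (real \<Rightarrow> real) \<Rightarrow> 'h \<Rightarrow> 'h \<Rightarrow> bool" where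
  "has_spectral_integral E f x y \<longleftrightarrow>
     (\<exists>J. (\<forall>a b. a < b \<longrightarrow> has_RS_integral f (\<lambda>t. E t x) a b (J a b)) \<and>
          ((\<lambda>(a, b). J a b) \<longlongrightarrow> y) (at_bot \<times>\<^sub>F at_top))"

text \<open>\<open>E\<close> is the spectral family of \<open>A\<close>, that is, \<open>A = \<integral> t dE(t)\<close> with equality of domains.
  By the spectral theorem every self-adjoint operator has exactly one spectral family, so
  the existential quantifiers over \<open>E\<close> below select that family.\<close>

definition spectral_family_of ::
    "'h::chilbert_space set \<Rightarrow> ('h \<Rightarrow> 'h) \<Rightarrow> (real \<Rightarrow> 'h \<Rightarrow> 'h) \<Rightarrow> bool" where
  "spectral_family_of D A E \<longleftrightarrow> spectral_family E \<and>
     (\<forall>x y. has_spectral_integral E (\<lambda>t. t) x y \<longleftrightarrow> x \<in> D \<and> A x = y)"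

definition RS_integrable_operator ::
    "(real \<Rightarrow> real) \<Rightarrow> 'h::chilbert_space set \<Rightarrow> ('h \<Rightarrow> 'h) \<Rightarrow> bool" where
  "RS_integrable_operator f D A \<longleftrightarrow>
     (\<exists>E. spectral_family_of D A E \<and>
       (\<forall>a b. a < b \<and> \<not> eigenvalue_on D A a \<and> \<not> eigenvalue_on D A b \<longrightarrow>
         (\<forall>x. RS_integrable f (\<lambda>t. (norm (E t x))\<^sup>2) a b)))"

definition operator_fun ::
    "(real \<Rightarrow> real) \<Rightarrow> 'h::chilbert_space set \<Rightarrow> ('h \<Rightarrow> 'h) \<Rightarrow> 'h \<Rightarrow> 'h" where
  "operator_fun f D A x =
     (THE y. \<exists>E. spectral_family_of D A E \<and> has_spectral_integral E f x y)"

section \<open>Functions of Hermitian matrices\<close>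

definition hermitian_mat_fun :: "(real \<Rightarrow> real) \<Rightarrow> complex mat \<Rightarrow> complex mat" where
  "hermitian_mat_fun f A =
     (THE B. \<exists>P d. P \<in> carrier_mat (dim_row A) (dim_row A) \<and>
        mat_adjoint P * P = 1\<^sub>m (dim_row A) \<and>
        A = P * mat_diag (dim_row A) (\<lambda>i. complex_of_real (d i)) * mat_adjoint P \<and>
        B = P * mat_diag (dim_row A) (\<lambda>i. complex_of_real (f (d i))) * mat_adjoint P)"

section \<open>Infinite matrices\<close>

definition orthonormal_basis :: "(nat \<Rightarrow> 'h::chilbert_space) \<Rightarrow> bool" where
  "orthonormal_basis \<phi> \<longleftrightarrow>
     (\<forall>i j. cinner (\<phi> i) (\<phi> j) = (if i = j then 1 else 0)) \<and>
     (\<forall>x. (\<lambda>i. cinner (\<phi> i) x *\<^sub>C \<phi> i) sums x)"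

definition inf_matrix :: "('h::chilbert_space \<Rightarrow> 'h) \<Rightarrow> (nat \<Rightarrow> 'h) \<Rightarrow> nat \<Rightarrow> nat \<Rightarrow> complex" where
  "inf_matrix A \<phi> i j = cinner (\<phi> i) (A (\<phi> j))"

definition inf_matrix_dom :: "(nat \<Rightarrow> nat \<Rightarrow> complex) \<Rightarrow> ell2 set" where
  "inf_matrix_dom M = {v. (\<forall>i. summable (\<lambda>j. M i j * coord v j)) \<and>
     summable (\<lambda>i. (cmod (\<Sum>j. M i j * coord v j))\<^sup>2)}"

definition inf_matrix_op :: "(nat \<Rightarrow> nat \<Rightarrow> complex) \<Rightarrow> ell2 \<Rightarrow> ell2" where
  "inf_matrix_op M v = Abs_ell2 (\<lambda>i. \<Sum>j. M i j * coord v j)"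

definition basis_iso :: "(nat \<Rightarrow> 'h::chilbert_space) \<Rightarrow> ell2 \<Rightarrow> 'h" where
  "basis_iso \<phi> v = (\<Sum>i. coord v i *\<^sub>C \<phi> i)"

text \<open>The last three conjuncts make the maximal matrix operator on \<open>\<ell>\<^sup>2\<close> self-adjoint and
  identify it with \<open>A\<close>. They do not follow from the basis lying in \<open>D\<close>: without them
  \<open>A\<close> could be one of several self-adjoint extensions of its restriction to the span of the
  basis, and the matrix would not determine it.\<close>

definition has_infinite_matrix ::
    "'h::chilbert_space set \<Rightarrow> ('h \<Rightarrow> 'h) \<Rightarrow> (nat \<Rightarrow> 'h) \<Rightarrow> bool" where
  "has_infinite_matrix D A \<phi> \<longleftrightarrow>
     orthonormal_basis \<phi> \<and> (\<forall>i. \<phi> i \<in> D) \<and>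
     (let M = inf_matrix A \<phi> in
       selfadjoint (inf_matrix_dom M) (inf_matrix_op M) \<and>
       basis_iso \<phi> ` inf_matrix_dom M = D \<and>
       (\<forall>v\<in>inf_matrix_dom M. basis_iso \<phi> (inf_matrix_op M v) = A (basis_iso \<phi> v)))"

text \<open>The truncations keep the indices \<open>0, \<dots>, n\<close>, so they have size \<open>n + 1\<close>.\<close>

definition trunc_matrix :: "(nat \<Rightarrow> nat \<Rightarrow> complex) \<Rightarrow> nat \<Rightarrow> complex mat" where
  "trunc_matrix M n = Matrix.mat (n + 1) (n + 1) (\<lambda>(i, j). M i j)"

definition trunc_vec :: "ell2 \<Rightarrow> nat \<Rightarrow> complex vec" where
  "trunc_vec v n = Matrix.vec (n + 1) (coord v)"

end

theory Submission
  imports Defs "HOL-Analysis.Weierstrass_Theorems" "HOL-Analysis.Infinite_Sum"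
    "HOL-Analysis.Continuum_Not_Denumerable"
begin

text \<open>
  Let \<open>M\<close> be the matrix operator, \<open>M\<^sub>n\<close> its truncations and \<open>v\<close> a vector in \<open>\<ell>\<^sup>2\<^sub>0\<close>. Two sequences
  of discrete functional calculi are compared: \<open>g \<mapsto> g(M\<^sub>n)\<close>, extended by zero to \<open>\<ell>\<^sup>2\<close>, and
  \<open>g \<mapsto> \<Sum>\<^sub>k g(t\<^sub>k) (E(t\<^sub>k\<^sub>+\<^sub>1) - E(t\<^sub>k))\<close> on ever finer and longer grids. Both are multiplicative and
  monotone in \<open>|g|\<close>, and for both the identity function converges on \<open>\<ell>\<^sup>2\<^sub>0\<close> to \<open>M\<close>.

  Self-adjointness of the maximal matrix operator makes \<open>(M - \<i>) \<ell>\<^sup>2\<^sub>0\<close> and \<open>(M + \<i>) \<ell>\<^sup>2\<^sub>0\<close> dense, as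
  a vector orthogonal to one of them would be an eigenvector with a non-real eigenvalue
  (\<open>shifted_range_dense\<close>). Hence the resolvents converge strongly. By Stone-Weierstrass so do the
  continuous functions vanishing at infinity, and the identity
  \<open>g(t) = g(t) t / (1 + t\<^sup>2) \<cdot> t + g(t) / (1 + t\<^sup>2)\<close>, used twice, extends this first to bounded
  continuous functions and then, on \<open>\<ell>\<^sup>2\<^sub>0\<close>, to continuous functions of linear growth
  (\<open>convergent_linearly_bounded\<close>). Interleaving shows that the limit is the same for all sequences
  of calculi of this kind (\<open>calculus_sequence_same_limit\<close>).

  A function \<open>f\<close> that is only Riemann--Stieltjes integrable is enclosed between Lipschitz envelopes
  \<open>L \<le> f \<le> U\<close>. The limit of \<open>\<parallel>(U - L)(M\<^sub>n) v\<parallel>\<close> is computed on the grids instead: there it is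
  bounded by the oscillations of \<open>f\<close> on the cells, weighted with the increments of \<open>\<parallel>E(t)v\<parallel>\<^sup>2\<close>, and
  by a tail which is small because \<open>v\<close> is in the domain of \<open>M\<close>. By monotonicity \<open>f(M\<^sub>n)v\<close> is squeezed towards \<open>\<integral> f dE v\<close>
  (\<open>calculus_tendsto_spectral_integral\<close>).

  The squeezing applies to every spectral family of \<open>M\<close> and every value of the integral. Since
  limits are unique, so is the value, and \<open>f(M)v\<close> is well defined as soon as one such integral
  exists. For existence, the spectral family of \<open>A\<close> is transported along \<open>v \<mapsto> \<Sum>\<^sub>i v\<^sub>i \<phi>\<^sub>i\<close>.
  Integrability with respect to \<open>\<parallel>E(t)x\<parallel>\<^sup>2\<close> gives norm convergence of the vector-valued sums,
  because the squared norm of the difference of two such sums is again bounded by oscillation sums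
  (\<open>RS_Cauchy_vector\<close>). Intervals whose endpoints are eigenvalues are enlarged, there being only
  countably many eigenvalues, and the improper integral is dominated by \<open>\<integral> t dE\<close>
  (\<open>spectral_integral_exists\<close>).
\<close>

section \<open>Complex Hilbert spaces\<close>

lemma scaleC_zero_right [simp]: "c *\<^sub>C (0 :: 'h::chilbert_space) = 0"
  using scaleC_add_right[of c 0 "0 :: 'h"] by simp

lemma scaleC_zero_left [simp]: "0 *\<^sub>C (x :: 'h::chilbert_space) = 0"
  using scaleC_of_real[of 0 x] by simp

lemma scaleC_one [simp]: "1 *\<^sub>C (x :: 'h::chilbert_space) = x"
  using scaleC_of_real[of 1 x] by simp

lemma scaleC_minus_right: "c *\<^sub>C (- x) = - (c *\<^sub>C (x :: 'h::chilbert_space))"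
  using scaleC_add_right[of c x "- x"] by (simp add: eq_neg_iff_add_eq_0 add.commute)

lemma scaleC_minus_left: "(- c) *\<^sub>C x = - (c *\<^sub>C (x :: 'h::chilbert_space))"
  using scaleC_add_left[of c "- c" x] by (simp add: eq_neg_iff_add_eq_0 add.commute)

lemma scaleC_diff_right: "c *\<^sub>C (x - y) = c *\<^sub>C x - c *\<^sub>C (y :: 'h::chilbert_space)"
  using scaleC_add_right[of c x "- y"] by (simp add: scaleC_minus_right)

lemma scaleC_diff_left: "(c - d) *\<^sub>C x = c *\<^sub>C x - d *\<^sub>C (x :: 'h::chilbert_space)"
  using scaleC_add_left[of c "- d" x] by (simp add: scaleC_minus_left)

lemma scaleC_sum_right: "c *\<^sub>C (\<Sum>i\<in>K. x i) = (\<Sum>i\<in>K. c *\<^sub>C (x i :: 'h::chilbert_space))"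
  by (induction K rule: infinite_finite_induct) (auto simp: scaleC_add_right)

lemma cinner_zero_right [simp]: "cinner x (0 :: 'h::chilbert_space) = 0"
  using cinner_add_right[of x 0 "0 :: 'h"] by simp

lemma cinner_zero_left [simp]: "cinner (0 :: 'h::chilbert_space) x = 0"
  by (subst cinner_commute) simp

lemma cinner_minus_right: "cinner x (- y) = - cinner x (y :: 'h::chilbert_space)"
  using cinner_add_right[of x y "- y"] by (simp add: eq_neg_iff_add_eq_0 add.commute)

lemma cinner_diff_right: "cinner x (y - z) = cinner x y - cinner x (z :: 'h::chilbert_space)"
  using cinner_add_right[of x y "- z"] by (simp add: cinner_minus_right)

lemma cinner_sum_right:
  "cinner x (\<Sum>i\<in>K. y i) = (\<Sum>i\<in>K. cinner x (y i :: 'h::chilbert_space))"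
  by (induction K rule: infinite_finite_induct) (auto simp: cinner_add_right)

lemma cinner_add_left: "cinner (x + y) z = cinner x z + cinner y (z :: 'h::chilbert_space)"
  by (metis cinner_commute cinner_add_right complex_cnj_add)

lemma cinner_diff_left: "cinner (x - y) z = cinner x z - cinner y (z :: 'h::chilbert_space)"
  by (metis cinner_commute cinner_diff_right complex_cnj_diff)

lemma cinner_scaleC_left: "cinner (c *\<^sub>C x) y = cnj c * cinner x (y :: 'h::chilbert_space)"
  by (metis cinner_commute cinner_scaleC_right complex_cnj_mult)

lemma cinner_self: "cinner x x = complex_of_real ((norm (x :: 'h::chilbert_space))\<^sup>2)"
proof (rule complex_eqI)
  have "0 \<le> sqrt (Re (cinner x x))"
    using norm_ge_zero[of x] by (simp only: norm_eq_sqrt_cinner[of x])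
  then have "0 \<le> Re (cinner x x)" by simp
  then show "Re (cinner x x) = Re (complex_of_real ((norm x)\<^sup>2))"
    by (simp add: norm_eq_sqrt_cinner[of x])
  show "Im (cinner x x) = Im (complex_of_real ((norm x)\<^sup>2))"
    using cinner_commute[of x x] by (metis Im_complex_of_real complex_cnj_cancel_iff
        complex_is_Real_iff Reals_cnj_iff)
qed

lemma norm_scaleC: "norm (c *\<^sub>C x) = cmod c * norm (x :: 'h::chilbert_space)"
proof -
  have "complex_of_real ((norm (c *\<^sub>C x))\<^sup>2) = complex_of_real ((cmod c * norm x)\<^sup>2)"
    by (simp only: cinner_self[symmetric] cinner_scaleC_left cinner_scaleC_right)
      (simp add: cinner_self complex_norm_square power_mult_distrib ac_simps del: of_real_power)
  then have "(norm (c *\<^sub>C x))\<^sup>2 = (cmod c * norm x)\<^sup>2"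
    by (simp only: of_real_eq_iff)
  then show ?thesis
    by (rule power2_eq_imp_eq) auto
qed

lemma norm_add_square:
  "(norm (x + y))\<^sup>2 = (norm x)\<^sup>2 + (norm y)\<^sup>2 + 2 * Re (cinner x (y :: 'h::chilbert_space))"
proof -
  have "complex_of_real ((norm (x + y))\<^sup>2) = cinner x x + cinner y y + (cinner x y + cinner y x)"
    by (simp only: cinner_self[symmetric] cinner_add_left cinner_add_right) simp
  also have "cinner x y + cinner y x = complex_of_real (2 * Re (cinner x y))"
    by (subst (2) cinner_commute) (rule complex_add_cnj)
  finally show ?thesis
    unfolding cinner_self by (simp only: of_real_add[symmetric] of_real_eq_iff)
qed

lemma norm_diff_square:
  "(norm (x - y))\<^sup>2 = (norm x)\<^sup>2 + (norm y)\<^sup>2 - 2 * Re (cinner x (y :: 'h::chilbert_space))"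
  using norm_add_square[of x "- y"] by (simp add: cinner_minus_right)

lemma Cauchy_Schwarz_cinner: "cmod (cinner x y) \<le> norm x * norm (y :: 'h::chilbert_space)"
proof (cases "y = 0")
  case False
  then have y: "0 < (norm y)\<^sup>2" by simp
  define c where "c = cinner y x / complex_of_real ((norm y)\<^sup>2)"
  have c: "c * complex_of_real ((norm y)\<^sup>2) = cinner y x"
    using y by (simp add: c_def)
  have mc: "cmod c * (norm y)\<^sup>2 = cmod (cinner y x)"
    using y by (simp add: c_def norm_divide norm_power)
  have "Re (cinner x (c *\<^sub>C y)) = Re (c * cnj (cinner y x))"
    by (simp only: cinner_scaleC_right) (metis cinner_commute)
  also have "\<dots> = (cmod c)\<^sup>2 * (norm y)\<^sup>2"
    unfolding c[symmetric] complex_cnj_mult complex_cnj_complex_of_real mult.assoc[symmetric]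
      complex_norm_square[symmetric] by (simp only: Re_complex_of_real of_real_mult[symmetric])
  finally have "0 \<le> (norm x)\<^sup>2 - (cmod c)\<^sup>2 * (norm y)\<^sup>2"
    using zero_le_power2[of "norm (x - c *\<^sub>C y)"]
    by (simp add: norm_diff_square norm_scaleC power_mult_distrib mult.commute)
  then have "(cmod c)\<^sup>2 * (norm y)\<^sup>2 * (norm y)\<^sup>2 \<le> (norm x)\<^sup>2 * (norm y)\<^sup>2"
    using y by (intro mult_right_mono) auto
  then have "(cmod (cinner y x))\<^sup>2 \<le> (norm x * norm y)\<^sup>2"
    unfolding mc[symmetric] by (simp add: power_mult_distrib power2_eq_square ac_simps)
  then have "cmod (cinner y x) \<le> norm x * norm y"
    by (rule power2_le_imp_le) simp
  then show ?thesis
    by (subst cinner_commute) simp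
qed simp

lemma norm_sum_orthogonal_square:
  assumes "finite K" and "\<And>i j. i \<in> K \<Longrightarrow> j \<in> K \<Longrightarrow> i \<noteq> j \<Longrightarrow> cinner (x i) (x j) = 0"
  shows "(norm (\<Sum>i\<in>K. x i :: 'h::chilbert_space))\<^sup>2 = (\<Sum>i\<in>K. (norm (x i))\<^sup>2)"
  using assms
proof (induction K rule: finite_induct)
  case (insert k K)
  have "cinner (x k) (\<Sum>i\<in>K. x i) = 0"
    unfolding cinner_sum_right using insert by (intro sum.neutral) auto
  then show ?case
    using insert by (simp add: norm_add_square)
qed simp

lemma bounded_linear_cinner: "bounded_linear (cinner (x :: 'h::chilbert_space))"
proof (rule bounded_linear_intro)
  fix y z :: 'h and r :: real
  show "cinner x (y + z) = cinner x y + cinner x z" by (rule cinner_add_right)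
  show "cinner x (r *\<^sub>R y) = r *\<^sub>R cinner x y"
    unfolding scaleC_of_real[symmetric] cinner_scaleC_right by (simp add: scaleR_conv_of_real)
  show "norm (cinner x y) \<le> norm y * norm x"
    using Cauchy_Schwarz_cinner[of x y] by (simp add: mult.commute)
qed

lemma bounded_linear_scaleC: "bounded_linear (scaleC c :: 'h::chilbert_space \<Rightarrow> 'h)"
proof (rule bounded_linear_intro)
  fix y z :: 'h and r :: real
  show "c *\<^sub>C (y + z) = c *\<^sub>C y + c *\<^sub>C z" by (rule scaleC_add_right)
  show "c *\<^sub>C r *\<^sub>R y = r *\<^sub>R c *\<^sub>C y"
    unfolding scaleC_of_real[symmetric] scaleC_scaleC by (simp add: mult.commute)
  show "norm (c *\<^sub>C y) \<le> norm y * cmod c"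
    by (simp add: norm_scaleC)
qed

definition csubspace :: "'h::chilbert_space set \<Rightarrow> bool" where
  "csubspace S \<longleftrightarrow> 0 \<in> S \<and> (\<forall>x\<in>S. \<forall>y\<in>S. x + y \<in> S) \<and> (\<forall>c. \<forall>x\<in>S. c *\<^sub>C x \<in> S)"

lemma csubspace_sum:
  assumes "csubspace S" "\<And>i. i \<in> K \<Longrightarrow> x i \<in> S"
  shows "(\<Sum>i\<in>K. x i) \<in> S"
  using assms(2) by (induction K rule: infinite_finite_induct)
    (use assms(1) in \<open>auto simp: csubspace_def\<close>)

text \<open>Otherwise subtracting from \<open>r\<close> its component along \<open>x\<close> would shorten it.\<close>

lemma orthogonal_if_shortest:
  assumes "\<And>c. norm r \<le> norm (r - c *\<^sub>C x)"
  shows "cinner x (r :: 'h::chilbert_space) = 0"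
proof (cases "x = 0")
  case False
  then have x: "0 < (norm x)\<^sup>2" by simp
  define c where "c = cinner x r / complex_of_real ((norm x)\<^sup>2)"
  have c: "cinner x r = c * complex_of_real ((norm x)\<^sup>2)"
    using x by (simp add: c_def)
  have "Re (cinner r (c *\<^sub>C x)) = Re (c * cnj (cinner x r))"
    by (simp only: cinner_scaleC_right) (metis cinner_commute)
  also have "\<dots> = (cmod c)\<^sup>2 * (norm x)\<^sup>2"
    unfolding c complex_cnj_mult complex_cnj_complex_of_real mult.assoc[symmetric]
      complex_norm_square[symmetric] by (simp only: Re_complex_of_real of_real_mult[symmetric])
  finally have "(norm (r - c *\<^sub>C x))\<^sup>2 = (norm r)\<^sup>2 - (cmod c)\<^sup>2 * (norm x)\<^sup>2"
    by (simp add: norm_diff_square norm_scaleC power_mult_distrib)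
  moreover have "(norm r)\<^sup>2 \<le> (norm (r - c *\<^sub>C x))\<^sup>2"
    using assms[of c] by (intro power_mono) auto
  ultimately have "(cmod c)\<^sup>2 * (norm x)\<^sup>2 \<le> 0" by linarith
  then have "c = 0" using x by (simp add: mult_le_0_iff)
  then show ?thesis by (simp add: c)
qed simp

text \<open>A point outside the closure of a subspace has a nearest point in that closure: by the
  parallelogram law every minimising sequence is Cauchy. The difference of the two is a
  nonzero vector orthogonal to the subspace.\<close>

lemma csubspace_dense:
  assumes S: "csubspace S" and orth: "\<And>y :: 'h::chilbert_space. (\<forall>x\<in>S. cinner x y = 0) \<Longrightarrow> y = 0"
  shows "closure S = UNIV"
proof -
  have "w \<in> closure S" for w
  proof -
    define d where "d = infdist w S"
    have S0: "S \<noteq> {}" using S by (auto simp: csubspace_def)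
    have d0: "0 \<le> d" by (simp add: d_def infdist_nonneg)
    have dle: "d \<le> norm (w - x)" if "x \<in> S" for x
      unfolding d_def using infdist_le[OF that, of w] by (simp add: dist_norm)
    have "\<exists>x\<in>S. norm (w - x) < d + 1 / Suc n" for n
    proof -
      have "infdist w S < d + 1 / Suc n" by (simp add: d_def)
      then show ?thesis
        by (subst (asm) infdist_notempty[OF S0])
          (auto simp: cINF_less_iff[OF S0] dist_norm bdd_belowI2[of _ 0])
    qed
    then obtain s where s: "\<And>n. s n \<in> S" "\<And>n. norm (w - s n) < d + 1 / Suc n"
      by metis
    have par: "(norm (s m - s n))\<^sup>2 \<le> (2 * d + 1) * (4 * e)"
      if "norm (w - s m) \<le> d + e" "norm (w - s n) \<le> d + e" "e \<le> 1/2" "0 \<le> e" for m n e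
    proof -
      let ?a = "w - s m" and ?b = "w - s n"
      have "(1/2) *\<^sub>C (s m + s n) \<in> S"
        using S s unfolding csubspace_def by blast
      then have "d \<le> norm (w - (1/2) *\<^sub>C (s m + s n))" by (rule dle)
      moreover have "?a + ?b = 2 *\<^sub>C (w - (1/2) *\<^sub>C (s m + s n))"
        using scaleC_add_left[of 1 1 w]
        by (simp add: scaleC_diff_right scaleC_scaleC)
      ultimately have "2 * d \<le> norm (?a + ?b)"
        by (simp add: norm_scaleC)
      then have "(2 * d)\<^sup>2 \<le> (norm (?a + ?b))\<^sup>2"
        using d0 by (intro power_mono) auto
      moreover have "(norm (?a - ?b))\<^sup>2 + (norm (?a + ?b))\<^sup>2 = 2 * (norm ?a)\<^sup>2 + 2 * (norm ?b)\<^sup>2"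
        using norm_add_square[of ?a ?b] norm_diff_square[of ?a ?b] by linarith
      moreover have "(norm ?a)\<^sup>2 \<le> (d + e)\<^sup>2" "(norm ?b)\<^sup>2 \<le> (d + e)\<^sup>2"
        using that by (auto intro: power_mono)
      moreover have "norm (?a - ?b) = norm (s m - s n)"
        by (simp add: norm_minus_commute)
      ultimately have "(norm (s m - s n))\<^sup>2 \<le> 4 * (d + e)\<^sup>2 - 4 * d\<^sup>2"
        by (simp add: power_mult_distrib)
      also have "\<dots> = (2 * d + e) * (4 * e)" by (simp add: power2_eq_square algebra_simps)
      also have "\<dots> \<le> (2 * d + 1) * (4 * e)"
        using that by (intro mult_right_mono) auto
      finally show ?thesis .
    qed
    have "Cauchy s"
    proof (rule metric_CauchyI)
      fix \<epsilon> :: real assume \<epsilon>: "0 < \<epsilon>"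
      define e where "e = min (1/2) (\<epsilon>\<^sup>2 / (8 * (2 * d + 1)))"
      have e: "0 < e" using \<epsilon> d0 by (auto simp: e_def)
      have e': "e \<le> 1/2" unfolding e_def by (rule min.cobounded1)
      have "(2 * d + 1) * (4 * e) \<le> (2 * d + 1) * (4 * (\<epsilon>\<^sup>2 / (8 * (2 * d + 1))))"
        using d0 by (intro mult_left_mono) (auto simp: e_def)
      also have "\<dots> = \<epsilon>\<^sup>2 / 2" using d0 by (simp add: field_simps)
      also have "\<dots> < \<epsilon>\<^sup>2" using \<epsilon> by simp
      finally have lt: "(2 * d + 1) * (4 * e) < \<epsilon>\<^sup>2" .
      obtain M where M: "1 / Suc M < e" using e nat_approx_posE by blast
      have b: "norm (w - s n) \<le> d + e" if "n \<ge> M" for n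
      proof -
        have "1 / real (Suc n) \<le> 1 / Suc M" using that by (simp add: field_simps)
        then show ?thesis using s(2)[of n] M by linarith
      qed
      have "dist (s m) (s n) < \<epsilon>" if "m \<ge> M" "n \<ge> M" for m n
      proof -
        have "(norm (s m - s n))\<^sup>2 < \<epsilon>\<^sup>2"
          using par[OF b[OF that(1)] b[OF that(2)]] e e' lt by linarith
        then show ?thesis
          using \<epsilon> power2_less_imp_less[of "norm (s m - s n)" \<epsilon>] by (simp add: dist_norm)
      qed
      then show "\<exists>M. \<forall>m\<ge>M. \<forall>n\<ge>M. dist (s m) (s n) < \<epsilon>" by blast
    qed
    then obtain p where p: "s \<longlonglongrightarrow> p"
      by (auto simp: Cauchy_convergent_iff convergent_def)
    have "norm (w - p) \<le> d"
    proof (rule LIMSEQ_le[OF tendsto_norm[OF tendsto_diff[OF tendsto_const p]]])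
      have "(\<lambda>n. d + 1 / Suc n) \<longlonglongrightarrow> d + 0"
        by (intro tendsto_add tendsto_const LIMSEQ_Suc[OF lim_1_over_n])
      then show "(\<lambda>n. d + 1 / Suc n) \<longlonglongrightarrow> d" by simp
      show "\<exists>N. \<forall>n\<ge>N. norm (w - s n) \<le> d + 1 / real (Suc n)"
        using s(2) less_imp_le by blast
    qed
    have "cinner x (w - p) = 0" if "x \<in> S" for x
    proof (rule orthogonal_if_shortest)
      fix c
      have "d \<le> norm (w - p - c *\<^sub>C x)"
      proof (rule LIMSEQ_le_const)
        show "(\<lambda>n. norm (w - s n - c *\<^sub>C x)) \<longlonglongrightarrow> norm (w - p - c *\<^sub>C x)"
          by (intro tendsto_intros p)
        have "d \<le> norm (w - (s n + c *\<^sub>C x))" for n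
          by (rule dle) (use S s that in \<open>auto simp: csubspace_def\<close>)
        then show "\<exists>N. \<forall>n\<ge>N. d \<le> norm (w - s n - c *\<^sub>C x)"
          by (simp add: diff_diff_eq)
      qed
      then show "norm (w - p) \<le> norm (w - p - c *\<^sub>C x)"
        using \<open>norm (w - p) \<le> d\<close> by linarith
    qed
    then have "w - p = 0" by (intro orth) auto
    then show ?thesis
      using p s(1) closure_sequential[of w S] by auto
  qed
  then show ?thesis by blast
qed

lemma clinear_onD:
  assumes "clinear_on UNIV P"
  shows "P 0 = 0" "P (x + y) = P x + P y" "P (c *\<^sub>C x) = c *\<^sub>C P x" "P (x - y) = P x - P y"
    "P (\<Sum>i\<in>K. z i) = (\<Sum>i\<in>K. P (z i))"
proof -
  show add: "P (x + y) = P x + P y" for x y using assms by (simp add: clinear_on_def)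
  show sc: "P (c *\<^sub>C x) = c *\<^sub>C P x" for c x using assms by (simp add: clinear_on_def)
  show z: "P 0 = 0" using add[of 0 0] by simp
  show "P (x - y) = P x - P y"
    using add[of x "(-1) *\<^sub>C y"] by (simp only: sc) (simp add: scaleC_minus_left)
  show "P (\<Sum>i\<in>K. z i) = (\<Sum>i\<in>K. P (z i))"
    by (induction K rule: infinite_finite_induct) (auto simp: add z)
qed

section \<open>Functional calculi and strong convergence\<close>

text \<open>These are the rules for \<open>g \<mapsto> g(A)\<close> when \<open>A\<close> has finitely many eigenvalues, restricted to the span
  of the eigenvectors. The constant \<open>1\<close> gives the projection onto that span, hence only a
  contraction.\<close>

locale functional_calculus =
  fixes \<Phi> :: "(real \<Rightarrow> complex) \<Rightarrow> 'h::chilbert_space \<Rightarrow> 'h"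
  assumes linear: "clinear_on UNIV (\<Phi> g)"
    and add: "\<Phi> (\<lambda>t. g t + h t) x = \<Phi> g x + \<Phi> h x"
    and scale: "\<Phi> (\<lambda>t. c * g t) x = c *\<^sub>C \<Phi> g x"
    and mult: "\<Phi> (\<lambda>t. g t * h t) x = \<Phi> g (\<Phi> h x)"
    and mono: "(\<And>t. cmod (g t) \<le> cmod (h t)) \<Longrightarrow> norm (\<Phi> g x) \<le> norm (\<Phi> h x)"
    and contraction: "norm (\<Phi> (\<lambda>_. 1) x) \<le> norm x"
begin

lemma minus: "\<Phi> (\<lambda>t. g t - h t) x = \<Phi> g x - \<Phi> h x"
  using add[of g "\<lambda>t. (-1) * h t" x] unfolding scale by (simp add: scaleC_minus_left)

lemma norm_le:
  assumes "\<And>t. cmod (g t) \<le> B"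
  shows "norm (\<Phi> g x) \<le> B * norm x"
proof -
  have B: "0 \<le> B" using norm_ge_zero[of "g 0"] assms[of 0] by linarith
  have "norm (\<Phi> g x) \<le> norm (\<Phi> (\<lambda>t. complex_of_real B * 1) x)"
    by (rule mono) (use assms B in simp)
  also have "\<dots> = B * norm (\<Phi> (\<lambda>_. 1) x)"
    unfolding scale norm_scaleC using B by simp
  also have "\<dots> \<le> B * norm x"
    by (rule mult_left_mono[OF contraction B])
  finally show ?thesis .
qed

end

lemma convergent_if_approximable:
  fixes X :: "nat \<Rightarrow> 'a::banach"
  assumes "\<And>\<epsilon>. 0 < \<epsilon> \<Longrightarrow> \<exists>Y. convergent Y \<and> (\<forall>n. norm (X n - Y n) \<le> \<epsilon>)"
  shows "convergent X"
proof -
  have "Cauchy X"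
  proof (rule metric_CauchyI)
    fix \<epsilon> :: real assume \<epsilon>: "0 < \<epsilon>"
    obtain Y where Y: "convergent Y" "\<And>n. norm (X n - Y n) \<le> \<epsilon> / 4"
      using assms[of "\<epsilon> / 4"] \<epsilon> by auto
    obtain M where M: "\<And>m n. m \<ge> M \<Longrightarrow> n \<ge> M \<Longrightarrow> dist (Y m) (Y n) < \<epsilon> / 4"
      using Y(1) \<epsilon> metric_CauchyD[of Y "\<epsilon> / 4"] by (auto simp: Cauchy_convergent_iff)
    have "dist (X m) (X n) < \<epsilon>" if "m \<ge> M" "n \<ge> M" for m n
    proof -
      have "dist (X m) (X n) \<le> dist (X m) (Y m) + dist (Y m) (Y n) + dist (X n) (Y n)"
        by metric
      also have "\<dots> < \<epsilon>"
        using Y(2)[of m] Y(2)[of n] M[OF that] \<epsilon> unfolding dist_norm by linarith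
      finally show ?thesis .
    qed
    then show "\<exists>M. \<forall>m\<ge>M. \<forall>n\<ge>M. dist (X m) (X n) < \<epsilon>" by blast
  qed
  then show ?thesis by (simp add: Cauchy_convergent_iff)
qed

definition resolvent_fun :: "real \<Rightarrow> complex" where
  "resolvent_fun t = 1 / (complex_of_real t - \<i>)"

lemma resolvent_fun_eq:
  "resolvent_fun t = Complex (t / (1 + t\<^sup>2)) (1 / (1 + t\<^sup>2))"
  by (simp add: resolvent_fun_def complex_eq_iff Re_divide Im_divide add.commute)

lemma cmod_resolvent_fun_square: "(cmod (resolvent_fun t))\<^sup>2 = 1 / (1 + t\<^sup>2)"
proof -
  have "(cmod (resolvent_fun t))\<^sup>2 = (t\<^sup>2 + 1) / (1 + t\<^sup>2)\<^sup>2"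
    by (simp add: resolvent_fun_eq cmod_power2 power_divide add_divide_distrib)
  also have "\<dots> = 1 / (1 + t\<^sup>2)"
    using zero_le_power2[of t] by (simp add: power2_eq_square divide_simps)
  finally show ?thesis .
qed

lemma cmod_resolvent_fun_le: "cmod (resolvent_fun t) \<le> 1"
proof -
  have "1 / (1 + t\<^sup>2) \<le> 1 / 1"
    by (intro divide_left_mono) (auto simp: add_pos_nonneg)
  then have "(cmod (resolvent_fun t))\<^sup>2 \<le> 1\<^sup>2" by (simp add: cmod_resolvent_fun_square)
  then show ?thesis by (rule power2_le_imp_le) simp
qed

lemma resolvent_fun_mult: "resolvent_fun t * (complex_of_real t - \<i>) = 1"
proof -
  have "complex_of_real t - \<i> \<noteq> 0" by (simp add: complex_eq_iff)
  then show ?thesis by (simp add: resolvent_fun_def)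
qed

text \<open>The map \<open>t \<mapsto> 1 / (t - \<i>)\<close> takes the real line, completed by \<open>\<infinity> \<mapsto> 0\<close>, onto the circle
  \<open>|z|\<^sup>2 = Im z\<close>. A continuous function vanishing at infinity thus becomes a continuous function on
  a compact set, to which the Stone-Weierstrass theorem applies.\<close>

lemma uniform_approx_resolvent_polynomial:
  fixes h :: "real \<Rightarrow> real"
  assumes h: "continuous_on UNIV h" and lim: "(h \<longlongrightarrow> 0) at_infinity" and \<epsilon>: "0 < \<epsilon>"
  shows "\<exists>p. real_polynomial_function p \<and> (\<forall>t. \<bar>h t - p (resolvent_fun t)\<bar> < \<epsilon>)"
proof -
  define S where "S = {z. (cmod z)\<^sup>2 = Im z}"
  define H where "H z = (if z = 0 then 0 else h (Re z / Im z))" for z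
  have "closed S"
    unfolding S_def by (intro closed_Collect_eq continuous_intros)
  moreover have "bounded S"
  proof -
    have "norm z \<le> 1" if "z \<in> S" for z
    proof -
      have "cmod z * cmod z \<le> cmod z * 1"
        using that abs_Im_le_cmod[of z] by (simp add: S_def power2_eq_square)
      then show ?thesis
        by (cases "z = 0") auto
    qed
    then show ?thesis by (auto simp: bounded_iff)
  qed
  ultimately have "compact S" by (simp add: compact_eq_bounded_closed)
  moreover have "continuous_on S H"
  proof (unfold continuous_on_eq_continuous_within, intro ballI)
    fix z assume z: "z \<in> S"
    show "continuous (at z within S) H"
    proof (cases "z = 0")
      case False
      have "isCont (\<lambda>z. h (Re z / Im z)) z"
      proof -
        have "Im z \<noteq> 0" using z False by (auto simp: S_def)
        then have "isCont (\<lambda>z. Re z / Im z) z"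
          by (intro isCont_divide continuous_Re continuous_Im continuous_ident)
        moreover have "isCont h (Re z / Im z)"
          using h continuous_on_eq_continuous_at[OF open_UNIV, of h] by blast
        ultimately show ?thesis
          by (rule isCont_o2)
      qed
      moreover have "\<forall>\<^sub>F w in nhds z. H w = h (Re w / Im w)"
        unfolding eventually_nhds
        by (rule exI[of _ "- {0}"]) (use False in \<open>simp add: H_def open_Compl\<close>)
      ultimately have "isCont H z"
        by (simp add: isCont_cong)
      then show ?thesis by (rule continuous_at_imp_continuous_at_within)
    next
      case True
      have "(H \<longlongrightarrow> 0) (at 0 within S)"
      proof (rule tendstoI)
        fix e :: real assume "0 < e"
        then obtain b where b: "0 < b" "\<And>t. norm t \<ge> b \<Longrightarrow> \<bar>h t\<bar> < e"
          using tendstoD[OF lim, of e] by (auto simp: eventually_at_infinity_pos)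
        have Hz: "\<bar>H z\<bar> < e" if z: "z \<in> S" "z \<noteq> 0" "(cmod z)\<^sup>2 * (1 + b\<^sup>2) < 1" for z
        proof -
          define s where "s = Im z"
          have s: "0 < s" "(Re z)\<^sup>2 + s\<^sup>2 = s"
          proof -
            show "(Re z)\<^sup>2 + s\<^sup>2 = s"
              using z(1) by (simp add: S_def cmod_power2 s_def)
            have "0 < (cmod z)\<^sup>2" using z(2) by simp
            moreover have "(cmod z)\<^sup>2 = s" using z(1) by (simp add: S_def s_def)
            ultimately show "0 < s" by simp
          qed
          have "(Re z)\<^sup>2 = s - s\<^sup>2" using s(2) by linarith
          then have "(Re z / s)\<^sup>2 = (s - s\<^sup>2) / s\<^sup>2"
            by (simp only: power_divide)
          also have "\<dots> = 1 / s - 1" using s(1) by (simp add: field_simps power2_eq_square)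
          finally have eq: "(Re z / s)\<^sup>2 = 1 / s - 1" .
          have "s * (1 + b\<^sup>2) < 1" using z by (simp add: S_def s_def)
          then have "1 + b\<^sup>2 < 1 / s" using s(1) by (simp add: pos_less_divide_eq mult.commute)
          then have "b\<^sup>2 < 1 / s - 1" by simp
          then have "b\<^sup>2 < \<bar>Re z / s\<bar>\<^sup>2" by (simp only: eq power2_abs)
          then have "b < \<bar>Re z / s\<bar>" by (rule power_less_imp_less_base) simp
          then show ?thesis using b(2)[of "Re z / s"] z(2) by (simp add: H_def s_def)
        qed
        have "\<forall>\<^sub>F z in at 0 within S. (cmod z)\<^sup>2 * (1 + b\<^sup>2) < 1"
        proof -
          have "((\<lambda>z. (cmod z)\<^sup>2 * (1 + b\<^sup>2)) \<longlongrightarrow> (cmod 0)\<^sup>2 * (1 + b\<^sup>2)) (at 0 within S)"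
            by (intro tendsto_intros)
          then show ?thesis by (rule order_tendstoD) simp
        qed
        moreover have "\<forall>\<^sub>F z in at 0 within S. z \<in> S \<and> z \<noteq> 0"
          by (auto simp: eventually_at_filter)
        ultimately show "\<forall>\<^sub>F z in at 0 within S. dist (H z) 0 < e"
          by eventually_elim (use Hz in auto)
      qed
      then show ?thesis by (simp add: True continuous_within H_def)
    qed
  qed
  ultimately obtain p where p: "real_polynomial_function p" "\<And>z. z \<in> S \<Longrightarrow> \<bar>H z - p z\<bar> < \<epsilon>"
    by (rule Stone_Weierstrass_real_polynomial_function[OF _ _ \<epsilon>]) blast
  have "\<bar>h t - p (resolvent_fun t)\<bar> < \<epsilon>" for t
  proof -
    have "resolvent_fun t \<in> S"
      unfolding S_def mem_Collect_eq cmod_resolvent_fun_square by (simp add: resolvent_fun_eq)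
    moreover have "H (resolvent_fun t) = h t"
    proof -
      have "1 + t\<^sup>2 \<noteq> 0" using zero_le_power2[of t] by linarith
      then show ?thesis by (simp add: H_def resolvent_fun_eq complex_eq_iff)
    qed
    ultimately show ?thesis using p(2)[of "resolvent_fun t"] by simp
  qed
  with p(1) show ?thesis by blast
qed

text \<open>The limit operator is only given on a core \<open>C\<close>. For a symmetric operator the density of the
  ranges of \<open>A \<plusminus> \<i>\<close> expresses that it is essentially self-adjoint there.\<close>

locale calculus_sequence =
  fixes \<Phi> :: "nat \<Rightarrow> (real \<Rightarrow> complex) \<Rightarrow> 'h::chilbert_space \<Rightarrow> 'h"
    and C :: "'h set" and A :: "'h \<Rightarrow> 'h"
  assumes calculus: "functional_calculus (\<Phi> n)"
    and unit: "(\<lambda>n. \<Phi> n (\<lambda>_. 1) x) \<longlonglongrightarrow> x"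
    and id_core: "u \<in> C \<Longrightarrow> (\<lambda>n. \<Phi> n complex_of_real u) \<longlonglongrightarrow> A u"
    and dense: "closure C = UNIV"
    and dense_minus: "closure ((\<lambda>u. A u - \<i> *\<^sub>C u) ` C) = UNIV"
    and dense_plus: "closure ((\<lambda>u. A u + \<i> *\<^sub>C u) ` C) = UNIV"
begin

lemmas lin = clinear_onD[OF functional_calculus.linear[OF calculus]]
lemmas add = functional_calculus.add[OF calculus]
lemmas scale = functional_calculus.scale[OF calculus]
lemmas mult = functional_calculus.mult[OF calculus]
lemmas minus = functional_calculus.minus[OF calculus]
lemmas norm_le = functional_calculus.norm_le[OF calculus]

lemma tendsto_bounded_calculus:
  assumes "\<And>t. cmod (g t) \<le> B" and "X \<longlonglongrightarrow> x"
    and "(\<lambda>n. \<Phi> n g x) \<longlonglongrightarrow> y"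
  shows "(\<lambda>n. \<Phi> n g (X n)) \<longlonglongrightarrow> y"
proof -
  have "(\<lambda>n. \<Phi> n g (X n - x)) \<longlonglongrightarrow> 0"
  proof (rule Lim_null_comparison)
    show "\<forall>\<^sub>F n in sequentially. norm (\<Phi> n g (X n - x)) \<le> B * norm (X n - x)"
      using norm_le[OF assms(1)] by simp
    have "(\<lambda>n. B * norm (X n - x)) \<longlonglongrightarrow> B * norm (x - x)"
      by (intro tendsto_intros assms(2))
    then show "(\<lambda>n. B * norm (X n - x)) \<longlonglongrightarrow> 0" by simp
  qed
  from tendsto_add[OF this assms(3)] show ?thesis
    by (simp add: lin(4))
qed

definition strongly_convergent :: "(real \<Rightarrow> complex) \<Rightarrow> bool" where
  "strongly_convergent g \<longleftrightarrow> (\<exists>B. \<forall>t. cmod (g t) \<le> B) \<and> (\<forall>x. convergent (\<lambda>n. \<Phi> n g x))"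

lemma strongly_convergentE:
  assumes "strongly_convergent g"
  obtains B where "\<And>t. cmod (g t) \<le> B"
  using assms by (auto simp: strongly_convergent_def)

lemma strongly_convergentD:
  assumes "strongly_convergent g"
  shows "\<exists>y. (\<lambda>n. \<Phi> n g x) \<longlonglongrightarrow> y"
  using assms by (auto simp: strongly_convergent_def convergent_def)

lemma strongly_convergent_if_dense:
  assumes B: "\<And>t. cmod (g t) \<le> B" and S: "closure S = UNIV"
    and conv: "\<And>x. x \<in> S \<Longrightarrow> convergent (\<lambda>n. \<Phi> n g x)"
  shows "strongly_convergent g"
proof -
  have B0: "0 \<le> B" using norm_ge_zero[of "g 0"] B[of 0] by linarith
  have "convergent (\<lambda>n. \<Phi> n g x)" for x
  proof (rule convergent_if_approximable)
    fix \<epsilon> :: real assume \<epsilon>: "0 < \<epsilon>"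
    have "x \<in> closure S" using S by simp
    moreover have "0 < \<epsilon> / (B + 1)" using \<epsilon> B0 by simp
    ultimately obtain s where s: "s \<in> S" "dist s x < \<epsilon> / (B + 1)"
      unfolding closure_approachable by blast
    have "norm (\<Phi> n g x - \<Phi> n g s) \<le> \<epsilon>" for n
    proof -
      have "norm (\<Phi> n g x - \<Phi> n g s) \<le> B * norm (x - s)"
        using norm_le[OF B, where n = n and x = "x - s"] by (simp add: lin(4))
      also have "\<dots> \<le> (B + 1) * (\<epsilon> / (B + 1))"
        using s(2) B0 by (intro mult_mono) (auto simp: dist_norm norm_minus_commute)
      also have "\<dots> = \<epsilon>" using B0 by simp
      finally show ?thesis .
    qed
    then show "\<exists>Y. convergent Y \<and> (\<forall>n. norm (\<Phi> n g x - Y n) \<le> \<epsilon>)"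
      using conv[OF s(1)] by blast
  qed
  then show ?thesis using B by (auto simp: strongly_convergent_def)
qed

lemma strongly_convergent_const: "strongly_convergent (\<lambda>_. c)"
proof -
  have "(\<lambda>n. \<Phi> n (\<lambda>_. c) x) \<longlonglongrightarrow> c *\<^sub>C x" for x
    using bounded_linear.tendsto[OF bounded_linear_scaleC[of c] unit[of x]]
    by (simp add: scale[of _ c "\<lambda>_. 1", simplified])
  then show ?thesis
    by (auto simp: strongly_convergent_def convergent_def)
qed

lemma strongly_convergent_add:
  assumes "strongly_convergent g" "strongly_convergent h"
  shows "strongly_convergent (\<lambda>t. g t + h t)"
proof -
  obtain B B' where "\<And>t. cmod (g t) \<le> B" "\<And>t. cmod (h t) \<le> B'"
    using assms by (auto simp: strongly_convergent_def)
  then have "cmod (g t + h t) \<le> B + B'" for t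
    by (meson add_mono norm_triangle_le)
  then show ?thesis
    using assms by (auto simp: strongly_convergent_def add intro: convergent_add)
qed

lemma strongly_convergent_mult:
  assumes g: "strongly_convergent g" and h: "strongly_convergent h"
  shows "strongly_convergent (\<lambda>t. g t * h t)"
proof -
  obtain B B' where B: "\<And>t. cmod (g t) \<le> B" "\<And>t. cmod (h t) \<le> B'"
    using assms by (auto simp: strongly_convergent_def)
  have "0 \<le> B" using norm_ge_zero[of "g 0"] B(1)[of 0] by linarith
  then have "cmod (g t * h t) \<le> B * B'" for t
    using B by (auto simp: norm_mult intro!: mult_mono)
  moreover have "convergent (\<lambda>n. \<Phi> n (\<lambda>t. g t * h t) x)" for x
  proof -
    obtain y where y: "(\<lambda>n. \<Phi> n h x) \<longlonglongrightarrow> y"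
      using h by (auto simp: strongly_convergent_def convergent_def)
    obtain z where "(\<lambda>n. \<Phi> n g y) \<longlonglongrightarrow> z"
      using g by (auto simp: strongly_convergent_def convergent_def)
    from tendsto_bounded_calculus[OF B(1) y this] show ?thesis
      by (auto simp: mult convergent_def)
  qed
  ultimately show ?thesis by (auto simp: strongly_convergent_def)
qed

text \<open>On the range of \<open>A - z\<close> the limit can be named: as \<open>g\<close> inverts \<open>t - z\<close>, the value of \<open>g\<close> at
  \<open>(A - z)u\<close> is \<open>u\<close> up to the image of a null sequence.\<close>

lemma strongly_convergent_inverse_shift:
  assumes inv: "\<And>t. g t * (complex_of_real t - z) = 1" and B: "\<And>t. cmod (g t) \<le> B"
    and dns: "closure ((\<lambda>u. A u - z *\<^sub>C u) ` C) = UNIV"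
  shows "strongly_convergent g"
proof (rule strongly_convergent_if_dense[OF B dns])
  fix w assume "w \<in> (\<lambda>u. A u - z *\<^sub>C u) ` C"
  then obtain u where u: "u \<in> C" "w = A u - z *\<^sub>C u" by blast
  define X where "X n = \<Phi> n complex_of_real u - z *\<^sub>C \<Phi> n (\<lambda>_. 1) u" for n
  have "X \<longlonglongrightarrow> w"
    unfolding X_def u(2)
    by (intro tendsto_intros id_core u bounded_linear.tendsto[OF bounded_linear_scaleC] unit)
  then have "(\<lambda>n. B * norm (w - X n)) \<longlonglongrightarrow> B * norm (w - w)"
    by (intro tendsto_intros)
  then have "(\<lambda>n. B * norm (w - X n)) \<longlonglongrightarrow> 0" by simp
  then have "(\<lambda>n. \<Phi> n g (w - X n)) \<longlonglongrightarrow> 0"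
    by (rule Lim_null_comparison[rotated]) (use norm_le[OF B] in simp)
  moreover have "\<Phi> n g (X n) = \<Phi> n (\<lambda>_. 1) u" for n
  proof -
    have "\<Phi> n (\<lambda>t. g t * (complex_of_real t - z * 1)) u = \<Phi> n g (\<Phi> n (\<lambda>t. complex_of_real t - z * 1) u)"
      by (rule mult)
    also have "\<dots> = \<Phi> n g (X n)"
      by (simp only: minus scale X_def)
    finally have "\<Phi> n (\<lambda>t. g t * (complex_of_real t - z * 1)) u = \<Phi> n g (X n)" .
    then show ?thesis by (simp add: inv)
  qed
  ultimately have "(\<lambda>n. \<Phi> n g w - \<Phi> n (\<lambda>_. 1) u) \<longlonglongrightarrow> 0"
    by (simp add: lin(4))
  from tendsto_add[OF this unit[of u]] show "convergent (\<lambda>n. \<Phi> n g w)"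
    by (auto simp: convergent_def)
qed

lemma strongly_convergent_resolvent: "strongly_convergent resolvent_fun"
  by (rule strongly_convergent_inverse_shift[OF resolvent_fun_mult cmod_resolvent_fun_le dense_minus])

lemma strongly_convergent_cnj_resolvent: "strongly_convergent (\<lambda>t. cnj (resolvent_fun t))"
proof (rule strongly_convergent_inverse_shift)
  show "cnj (resolvent_fun t) * (complex_of_real t - (- \<i>)) = 1" for t
    using arg_cong[OF resolvent_fun_mult[of t], of cnj] by simp
  show "cmod (cnj (resolvent_fun t)) \<le> 1" for t
    using cmod_resolvent_fun_le by simp
  show "closure ((\<lambda>u. A u - (- \<i>) *\<^sub>C u) ` C) = UNIV"
    using dense_plus by (simp add: scaleC_minus_left)
qed

lemma strongly_convergent_polynomial:
  assumes "real_polynomial_function p"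
  shows "strongly_convergent (\<lambda>t. complex_of_real (p (resolvent_fun t)))"
  using assms
proof induction
  case (linear f)
  interpret f: bounded_linear f by fact
  have eq: "complex_of_real (f z) = complex_of_real (f 1) * (1/2) * (z + cnj z) +
      complex_of_real (f \<i>) * (1 / (2 * \<i>)) * (z + (-1) * cnj z)" for z
  proof -
    have "z = Re z *\<^sub>R 1 + Im z *\<^sub>R \<i>"
      by (simp add: complex_eq_iff)
    then have "f z = f (Re z *\<^sub>R 1 + Im z *\<^sub>R \<i>)"
      by (rule arg_cong)
    also have "\<dots> = Re z * f 1 + Im z * f \<i>" by (simp only: f.add f.scaleR real_scaleR_def)
    finally show ?thesis by (simp add: complex_eq_iff)
  qed
  have "(\<lambda>t. complex_of_real (f (resolvent_fun t))) =
      (\<lambda>t. complex_of_real (f 1) * (1/2) * (resolvent_fun t + cnj (resolvent_fun t)) +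
        complex_of_real (f \<i>) * (1 / (2 * \<i>)) * (resolvent_fun t + (-1) * cnj (resolvent_fun t)))"
    by (rule ext) (rule eq)
  then show ?case
    by (simp only:) (intro strongly_convergent_add strongly_convergent_mult
        strongly_convergent_const strongly_convergent_resolvent strongly_convergent_cnj_resolvent)
next
  case (const c)
  show ?case by (rule strongly_convergent_const)
next
  case (add f g)
  then show ?case using strongly_convergent_add by simp
next
  case (mult f g)
  then show ?case using strongly_convergent_mult by simp
qed

lemma strongly_convergent_vanishing:
  fixes h :: "real \<Rightarrow> real"
  assumes h: "continuous_on UNIV h" "(h \<longlongrightarrow> 0) at_infinity"
  shows "strongly_convergent (\<lambda>t. complex_of_real (h t))"
proof -
  have conv: "convergent (\<lambda>n. \<Phi> n (\<lambda>t. complex_of_real (h t)) x)" for x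
  proof (rule convergent_if_approximable)
    fix \<epsilon> :: real assume \<epsilon>: "0 < \<epsilon>"
    define \<delta> where "\<delta> = \<epsilon> / (norm x + 1)"
    have \<delta>: "0 < \<delta>" using \<epsilon> by (simp add: \<delta>_def add_nonneg_pos)
    obtain p where p: "real_polynomial_function p" "\<And>t. \<bar>h t - p (resolvent_fun t)\<bar> < \<delta>"
      using uniform_approx_resolvent_polynomial[OF h \<delta>] by blast
    have "norm (\<Phi> n (\<lambda>t. complex_of_real (h t)) x - \<Phi> n (\<lambda>t. complex_of_real (p (resolvent_fun t))) x)
        \<le> \<epsilon>" for n
    proof -
      have "norm (\<Phi> n (\<lambda>t. complex_of_real (h t) - complex_of_real (p (resolvent_fun t))) x) \<le> \<delta> * norm x"
        by (rule norm_le) (use p(2) less_imp_le in \<open>auto simp: of_real_diff[symmetric] simp del: of_real_diff\<close>)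
      also have "\<dots> \<le> \<delta> * (norm x + 1)" using \<delta> by simp
      also have "\<dots> = \<epsilon>" by (simp add: \<delta>_def add_nonneg_eq_0_iff)
      finally show ?thesis by (simp add: minus)
    qed
    then show "\<exists>Y. convergent Y \<and> (\<forall>n. norm (\<Phi> n (\<lambda>t. complex_of_real (h t)) x - Y n) \<le> \<epsilon>)"
      using strongly_convergent_polynomial[OF p(1)] unfolding strongly_convergent_def by blast
  qed
  obtain p where p: "real_polynomial_function p" "\<And>t. \<bar>h t - p (resolvent_fun t)\<bar> < 1"
    using uniform_approx_resolvent_polynomial[OF h, of 1] by auto
  obtain B where B: "\<And>t. cmod (complex_of_real (p (resolvent_fun t))) \<le> B"
    using strongly_convergentE[OF strongly_convergent_polynomial[OF p(1)]] by metis
  have "cmod (complex_of_real (h t)) \<le> B + 1" for t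
    using p(2)[of t] B[of t] by simp
  with conv show ?thesis unfolding strongly_convergent_def by blast
qed

text \<open>The product with \<open>1 = t / (1 + t\<^sup>2) \<cdot> t + 1 / (1 + t\<^sup>2)\<close> trades one order of growth for an
  application of the operator itself, which converges on the core.\<close>

lemma convergent_on_core:
  fixes g :: "real \<Rightarrow> real"
  assumes w: "strongly_convergent (\<lambda>t. complex_of_real (g t * (t / (1 + t\<^sup>2))))"
    and u: "strongly_convergent (\<lambda>t. complex_of_real (g t * (1 / (1 + t\<^sup>2))))"
    and v: "v \<in> C"
  shows "convergent (\<lambda>n. \<Phi> n (\<lambda>t. complex_of_real (g t)) v)"
proof -
  let ?w = "\<lambda>t. complex_of_real (g t * (t / (1 + t\<^sup>2)))"
  let ?u = "\<lambda>t. complex_of_real (g t * (1 / (1 + t\<^sup>2)))"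
  obtain B where B: "\<And>t. cmod (?w t) \<le> B" using strongly_convergentE[OF w] by metis
  obtain B' where B': "\<And>t. cmod (?u t) \<le> B'" using strongly_convergentE[OF u] by metis
  have eq: "complex_of_real (g t) = ?w t * complex_of_real t + ?u t * 1" for t
  proof -
    have "1 + t\<^sup>2 \<noteq> 0" using zero_le_power2[of t] by linarith
    then have "t / (1 + t\<^sup>2) * t + 1 / (1 + t\<^sup>2) = 1"
      by (simp add: add_divide_distrib[symmetric] power2_eq_square add.commute)
    from arg_cong[OF this, of "\<lambda>y. g t * y"]
    have "g t = g t * (t / (1 + t\<^sup>2)) * t + g t * (1 / (1 + t\<^sup>2))"
      by (simp only: distrib_left mult.assoc mult_1_right)
    from arg_cong[OF this, of complex_of_real] show ?thesis
      by (simp only: of_real_add of_real_mult mult_1_right)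
  qed
  obtain y where y: "(\<lambda>n. \<Phi> n ?w (A v)) \<longlonglongrightarrow> y"
    using strongly_convergentD[OF w, of "A v"] ..
  obtain z where z: "(\<lambda>n. \<Phi> n ?u v) \<longlonglongrightarrow> z"
    using strongly_convergentD[OF u, of v] ..
  have "(\<lambda>n. \<Phi> n ?w (\<Phi> n complex_of_real v) + \<Phi> n ?u (\<Phi> n (\<lambda>_. 1) v)) \<longlonglongrightarrow> y + z"
    by (intro tendsto_add tendsto_bounded_calculus[OF B id_core[OF v] y]
        tendsto_bounded_calculus[OF B' unit z])
  moreover have "\<Phi> n (\<lambda>t. complex_of_real (g t)) v =
      \<Phi> n ?w (\<Phi> n complex_of_real v) + \<Phi> n ?u (\<Phi> n (\<lambda>_. 1) v)" for n
    by (subst eq) (simp only: add mult)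
  ultimately show ?thesis unfolding convergent_def by auto
qed

text \<open>After multiplication with \<open>t / (1 + t\<^sup>2)\<close> or \<open>1 / (1 + t\<^sup>2)\<close> a bounded function vanishes at infinity,
  which gives convergence on the core. Boundedness then extends it to the closure.\<close>

lemma strongly_convergent_bounded:
  fixes h :: "real \<Rightarrow> real"
  assumes h: "continuous_on UNIV h" and B: "\<And>t. \<bar>h t\<bar> \<le> B"
  shows "strongly_convergent (\<lambda>t. complex_of_real (h t))"
proof (rule strongly_convergent_if_dense[OF _ dense])
  show "cmod (complex_of_real (h t)) \<le> B" for t using B by simp
  have nz: "1 + t\<^sup>2 \<noteq> 0" for t :: real using zero_le_power2[of t] by linarith
  have van: "((\<lambda>t. h t * k t) \<longlongrightarrow> 0) at_infinity" if "(k \<longlongrightarrow> 0) at_infinity" for k :: "real \<Rightarrow> real"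
  proof (rule Lim_null_comparison)
    show "\<forall>\<^sub>F t in at_infinity. norm (h t * k t) \<le> B * norm (k t)"
      using B by (intro always_eventually) (auto simp: abs_mult intro!: mult_right_mono)
    show "((\<lambda>t. B * norm (k t)) \<longlongrightarrow> 0) at_infinity"
      using tendsto_mult[OF tendsto_const[of B] tendsto_norm[OF that]] by simp
  qed
  have inv: "((\<lambda>t :: real. inverse t) \<longlongrightarrow> 0) at_infinity" by (rule tendsto_inverse_0)
  have pos: "0 < 1 + t\<^sup>2" for t :: real by (simp add: add_pos_nonneg)
  have le1: "\<bar>t / (1 + t\<^sup>2)\<bar> \<le> \<bar>inverse t\<bar>" if "t \<noteq> 0" for t :: real
  proof -
    have "\<bar>t\<bar> * \<bar>t\<bar> \<le> 1 * (1 + t\<^sup>2)" by (simp add: power2_eq_square)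
    then have "\<bar>t\<bar> / (1 + t\<^sup>2) \<le> 1 / \<bar>t\<bar>"
      using that pos[of t] by (intro mult_imp_div_pos_le) (auto simp: pos_le_divide_eq)
    then show ?thesis using pos[of t] by (simp only: abs_divide abs_inverse inverse_eq_divide abs_of_pos)
  qed
  have le2: "\<bar>1 / (1 + t\<^sup>2)\<bar> \<le> \<bar>inverse t\<bar>" if "t \<noteq> 0" for t :: real
  proof -
    have "\<bar>t\<bar> \<le> 1 + t\<^sup>2"
      using sum_squares_bound[of 1 "\<bar>t\<bar>"] by (simp add: power2_eq_square)
    then have "1 / (1 + t\<^sup>2) \<le> 1 / \<bar>t\<bar>"
      using that by (intro divide_left_mono) (auto simp: pos)
    then show ?thesis using pos[of t] by (simp only: abs_divide abs_inverse inverse_eq_divide abs_of_pos abs_one)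
  qed
  have ev: "\<forall>\<^sub>F t :: real in at_infinity. t \<noteq> 0"
    by (auto simp: eventually_at_infinity_pos intro!: exI[of _ 1])
  have l1: "((\<lambda>t :: real. t / (1 + t\<^sup>2)) \<longlongrightarrow> 0) at_infinity"
    by (rule Lim_null_comparison[OF _ tendsto_norm_zero[OF inv]])
      (use ev in \<open>eventually_elim, use le1 in auto\<close>)
  have l2: "((\<lambda>t :: real. 1 / (1 + t\<^sup>2)) \<longlongrightarrow> 0) at_infinity"
    by (rule Lim_null_comparison[OF _ tendsto_norm_zero[OF inv]])
      (use ev in \<open>eventually_elim, use le2 in auto\<close>)
  fix x assume "x \<in> C"
  show "convergent (\<lambda>n. \<Phi> n (\<lambda>t. complex_of_real (h t)) x)"
  proof (rule convergent_on_core[OF strongly_convergent_vanishing strongly_convergent_vanishing \<open>x \<in> C\<close>])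
    show "((\<lambda>t. h t * (t / (1 + t\<^sup>2))) \<longlongrightarrow> 0) at_infinity"
      "((\<lambda>t. h t * (1 / (1 + t\<^sup>2))) \<longlongrightarrow> 0) at_infinity"
      by (rule van, rule l1) (rule van, rule l2)
    show "continuous_on UNIV (\<lambda>t. h t * (t / (1 + t\<^sup>2)))"
      "continuous_on UNIV (\<lambda>t. h t * (1 / (1 + t\<^sup>2)))"
      by (auto intro!: continuous_intros h simp: nz)
  qed
qed

theorem convergent_linearly_bounded:
  fixes g :: "real \<Rightarrow> real"
  assumes g: "continuous_on UNIV g" and bd: "\<And>t. \<bar>g t\<bar> \<le> a + b * \<bar>t\<bar>"
    and v: "v \<in> C"
  shows "convergent (\<lambda>n. \<Phi> n (\<lambda>t. complex_of_real (g t)) v)"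
proof -
  have nz: "1 + t\<^sup>2 > 0" for t :: real using zero_le_power2[of t] by linarith
  have t1: "\<bar>t\<bar> \<le> 1 + t\<^sup>2" for t :: real
    using sum_squares_bound[of 1 "\<bar>t\<bar>"] by (simp add: power2_eq_square)
  have ab: "\<bar>g t\<bar> \<le> \<bar>a\<bar> + \<bar>b\<bar> * \<bar>t\<bar>" for t
    using bd[of t] mult_right_mono[OF abs_ge_self[of b], of "\<bar>t\<bar>"] by linarith
  have b1: "\<bar>g t * (t / (1 + t\<^sup>2))\<bar> \<le> \<bar>a\<bar> + \<bar>b\<bar>" for t
  proof -
    have "\<bar>g t\<bar> * \<bar>t\<bar> \<le> (\<bar>a\<bar> + \<bar>b\<bar> * \<bar>t\<bar>) * \<bar>t\<bar>" by (intro mult_right_mono ab) simp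
    also have "\<dots> = \<bar>a\<bar> * \<bar>t\<bar> + \<bar>b\<bar> * t\<^sup>2" by (simp add: algebra_simps power2_eq_square)
    also have "\<dots> \<le> \<bar>a\<bar> * (1 + t\<^sup>2) + \<bar>b\<bar> * (1 + t\<^sup>2)"
      by (intro add_mono mult_left_mono t1) auto
    finally show ?thesis using nz[of t] by (simp add: abs_mult divide_simps algebra_simps)
  qed
  have b2: "\<bar>g t * (1 / (1 + t\<^sup>2))\<bar> \<le> \<bar>a\<bar> + \<bar>b\<bar>" for t
  proof -
    have "\<bar>g t\<bar> \<le> \<bar>a\<bar> * (1 + t\<^sup>2) + \<bar>b\<bar> * (1 + t\<^sup>2)"
      using ab[of t] mult_left_mono[OF t1[of t], of "\<bar>b\<bar>"] mult_left_mono[of 1 "1 + t\<^sup>2" "\<bar>a\<bar>"]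
      by simp
    then show ?thesis using nz[of t] by (simp add: abs_mult divide_simps algebra_simps)
  qed
  have nz': "1 + t\<^sup>2 \<noteq> 0" for t :: real using nz[of t] by simp
  have "continuous_on UNIV (\<lambda>t. g t * (t / (1 + t\<^sup>2)))"
    "continuous_on UNIV (\<lambda>t. g t * (1 / (1 + t\<^sup>2)))"
    by (auto intro!: continuous_intros g simp: nz')
  from convergent_on_core[OF strongly_convergent_bounded[OF this(1) b1]
      strongly_convergent_bounded[OF this(2) b2] v]
  show ?thesis .
qed

end

text \<open>Interleaving the two sequences gives a third one of the same kind. It converges as well, and both
  are subsequences of it.\<close>

lemma calculus_sequence_same_limit:
  fixes g :: "real \<Rightarrow> real"
  assumes "calculus_sequence \<Phi> C A" and "calculus_sequence \<Psi> C A"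
    and g: "continuous_on UNIV g" "\<And>t. \<bar>g t\<bar> \<le> a + b * \<bar>t\<bar>" and v: "v \<in> C"
  shows "\<exists>y. (\<lambda>n. \<Phi> n (\<lambda>t. complex_of_real (g t)) v) \<longlonglongrightarrow> y \<and>
    (\<lambda>n. \<Psi> n (\<lambda>t. complex_of_real (g t)) v) \<longlonglongrightarrow> y"
proof -
  interpret P: calculus_sequence \<Phi> C A by fact
  interpret Q: calculus_sequence \<Psi> C A by fact
  define X where "X n = (if even n then \<Phi> (n div 2) else \<Psi> (n div 2))" for n
  have inter: "(\<lambda>n. X n k x) \<longlonglongrightarrow> l"
    if l: "(\<lambda>n. \<Phi> n k x) \<longlonglongrightarrow> l" "(\<lambda>n. \<Psi> n k x) \<longlonglongrightarrow> l" for k x l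
  proof (rule metric_LIMSEQ_I)
    fix r :: real assume r: "0 < r"
    obtain N where N: "\<And>n. n \<ge> N \<Longrightarrow> dist (\<Phi> n k x) l < r"
      using metric_LIMSEQ_D[OF l(1) r] by blast
    obtain N' where N': "\<And>n. n \<ge> N' \<Longrightarrow> dist (\<Psi> n k x) l < r"
      using metric_LIMSEQ_D[OF l(2) r] by blast
    have "dist (X n k x) l < r" if "n \<ge> 2 * max N N'" for n
      using N[of "n div 2"] N'[of "n div 2"] that by (auto simp: X_def)
    then show "\<exists>N. \<forall>n\<ge>N. dist (X n k x) l < r" by blast
  qed
  have "functional_calculus (X n)" for n
    using P.calculus Q.calculus by (simp add: X_def)
  then have "calculus_sequence X C A"
    by (intro calculus_sequence.intro inter P.unit Q.unit P.id_core Q.id_core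
        P.dense P.dense_minus P.dense_plus)
  then have "convergent (\<lambda>n. X n (\<lambda>t. complex_of_real (g t)) v)"
    using calculus_sequence.convergent_linearly_bounded g v by blast
  then obtain y where y: "(\<lambda>n. X n (\<lambda>t. complex_of_real (g t)) v) \<longlonglongrightarrow> y"
    by (auto simp: convergent_def)
  have "strict_mono (\<lambda>n :: nat. 2 * n)" "strict_mono (\<lambda>n :: nat. 2 * n + 1)"
    by (auto simp: strict_mono_def)
  from LIMSEQ_subseq_LIMSEQ[OF y this(1)] LIMSEQ_subseq_LIMSEQ[OF y this(2)]
  show ?thesis by (auto simp: X_def o_def)
qed

section \<open>Riemann--Stieltjes sums\<close>

definition tagged_partition :: "real \<Rightarrow> real \<Rightarrow> real \<Rightarrow> nat \<Rightarrow> (nat \<Rightarrow> real) \<Rightarrow> (nat \<Rightarrow> real) \<Rightarrow> bool" where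
  "tagged_partition d a b n t \<xi> \<longleftrightarrow> t 0 = a \<and> t n = b \<and>
     (\<forall>k<n. t k < t (Suc k) \<and> t (Suc k) - t k < d \<and> t k \<le> \<xi> k \<and> \<xi> k \<le> t (Suc k))"

definition RS_sum ::
    "(real \<Rightarrow> real) \<Rightarrow> (real \<Rightarrow> 'b::real_normed_vector) \<Rightarrow> nat \<Rightarrow> (nat \<Rightarrow> real) \<Rightarrow> (nat \<Rightarrow> real) \<Rightarrow> 'b" where
  "RS_sum f g n t \<xi> = (\<Sum>k<n. f (\<xi> k) *\<^sub>R (g (t (Suc k)) - g (t k)))"

lemma has_RS_integral_iff:
  "has_RS_integral f g a b I \<longleftrightarrow> (\<forall>\<epsilon>>0. \<exists>\<delta>>0. \<forall>n t \<xi>.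
     tagged_partition \<delta> a b n t \<xi> \<longrightarrow> norm (RS_sum f g n t \<xi> - I) < \<epsilon>)"
  unfolding has_RS_integral_def tagged_partition_def RS_sum_def ..

lemma has_RS_integralE:
  assumes "has_RS_integral f g a b I" "0 < \<epsilon>"
  obtains \<delta> where "0 < \<delta>"
    "\<And>n t \<xi>. tagged_partition \<delta> a b n t \<xi> \<Longrightarrow> norm (RS_sum f g n t \<xi> - I) < \<epsilon>"
  using assms unfolding has_RS_integral_iff by blast

lemma tagged_partition_finer:
  "tagged_partition d a b n t \<xi> \<Longrightarrow> d \<le> d' \<Longrightarrow> tagged_partition d' a b n t \<xi>"
  unfolding tagged_partition_def by fastforce

lemma tagged_partition_mono:
  assumes "tagged_partition d a b n t \<xi>" "i \<le> j" "j \<le> n"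
  shows "t i \<le> t j"
proof -
  have "m \<le> n \<Longrightarrow> t i \<le> t m" if "i \<le> m" for m
    using that
  proof (induction m rule: dec_induct)
    case (step m)
    then have "t m < t (Suc m)" using assms(1) by (simp add: tagged_partition_def)
    then show ?case using step by simp
  qed simp
  then show ?thesis using assms by simp
qed

lemma tagged_partition_cells:
  assumes "tagged_partition d a b n t \<xi>" "k < n"
  shows "t k < t (Suc k)" "\<xi> k \<in> {t k..t (Suc k)}" "a \<le> t k" "t (Suc k) \<le> b"
proof -
  show "t k < t (Suc k)" "\<xi> k \<in> {t k..t (Suc k)}"
    using assms by (auto simp: tagged_partition_def)
  show "a \<le> t k" "t (Suc k) \<le> b"
    using tagged_partition_mono[OF assms(1), of 0 k] tagged_partition_mono[OF assms(1), of "Suc k" n] assms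
    by (auto simp: tagged_partition_def)
qed

lemma tagged_partition_retag:
  assumes "tagged_partition d a b n t \<xi>" "\<And>k. k < n \<Longrightarrow> \<eta> k \<in> {t k..t (Suc k)}"
  shows "tagged_partition d a b n t \<eta>"
  using assms by (auto simp: tagged_partition_def)

lemma tagged_partition_concat:
  assumes "tagged_partition d a c n s \<xi>" "tagged_partition d c b m t \<eta>"
  shows "tagged_partition d a b (n + m) (\<lambda>k. if k \<le> n then s k else t (k - n))
    (\<lambda>k. if k < n then \<xi> k else \<eta> (k - n))"
proof -
  let ?u = "\<lambda>k. if k \<le> n then s k else t (k - n)"
  have u: "?u k = t (k - n)" if "n \<le> k" for k
    using assms that by (auto simp: tagged_partition_def)
  have "?u k < ?u (Suc k) \<and> ?u (Suc k) - ?u k < d \<and>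
      ?u k \<le> (if k < n then \<xi> k else \<eta> (k - n)) \<and>
      (if k < n then \<xi> k else \<eta> (k - n)) \<le> ?u (Suc k)" if "k < n + m" for k
  proof (cases "k < n")
    case True
    then show ?thesis using assms(1) by (simp add: tagged_partition_def)
  next
    case False
    then have "k - n < m" "?u k = t (k - n)" "?u (Suc k) = t (Suc (k - n))"
      using that u[of k] u[of "Suc k"] by (auto simp: Suc_diff_le)
    then show ?thesis using assms(2) False unfolding tagged_partition_def by presburger
  qed
  moreover have "?u 0 = a" "?u (n + m) = b"
    using assms u[of "n + m"] by (auto simp: tagged_partition_def)
  ultimately show ?thesis unfolding tagged_partition_def by blast
qed

lemma RS_sum_concat:
  assumes "s n = t 0"
  shows "RS_sum f g (n + m) (\<lambda>k. if k \<le> n then s k else t (k - n))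
      (\<lambda>k. if k < n then \<xi> k else \<eta> (k - n)) = RS_sum f g n s \<xi> + RS_sum f g m t \<eta>"
  by (induction m) (use assms in \<open>auto simp: RS_sum_def Suc_diff_le\<close>)

lemma tagged_partition_exists:
  assumes "a \<le> b" "0 < d"
  shows "\<exists>n t. tagged_partition d a b n t t"
proof (cases "a = b")
  case True
  then show ?thesis by (intro exI[of _ 0] exI[of _ "\<lambda>_. a"]) (simp add: tagged_partition_def)
next
  case False
  then have ab: "0 < b - a" using assms by simp
  obtain n where n: "(b - a) / d < real n" using reals_Archimedean2 by blast
  have "0 < (b - a) / d" using ab assms by simp
  then have n0: "0 < real n" using n by linarith
  define h where "h = (b - a) / n"
  have h: "h < d" "0 < h" "real n * h = b - a"
    using n n0 assms(2) ab by (simp_all add: h_def field_simps)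
  then have "tagged_partition d a b n (\<lambda>k. a + k * h) (\<lambda>k. a + k * h)"
    by (simp add: tagged_partition_def distrib_right)
  then show ?thesis by blast
qed

text \<open>The Cauchy condition is imposed on all subintervals at once, with a mesh that does not
  depend on the subinterval: two partitions of a subinterval extend, by the same partition of
  the rest, to partitions of the whole interval with the same difference of sums.\<close>

definition RS_sums_close ::
    "(real \<Rightarrow> real) \<Rightarrow> (real \<Rightarrow> 'b::real_normed_vector) \<Rightarrow> real \<Rightarrow> real \<Rightarrow> real \<Rightarrow> real \<Rightarrow> bool" where
  "RS_sums_close f g a b \<epsilon> \<delta> \<longleftrightarrow> (\<forall>c d n t \<xi> n' t' \<xi>'. a \<le> c \<and> c \<le> d \<and> d \<le> b \<and>
     tagged_partition \<delta> c d n t \<xi> \<and> tagged_partition \<delta> c d n' t' \<xi>' \<longrightarrow>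
     norm (RS_sum f g n t \<xi> - RS_sum f g n' t' \<xi>') < \<epsilon>)"

lemma RS_sums_closeI:
  assumes "\<And>c d n t \<xi> n' t' \<xi>'. a \<le> c \<Longrightarrow> c \<le> d \<Longrightarrow> d \<le> b \<Longrightarrow> tagged_partition \<delta> c d n t \<xi> \<Longrightarrow>
    tagged_partition \<delta> c d n' t' \<xi>' \<Longrightarrow> norm (RS_sum f g n t \<xi> - RS_sum f g n' t' \<xi>') < \<epsilon>"
  shows "RS_sums_close f g a b \<epsilon> \<delta>"
  unfolding RS_sums_close_def by (intro allI impI, elim conjE) (rule assms)

lemma RS_sums_closeD:
  assumes "RS_sums_close f g a b \<epsilon> \<delta>" "a \<le> c" "c \<le> d" "d \<le> b"
    and "tagged_partition \<delta> c d n t \<xi>" "tagged_partition \<delta> c d n' t' \<xi>'"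
  shows "norm (RS_sum f g n t \<xi> - RS_sum f g n' t' \<xi>') < \<epsilon>"
  using assms unfolding RS_sums_close_def by simp

definition RS_Cauchy :: "(real \<Rightarrow> real) \<Rightarrow> (real \<Rightarrow> 'b::real_normed_vector) \<Rightarrow> real \<Rightarrow> real \<Rightarrow> bool" where
  "RS_Cauchy f g a b \<longleftrightarrow> (\<forall>\<epsilon>>0. \<exists>\<delta>>0. RS_sums_close f g a b \<epsilon> \<delta>)"

lemma RS_CauchyE:
  assumes "RS_Cauchy f g a b" "0 < \<epsilon>"
  obtains \<delta> where "0 < \<delta>" "RS_sums_close f g a b \<epsilon> \<delta>"
  using assms unfolding RS_Cauchy_def by blast

lemma RS_Cauchy_subinterval:
  assumes "RS_Cauchy f g a b" "a \<le> c" "d \<le> b"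
  shows "RS_Cauchy f g c d"
proof -
  have "RS_sums_close f g c d \<epsilon> \<delta>" if close: "RS_sums_close f g a b \<epsilon> \<delta>" for \<epsilon> \<delta>
    by (rule RS_sums_closeI, rule RS_sums_closeD[OF close, rotated 3])
      (assumption | use assms(2,3) in linarith)+
  then show ?thesis using assms(1) unfolding RS_Cauchy_def by blast
qed

lemma has_RS_integral_imp_Cauchy:
  assumes "has_RS_integral f g a b I"
  shows "RS_Cauchy f g a b"
  unfolding RS_Cauchy_def
proof (intro allI impI)
  fix \<epsilon> :: real assume "0 < \<epsilon>"
  then have "0 < \<epsilon> / 2" by simp
  from has_RS_integralE[OF assms this] obtain \<delta> where \<delta>: "0 < \<delta>"
    "\<And>n t \<xi>. tagged_partition \<delta> a b n t \<xi> \<Longrightarrow> norm (RS_sum f g n t \<xi> - I) < \<epsilon> / 2"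
    by blast
  have "norm (RS_sum f g n t \<xi> - RS_sum f g n' t' \<xi>') < \<epsilon>"
    if cd: "a \<le> c" "c \<le> d" "d \<le> b" and t: "tagged_partition \<delta> c d n t \<xi>"
      and t': "tagged_partition \<delta> c d n' t' \<xi>'" for c d n t \<xi> n' t' \<xi>'
  proof -
    obtain l p where l: "tagged_partition \<delta> a c l p p"
      using tagged_partition_exists[OF cd(1) \<delta>(1)] by blast
    obtain r q where r: "tagged_partition \<delta> d b r q q"
      using tagged_partition_exists[OF cd(3) \<delta>(1)] by blast
    have "\<exists>N u \<eta>. tagged_partition \<delta> a b N u \<eta> \<and>
        RS_sum f g N u \<eta> = RS_sum f g l p p + RS_sum f g n t \<xi> + RS_sum f g r q q"
      if t: "tagged_partition \<delta> c d n t \<xi>" for n t \<xi>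
    proof -
      note lt = tagged_partition_concat[OF l t]
      note ltr = tagged_partition_concat[OF lt r]
      have e: "p l = t 0" using l t by (simp add: tagged_partition_def)
      from lt r have e': "(if l + n \<le> l then p (l + n) else t (l + n - l)) = q 0"
        by (simp add: tagged_partition_def)
      show ?thesis
        by (intro exI conjI, rule ltr)
          (simp only: RS_sum_concat[where t = q and n = "l + n"
            and s = "\<lambda>k. if k \<le> l then p k else t (k - l)" and \<eta> = q
            and \<xi> = "\<lambda>k. if k < l then p k else \<xi> (k - l)", OF e']
            RS_sum_concat[where s = p and t = t and n = l and \<xi> = p and \<eta> = \<xi>, OF e])
    qed
    from this[OF t] this[OF t'] obtain N u \<eta> N' u' \<eta>' where
      "tagged_partition \<delta> a b N u \<eta>" "tagged_partition \<delta> a b N' u' \<eta>'" and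
      eq: "RS_sum f g N u \<eta> = RS_sum f g l p p + RS_sum f g n t \<xi> + RS_sum f g r q q"
      "RS_sum f g N' u' \<eta>' = RS_sum f g l p p + RS_sum f g n' t' \<xi>' + RS_sum f g r q q"
      by blast
    then have "norm (RS_sum f g N u \<eta> - I) < \<epsilon> / 2" "norm (RS_sum f g N' u' \<eta>' - I) < \<epsilon> / 2"
      using \<delta>(2) by blast+
    then have "norm ((RS_sum f g N u \<eta> - I) - (RS_sum f g N' u' \<eta>' - I)) < \<epsilon>"
      using norm_triangle_ineq4[of "RS_sum f g N u \<eta> - I" "RS_sum f g N' u' \<eta>' - I"] by linarith
    then show ?thesis by (simp add: eq)
  qed
  then have "RS_sums_close f g a b \<epsilon> \<delta>" by (rule RS_sums_closeI)
  with \<delta>(1) show "\<exists>\<delta>>0. RS_sums_close f g a b \<epsilon> \<delta>" by blast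
qed

lemma RS_Cauchy_imp_integral:
  fixes g :: "real \<Rightarrow> 'b::banach"
  assumes C: "RS_Cauchy f g a b" and ab: "a \<le> b"
  shows "\<exists>I. has_RS_integral f g a b I"
proof -
  have "\<forall>j :: nat. \<exists>n t. tagged_partition (1 / Suc j) a b n t t"
    using tagged_partition_exists[OF ab] by simp
  then obtain n t where nt: "\<And>j :: nat. tagged_partition (1 / Suc j) a b (n j) (t j) (t j)"
    by metis
  define S where "S j = RS_sum f g (n j) (t j) (t j)" for j
  have fine: "tagged_partition \<delta> a b (n j) (t j) (t j)" if "j \<ge> M" "1 / Suc M < \<delta>" for j M \<delta>
  proof -
    have "1 / real (Suc j) \<le> 1 / Suc M" using that by (simp add: field_simps)
    then show ?thesis using that by (intro tagged_partition_finer[OF nt[of j]]) linarith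
  qed
  have "Cauchy S"
  proof (rule metric_CauchyI)
    fix \<epsilon> :: real assume \<epsilon>: "0 < \<epsilon>"
    from RS_CauchyE[OF C this] obtain \<delta> where \<delta>: "0 < \<delta>" "RS_sums_close f g a b (\<epsilon>) \<delta>" by blast
    obtain M where M: "1 / Suc M < \<delta>" using \<delta>(1) nat_approx_posE by blast
    have "dist (S i) (S j) < \<epsilon>" if "i \<ge> M" "j \<ge> M" for i j
      unfolding S_def dist_norm
      using RS_sums_closeD[OF \<delta>(2) order_refl ab order_refl fine[OF that(1) M] fine[OF that(2) M]] .
    then show "\<exists>M. \<forall>i\<ge>M. \<forall>j\<ge>M. dist (S i) (S j) < \<epsilon>" by blast
  qed
  then obtain I where I: "S \<longlonglongrightarrow> I" by (auto simp: Cauchy_convergent_iff convergent_def)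
  have "has_RS_integral f g a b I"
    unfolding has_RS_integral_iff
  proof (intro allI impI)
    fix \<epsilon> :: real assume "0 < \<epsilon>"
    then have \<epsilon>: "0 < \<epsilon> / 2" by simp
    from RS_CauchyE[OF C \<epsilon>] obtain \<delta> where \<delta>: "0 < \<delta>" "RS_sums_close f g a b (\<epsilon> / 2) \<delta>" by blast
    obtain M where M: "1 / Suc M < \<delta>" using \<delta>(1) nat_approx_posE by blast
    obtain M' where M': "\<And>j. j \<ge> M' \<Longrightarrow> dist (S j) I < \<epsilon> / 2"
      using metric_LIMSEQ_D[OF I \<epsilon>] by blast
    have "norm (RS_sum f g m u \<eta> - I) < \<epsilon>" if "tagged_partition \<delta> a b m u \<eta>" for m u \<eta>
    proof -
      let ?j = "max M M'"
      have "norm (RS_sum f g m u \<eta> - S ?j) < \<epsilon> / 2"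
        unfolding S_def using RS_sums_closeD[OF \<delta>(2) order_refl ab order_refl that fine[of M ?j, OF _ M]] by simp
      moreover have "norm (S ?j - I) < \<epsilon> / 2" using M'[of ?j] by (simp add: dist_norm)
      ultimately show ?thesis
        using norm_triangle_ineq[of "RS_sum f g m u \<eta> - S ?j" "S ?j - I"] by simp
    qed
    then show "\<exists>\<delta>>0. \<forall>n t \<xi>. tagged_partition \<delta> a b n t \<xi> \<longrightarrow> norm (RS_sum f g n t \<xi> - I) < \<epsilon>"
      using \<delta>(1) by blast
  qed
  then show ?thesis ..
qed

lemma has_RS_integral_additive:
  assumes I: "has_RS_integral f g a b I" and J: "has_RS_integral f g b c J"
    and K: "has_RS_integral f g a c K" and abc: "a \<le> b" "b \<le> c"
  shows "K = I + J"
proof -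
  have le: "norm (K - (I + J)) \<le> \<epsilon>" if "0 < \<epsilon>" for \<epsilon> :: real
  proof -
    have e: "0 < \<epsilon> / 3" using that by simp
    from has_RS_integralE[OF I e] obtain d1 where d1: "0 < d1"
      "\<And>n t \<xi>. tagged_partition d1 a b n t \<xi> \<Longrightarrow> norm (RS_sum f g n t \<xi> - I) < \<epsilon> / 3" by blast
    from has_RS_integralE[OF J e] obtain d2 where d2: "0 < d2"
      "\<And>n t \<xi>. tagged_partition d2 b c n t \<xi> \<Longrightarrow> norm (RS_sum f g n t \<xi> - J) < \<epsilon> / 3" by blast
    from has_RS_integralE[OF K e] obtain d3 where d3: "0 < d3"
      "\<And>n t \<xi>. tagged_partition d3 a c n t \<xi> \<Longrightarrow> norm (RS_sum f g n t \<xi> - K) < \<epsilon> / 3" by blast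
    define d where "d = min d1 (min d2 d3)"
    have d: "0 < d" "d \<le> d1" "d \<le> d2" "d \<le> d3" using d1 d2 d3 by (auto simp: d_def)
    obtain n s where s: "tagged_partition d a b n s s"
      using tagged_partition_exists[OF abc(1) d(1)] by blast
    obtain m t where t: "tagged_partition d b c m t t"
      using tagged_partition_exists[OF abc(2) d(1)] by blast
    have st: "s n = t 0" using s t by (simp add: tagged_partition_def)
    let ?X = "RS_sum f g n s s - I" and ?Y = "RS_sum f g m t t - J"
      and ?Z = "RS_sum f g n s s + RS_sum f g m t t - K"
    have lt: "norm ?X < \<epsilon> / 3" "norm ?Y < \<epsilon> / 3" "norm ?Z < \<epsilon> / 3"
      using d1(2)[OF tagged_partition_finer[OF s d(2)]] d2(2)[OF tagged_partition_finer[OF t d(3)]]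
        d3(2)[OF tagged_partition_finer[OF tagged_partition_concat[OF s t] d(4)]]
      by (simp_all add: RS_sum_concat[where s = s and t = t and n = n and \<xi> = s and \<eta> = t, OF st])
    have tri: "norm (X + Y - Z) \<le> norm X + norm Y + norm Z" for X Y Z :: 'a
      using norm_triangle_ineq4[of "X + Y" Z] norm_triangle_ineq[of X Y] by linarith
    have eq: "K - (I + J) = ?X + ?Y - ?Z" by simp
    have "norm (K - (I + J)) \<le> norm ?X + norm ?Y + norm ?Z"
      unfolding eq by (rule tri)
    also have "\<dots> \<le> \<epsilon>" using lt by linarith
    finally show ?thesis .
  qed
  have "norm (K - (I + J)) \<le> 0"
    by (rule field_le_epsilon) (use le in simp)
  then show ?thesis by simp
qed

lemma has_RS_integral_bounded_linear:
  assumes "has_RS_integral f g a b I" "bounded_linear L"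
  shows "has_RS_integral f (\<lambda>t. L (g t)) a b (L I)"
proof -
  interpret L: bounded_linear L by fact
  obtain K where K: "0 < K" "\<And>x. norm (L x) \<le> norm x * K"
    using L.pos_bounded by blast
  show ?thesis
    unfolding has_RS_integral_iff
  proof (intro allI impI)
    fix \<epsilon> :: real assume "0 < \<epsilon>"
    then have "0 < \<epsilon> / K" using K by simp
    from has_RS_integralE[OF assms(1) this] obtain \<delta> where \<delta>: "0 < \<delta>"
      "\<And>n t \<xi>. tagged_partition \<delta> a b n t \<xi> \<Longrightarrow> norm (RS_sum f g n t \<xi> - I) < \<epsilon> / K" by blast
    have "norm (RS_sum f (\<lambda>t. L (g t)) n t \<xi> - L I) < \<epsilon>" if "tagged_partition \<delta> a b n t \<xi>" for n t \<xi>
    proof -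
      have "RS_sum f (\<lambda>t. L (g t)) n t \<xi> - L I = L (RS_sum f g n t \<xi> - I)"
        by (simp add: RS_sum_def L.diff L.sum L.scaleR)
      then have "norm (RS_sum f (\<lambda>t. L (g t)) n t \<xi> - L I) \<le> norm (RS_sum f g n t \<xi> - I) * K"
        using K(2) by simp
      also have "\<dots> < \<epsilon> / K * K" using \<delta>(2)[OF that] K(1) by (intro mult_strict_right_mono) auto
      finally show ?thesis using K(1) by simp
    qed
    then show "\<exists>\<delta>>0. \<forall>n t \<xi>. tagged_partition \<delta> a b n t \<xi> \<longrightarrow>
        norm (RS_sum f (\<lambda>t. L (g t)) n t \<xi> - L I) < \<epsilon>"
      using \<delta>(1) by blast
  qed
qed

section \<open>Oscillation\<close>

definition osc :: "(real \<Rightarrow> real) \<Rightarrow> real \<Rightarrow> real \<Rightarrow> real" where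
  "osc f a b = (SUP (x, y)\<in>{a..b} \<times> {a..b}. \<bar>f x - f y\<bar>)"

context
  fixes f :: "real \<Rightarrow> real" and a b B :: real
  assumes bounded: "\<And>x. x \<in> {a..b} \<Longrightarrow> \<bar>f x\<bar> \<le> B"
begin

lemma bdd_above_osc: "bdd_above ((\<lambda>(x, y). \<bar>f x - f y\<bar>) ` ({a..b} \<times> {a..b}))"
proof (rule bdd_aboveI2)
  fix p assume "p \<in> {a..b} \<times> {a..b}"
  then show "(case p of (x, y) \<Rightarrow> \<bar>f x - f y\<bar>) \<le> 2 * B"
    using bounded[of "fst p"] bounded[of "snd p"] by (auto split: prod.splits)
qed

lemma diff_le_osc:
  assumes "x \<in> {a..b}" "y \<in> {a..b}"
  shows "\<bar>f x - f y\<bar> \<le> osc f a b"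
  using cSUP_upper[OF _ bdd_above_osc, of "(x, y)"] assms by (simp add: osc_def)

lemma osc_nonneg:
  assumes "a \<le> b"
  shows "0 \<le> osc f a b"
  using diff_le_osc[of a a] assms by simp

lemma osc_half_attained:
  assumes "a \<le> b"
  shows "\<exists>x y. x \<in> {a..b} \<and> y \<in> {a..b} \<and> osc f a b \<le> 2 * (f x - f y) \<and> 0 \<le> f x - f y"
proof (cases "osc f a b = 0")
  case True
  then show ?thesis using assms by (intro exI[of _ a]) auto
next
  case False
  then have "osc f a b / 2 < (SUP (x, y)\<in>{a..b} \<times> {a..b}. \<bar>f x - f y\<bar>)"
    using osc_nonneg[OF assms] by (simp add: osc_def[symmetric])
  then have "\<exists>p\<in>{a..b} \<times> {a..b}. osc f a b / 2 < (case p of (x, y) \<Rightarrow> \<bar>f x - f y\<bar>)"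
    by (rule less_cSUP_iff[THEN iffD1, OF _ bdd_above_osc, rotated]) (use assms in auto)
  then obtain x y where xy: "x \<in> {a..b}" "y \<in> {a..b}" "osc f a b / 2 < \<bar>f x - f y\<bar>"
    by auto
  show ?thesis
  proof (cases "f y \<le> f x")
    case True
    then show ?thesis using xy by (intro exI[of _ x] exI[of _ y]) auto
  next
    case False
    then show ?thesis using xy by (intro exI[of _ y] exI[of _ x]) auto
  qed
qed

end

text \<open>A supremum need not be attained, but half of a positive one is exceeded. Accepting the factor
  \<open>2\<close> avoids an additional error term.\<close>

lemma partition_extreme_tags:
  assumes t: "tagged_partition d a b n t \<xi>" and B: "\<And>x. x \<in> {a..b} \<Longrightarrow> \<bar>f x\<bar> \<le> B"
  shows "\<exists>x y. tagged_partition d a b n t x \<and> tagged_partition d a b n t y \<and>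
    (\<forall>k<n. osc f (t k) (t (Suc k)) \<le> 2 * (f (x k) - f (y k)))"
proof -
  have "\<forall>k. \<exists>x y. k < n \<longrightarrow> x \<in> {t k..t (Suc k)} \<and> y \<in> {t k..t (Suc k)} \<and>
      osc f (t k) (t (Suc k)) \<le> 2 * (f x - f y) \<and> 0 \<le> f x - f y"
  proof
    fix k
    show "\<exists>x y. k < n \<longrightarrow> x \<in> {t k..t (Suc k)} \<and> y \<in> {t k..t (Suc k)} \<and>
      osc f (t k) (t (Suc k)) \<le> 2 * (f x - f y) \<and> 0 \<le> f x - f y"
    proof (cases "k < n")
      case True
      have "\<bar>f x\<bar> \<le> B" if "x \<in> {t k..t (Suc k)}" for x
        using tagged_partition_cells[OF t True] that by (intro B) auto
      from osc_half_attained[OF this] tagged_partition_cells(1)[OF t True] show ?thesis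
        by fastforce
    qed simp
  qed
  from choice[OF this] obtain x where "\<forall>k. \<exists>y. k < n \<longrightarrow> x k \<in> {t k..t (Suc k)} \<and> y \<in> {t k..t (Suc k)} \<and>
      osc f (t k) (t (Suc k)) \<le> 2 * (f (x k) - f y) \<and> 0 \<le> f (x k) - f y" ..
  from choice[OF this] obtain y where
    "\<forall>k. k < n \<longrightarrow> x k \<in> {t k..t (Suc k)} \<and> y k \<in> {t k..t (Suc k)} \<and>
      osc f (t k) (t (Suc k)) \<le> 2 * (f (x k) - f (y k)) \<and> 0 \<le> f (x k) - f (y k)" ..
  then show ?thesis
    by (intro exI[of _ x] exI[of _ y] conjI tagged_partition_retag[OF t]) simp_all
qed

text \<open>Choosing the tags nearly extremal turns the Cauchy condition for two taggings of one
  partition into smallness of the oscillation sums of Darboux.\<close>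

lemma RS_Cauchy_osc_sum:
  fixes \<rho> :: "real \<Rightarrow> real"
  assumes C: "RS_Cauchy f \<rho> a b" and B: "\<And>x. x \<in> {a..b} \<Longrightarrow> \<bar>f x\<bar> \<le> B"
    and mono: "mono \<rho>" and \<epsilon>: "0 < \<epsilon>"
  obtains \<delta> where "0 < \<delta>" "\<And>c d n t \<xi>. a \<le> c \<Longrightarrow> c \<le> d \<Longrightarrow> d \<le> b \<Longrightarrow>
    tagged_partition \<delta> c d n t \<xi> \<Longrightarrow>
    (\<Sum>k<n. osc f (t k) (t (Suc k)) * (\<rho> (t (Suc k)) - \<rho> (t k))) \<le> \<epsilon>"
proof -
  have "0 < \<epsilon> / 2" using \<epsilon> by simp
  from RS_CauchyE[OF C this] obtain \<delta> where \<delta>: "0 < \<delta>" "RS_sums_close f \<rho> a b (\<epsilon> / 2) \<delta>" by blast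
  have main: "(\<Sum>k<n. osc f (t k) (t (Suc k)) * (\<rho> (t (Suc k)) - \<rho> (t k))) \<le> \<epsilon>"
    if cd: "a \<le> c" "c \<le> d" "d \<le> b" and t: "tagged_partition \<delta> c d n t \<xi>" for c d n t \<xi>
  proof -
    have bd: "\<And>x. x \<in> {c..d} \<Longrightarrow> \<bar>f x\<bar> \<le> B" using cd B by auto
    from partition_extreme_tags[where f = f, OF t bd] obtain x y where
      xy: "tagged_partition \<delta> c d n t x" "tagged_partition \<delta> c d n t y"
      "\<And>k. k < n \<Longrightarrow> osc f (t k) (t (Suc k)) \<le> 2 * (f (x k) - f (y k))"
      by blast
    have "(\<Sum>k<n. osc f (t k) (t (Suc k)) * (\<rho> (t (Suc k)) - \<rho> (t k)))
        \<le> (\<Sum>k<n. 2 * (f (x k) - f (y k)) * (\<rho> (t (Suc k)) - \<rho> (t k)))"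
    proof (intro sum_mono mult_right_mono)
      fix k assume "k \<in> {..<n}"
      then show "osc f (t k) (t (Suc k)) \<le> 2 * (f (x k) - f (y k))" using xy(3) by simp
      show "0 \<le> \<rho> (t (Suc k)) - \<rho> (t k)"
        using \<open>k \<in> {..<n}\<close> tagged_partition_cells(1)[OF t] monoD[OF mono] by (simp add: less_imp_le)
    qed
    also have "\<dots> = 2 * (RS_sum f \<rho> n t x - RS_sum f \<rho> n t y)"
      by (simp add: RS_sum_def sum_subtractf[symmetric] sum_distrib_left algebra_simps)
    also have "\<dots> \<le> 2 * \<bar>RS_sum f \<rho> n t x - RS_sum f \<rho> n t y\<bar>"
      by (intro mult_left_mono abs_ge_self) simp
    also have "\<dots> \<le> \<epsilon>" using RS_sums_closeD[OF \<delta>(2) cd xy(1,2)] by simp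
    finally show ?thesis .
  qed
  show thesis by (rule that[OF \<delta>(1) main])
qed

section \<open>Finite orthogonal decompositions and spectral families\<close>

text \<open>The projections need not add up to the identity: a truncation sees only a finite-dimensional
  subspace, and a grid only a bounded part of the spectrum.\<close>

definition resolution :: "'i set \<Rightarrow> ('i \<Rightarrow> 'h::chilbert_space \<Rightarrow> 'h) \<Rightarrow> bool" where
  "resolution K Q \<longleftrightarrow> finite K \<and> (\<forall>k\<in>K. orthogonal_projection (Q k)) \<and>
     (\<forall>j\<in>K. \<forall>k\<in>K. j \<noteq> k \<longrightarrow> (\<forall>x. Q j (Q k x) = 0))"

lemma orthogonal_projectionD:
  assumes "orthogonal_projection P"
  shows "clinear_on UNIV P" "P (P x) = P x" "cinner (P x) y = cinner x (P y)"
  using assms by (auto simp: orthogonal_projection_def)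

lemma resolution_norm_square:
  assumes "resolution K Q"
  shows "(norm (\<Sum>k\<in>K. c k *\<^sub>C Q k x))\<^sup>2 = (\<Sum>k\<in>K. (cmod (c k))\<^sup>2 * (norm (Q k x))\<^sup>2)"
proof -
  have "cinner (c i *\<^sub>C Q i x) (c j *\<^sub>C Q j x) = 0" if "i \<in> K" "j \<in> K" "i \<noteq> j" for i j
  proof -
    have "cinner (Q i x) (Q j x) = cinner x (Q i (Q j x))"
      using assms that orthogonal_projectionD(3)[of "Q i"] by (auto simp: resolution_def)
    then show ?thesis
      using assms that by (simp add: resolution_def cinner_scaleC_left cinner_scaleC_right)
  qed
  then have "(norm (\<Sum>k\<in>K. c k *\<^sub>C Q k x))\<^sup>2 = (\<Sum>k\<in>K. (norm (c k *\<^sub>C Q k x))\<^sup>2)"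
    using assms by (intro norm_sum_orthogonal_square) (auto simp: resolution_def)
  then show ?thesis by (simp add: norm_scaleC power_mult_distrib)
qed

lemma resolution_norm_square_sum:
  assumes "resolution K Q"
  shows "(norm (\<Sum>k\<in>K. Q k x))\<^sup>2 = (\<Sum>k\<in>K. (norm (Q k x))\<^sup>2)"
  using resolution_norm_square[OF assms, of "\<lambda>_. 1"] by simp

lemma resolution_contraction:
  assumes "resolution K Q"
  shows "norm (\<Sum>k\<in>K. Q k x) \<le> norm x"
proof -
  define y where "y = (\<Sum>k\<in>K. Q k x)"
  have "complex_of_real ((norm y)\<^sup>2) = (\<Sum>k\<in>K. complex_of_real ((norm (Q k x))\<^sup>2))"
    unfolding y_def resolution_norm_square_sum[OF assms] by simp
  also have "\<dots> = (\<Sum>k\<in>K. cinner x (Q k x))"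
  proof (rule sum.cong[OF refl])
    fix k assume "k \<in> K"
    then have "orthogonal_projection (Q k)" using assms by (simp add: resolution_def)
    then have "cinner (Q k x) (Q k x) = cinner x (Q k x)"
      by (simp add: orthogonal_projectionD)
    then show "complex_of_real ((norm (Q k x))\<^sup>2) = cinner x (Q k x)"
      by (simp add: cinner_self)
  qed
  also have "\<dots> = cinner x y" by (simp add: y_def cinner_sum_right)
  finally have "(norm y)\<^sup>2 = cmod (cinner x y)"
    by (metis norm_of_real abs_of_nonneg zero_le_power2)
  also have "\<dots> \<le> norm x * norm y" by (rule Cauchy_Schwarz_cinner)
  finally have "norm y * norm y \<le> norm x * norm y" by (simp add: power2_eq_square)
  then have "norm y \<le> norm x" by (cases "y = 0") auto
  then show ?thesis by (simp add: y_def)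
qed

lemma resolution_projection: "resolution K Q \<Longrightarrow> k \<in> K \<Longrightarrow> orthogonal_projection (Q k)"
  by (simp add: resolution_def)

text \<open>This is the common refinement of two commuting decompositions.\<close>

lemma resolution_product:
  assumes P: "resolution K P" and Q: "resolution L Q"
    and comm: "\<And>k l x. k \<in> K \<Longrightarrow> l \<in> L \<Longrightarrow> P k (Q l x) = Q l (P k x)"
  shows "resolution (K \<times> L) (\<lambda>(k, l) x. P k (Q l x))"
proof -
  note PD = orthogonal_projectionD[OF resolution_projection[OF P]]
  note QD = orthogonal_projectionD[OF resolution_projection[OF Q]]
  have op: "orthogonal_projection (\<lambda>x. P k (Q l x))" if "k \<in> K" "l \<in> L" for k l
  proof -
    have "clinear_on UNIV (\<lambda>x. P k (Q l x))"
      using PD(1)[OF that(1)] QD(1)[OF that(2)] by (simp add: clinear_on_def)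
    moreover have "P k (Q l (P k (Q l x))) = P k (Q l x)" for x
      by (simp only: comm[OF that, symmetric] PD(2)[OF that(1)] QD(2)[OF that(2)])
    moreover have "cinner (P k (Q l x)) y = cinner x (P k (Q l y))" for x y
      by (simp only: PD(3)[OF that(1)] QD(3)[OF that(2)] comm[OF that, symmetric])
    ultimately show ?thesis by (simp add: orthogonal_projection_def)
  qed
  have zero: "P k (Q l (P k' (Q l' x))) = 0"
    if "k \<in> K" "l \<in> L" "k' \<in> K" "l' \<in> L" "(k, l) \<noteq> (k', l')" for k l k' l' x
  proof -
    have "P k (Q l (P k' (Q l' x))) = P k (P k' (Q l (Q l' x)))"
      by (simp only: comm[OF that(3,2), symmetric])
    also have "\<dots> = 0"
    proof (cases "k = k'")
      case True
      then have "Q l (Q l' x) = 0" using that Q by (auto simp: resolution_def)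
      then show ?thesis
        using clinear_onD(1)[OF PD(1)] that by simp
    next
      case False
      then show ?thesis using that P by (auto simp: resolution_def)
    qed
    finally show ?thesis .
  qed
  show ?thesis
    unfolding resolution_def
    using P Q op zero by (auto simp: resolution_def)
qed

definition spectral_sum ::
    "'i set \<Rightarrow> ('i \<Rightarrow> real) \<Rightarrow> ('i \<Rightarrow> 'h::chilbert_space \<Rightarrow> 'h) \<Rightarrow> (real \<Rightarrow> complex) \<Rightarrow> 'h \<Rightarrow> 'h" where
  "spectral_sum K l Q g x = (\<Sum>k\<in>K. g (l k) *\<^sub>C Q k x)"

lemma functional_calculus_spectral_sum:
  fixes Q :: "'i \<Rightarrow> 'h::chilbert_space \<Rightarrow> 'h"
  assumes res: "resolution K Q"
  shows "functional_calculus (spectral_sum K l Q)"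
proof
  have fin: "finite K" using res by (simp add: resolution_def)
  have lin: "clinear_on UNIV (Q k)" if "k \<in> K" for k
    using res that orthogonal_projectionD(1) unfolding resolution_def by blast
  have QQ: "Q k (Q k x) = Q k x" if "k \<in> K" for k x
    using res that orthogonal_projectionD(2) unfolding resolution_def by blast
  have ortho: "Q j (Q k x) = 0" if "j \<in> K" "k \<in> K" "j \<noteq> k" for j k x
    using res that by (simp add: resolution_def)
  fix g h :: "real \<Rightarrow> complex" and x :: 'h and c :: complex
  show "clinear_on UNIV (spectral_sum K l Q g)"
    unfolding clinear_on_def spectral_sum_def
    by (auto simp: clinear_onD[OF lin] scaleC_add_right sum.distrib scaleC_sum_right scaleC_scaleC
        mult.commute intro!: sum.cong)
  show "spectral_sum K l Q (\<lambda>t. g t + h t) x = spectral_sum K l Q g x + spectral_sum K l Q h x"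
    by (simp add: spectral_sum_def scaleC_add_left sum.distrib)
  show "spectral_sum K l Q (\<lambda>t. c * g t) x = c *\<^sub>C spectral_sum K l Q g x"
    by (simp add: spectral_sum_def scaleC_sum_right scaleC_scaleC)
  have "Q k (\<Sum>j\<in>K. h (l j) *\<^sub>C Q j x) = h (l k) *\<^sub>C Q k x" if k: "k \<in> K" for k
  proof -
    have "Q k (\<Sum>j\<in>K. h (l j) *\<^sub>C Q j x) = (\<Sum>j\<in>K. h (l j) *\<^sub>C Q k (Q j x))"
      by (simp add: clinear_onD[OF lin[OF k]])
    also have "\<dots> = (\<Sum>j\<in>K. if j = k then h (l k) *\<^sub>C Q k x else 0)"
      by (rule sum.cong) (use k QQ ortho in auto)
    finally show ?thesis using fin k by simp
  qed
  then show "spectral_sum K l Q (\<lambda>t. g t * h t) x = spectral_sum K l Q g (spectral_sum K l Q h x)"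
    by (simp add: spectral_sum_def scaleC_scaleC)
  show "norm (spectral_sum K l Q g x) \<le> norm (spectral_sum K l Q h x)"
    if le: "\<And>t. cmod (g t) \<le> cmod (h t)"
  proof -
    have "(norm (spectral_sum K l Q g x))\<^sup>2 \<le> (norm (spectral_sum K l Q h x))\<^sup>2"
      unfolding spectral_sum_def resolution_norm_square[OF res]
      by (intro sum_mono mult_right_mono power_mono le) auto
    then show ?thesis by (rule power2_le_imp_le) simp
  qed
  show "norm (spectral_sum K l Q (\<lambda>_. 1) x) \<le> norm x"
    unfolding spectral_sum_def using resolution_contraction[OF res, of x] by simp
qed

lemma resolution_orthonormal:
  assumes "finite K" and u: "\<And>k l. k \<in> K \<Longrightarrow> l \<in> K \<Longrightarrow> cinner (u k) (u l) = (if k = l then 1 else 0)"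
  shows "resolution K (\<lambda>k x. cinner (u k) x *\<^sub>C u k)"
proof -
  have "orthogonal_projection (\<lambda>x. cinner (u k) x *\<^sub>C u k)" if "k \<in> K" for k
  proof -
    have "cinner (cinner (u k) x *\<^sub>C u k) y = cinner x (cinner (u k) y *\<^sub>C u k)" for x y
      unfolding cinner_scaleC_left cinner_scaleC_right
      by (subst cinner_commute[of x]) simp
    then show ?thesis
      using u[OF that that]
      by (simp add: orthogonal_projection_def clinear_on_def cinner_add_right
          cinner_scaleC_right scaleC_add_left scaleC_scaleC)
  qed
  then show ?thesis
    using assms by (simp add: resolution_def cinner_scaleC_right)
qed

definition increment :: "(real \<Rightarrow> 'h::chilbert_space \<Rightarrow> 'h) \<Rightarrow> real \<Rightarrow> real \<Rightarrow> 'h \<Rightarrow> 'h" where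
  "increment E s t x = E t x - E s x"

context
  fixes E :: "real \<Rightarrow> 'h::chilbert_space \<Rightarrow> 'h"
  assumes E: "spectral_family E"
begin

lemma spectral_family_projection: "orthogonal_projection (E t)"
  using E by (simp add: spectral_family_def)

lemmas spectral_family_linear = clinear_onD[OF orthogonal_projectionD(1)[OF spectral_family_projection]]

text \<open>For \<open>s \<le> t\<close> this is part of the definition of a spectral family. The other case follows by taking
  adjoints.\<close>

lemma spectral_family_min: "E s (E t x) = E (min s t) x"
proof -
  have le: "E s (E t x) = E s x" if "s \<le> t" for s t x
    using E that by (simp add: spectral_family_def)
  show ?thesis
  proof (cases "s \<le> t")
    case False
    have "cinner (E s (E t x) - E t x) y = 0" for y
    proof -
      have "cinner (E s (E t x)) y = cinner x (E t (E s y))"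
        by (simp add: orthogonal_projectionD(3)[OF spectral_family_projection])
      also have "\<dots> = cinner (E t x) y"
        using le[of t s] False by (simp add: orthogonal_projectionD(3)[OF spectral_family_projection])
      finally show ?thesis by (simp add: cinner_diff_left)
    qed
    from this[of "E s (E t x) - E t x"] have "E s (E t x) = E t x"
      by (simp add: cinner_self)
    then show ?thesis using False by (simp add: min_def)
  qed (simp add: le min_def)
qed

lemma increment_increment:
  "increment E s t (increment E s' t' x) =
    E (min t t') x - E (min t s') x - E (min s t') x + E (min s s') x"
  by (simp add: increment_def spectral_family_linear spectral_family_min)

lemma increment_commute:
  "increment E s t (increment E s' t' x) = increment E s' t' (increment E s t x)"
  unfolding increment_increment by (simp add: min.commute)

lemma increment_disjoint:
  assumes "s \<le> t" "s' \<le> t'" "t \<le> s' \<or> t' \<le> s"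
  shows "increment E s t (increment E s' t' x) = 0"
  using assms(3)
proof
  assume "t \<le> s'"
  then have "t \<le> t'" "s \<le> s'" "s \<le> t'" using assms by linarith+
  then show ?thesis using \<open>t \<le> s'\<close> unfolding increment_increment by (simp add: min_absorb1)
next
  assume "t' \<le> s"
  then have "t' \<le> t" "s' \<le> s" "s' \<le> t" using assms by linarith+
  then show ?thesis using \<open>t' \<le> s\<close> unfolding increment_increment by (simp add: min_absorb2)
qed

lemma increment_subset:
  assumes "c \<le> s" "s \<le> t" "t \<le> d"
  shows "increment E c d (increment E s t x) = increment E s t x"
  using assms unfolding increment_increment by (simp add: min_def increment_def)

lemma increment_projection:
  assumes "s \<le> t"
  shows "orthogonal_projection (increment E s t)"
proof -
  have "clinear_on UNIV (increment E s t)"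
    by (simp add: clinear_on_def increment_def spectral_family_linear scaleC_diff_right)
  moreover have "cinner (increment E s t x) y = cinner x (increment E s t y)" for x y
    by (simp add: increment_def cinner_diff_left cinner_diff_right orthogonal_projectionD(3)[OF spectral_family_projection])
  ultimately show ?thesis
    using increment_subset[of s s t t] assms by (simp add: orthogonal_projection_def)
qed

lemma norm_increment_square:
  assumes "s \<le> t"
  shows "(norm (increment E s t x))\<^sup>2 = (norm (E t x))\<^sup>2 - (norm (E s x))\<^sup>2"
proof -
  have "E t x = E s x + increment E s t x" by (simp add: increment_def)
  moreover have "cinner (E s x) (increment E s t x) = 0"
    unfolding orthogonal_projectionD(3)[OF spectral_family_projection]
    using assms by (simp add: increment_def spectral_family_linear spectral_family_min min_def)
  ultimately show ?thesis using norm_add_square[of "E s x" "increment E s t x"] by simp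
qed

lemma mono_norm_spectral_family: "mono (\<lambda>t. (norm (E t x))\<^sup>2)"
proof (rule monoI)
  fix s t :: real assume "s \<le> t"
  from norm_increment_square[OF this, of x] zero_le_power2[of "norm (increment E s t x)"]
  show "(norm (E s x))\<^sup>2 \<le> (norm (E t x))\<^sup>2" by linarith
qed

lemma resolution_partition:
  assumes "tagged_partition d a b n t \<xi>"
  shows "resolution {..<n} (\<lambda>k. increment E (t k) (t (Suc k)))"
proof -
  have "increment E (t j) (t (Suc j)) (increment E (t k) (t (Suc k)) x) = 0"
    if "j < n" "k < n" "j \<noteq> k" for j k x
  proof (rule increment_disjoint)
    show "t j \<le> t (Suc j)" "t k \<le> t (Suc k)"
      using tagged_partition_cells(1)[OF assms] that by (simp_all add: less_imp_le)
    show "t (Suc j) \<le> t k \<or> t (Suc k) \<le> t j"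
      using tagged_partition_mono[OF assms, of "Suc j" k] tagged_partition_mono[OF assms, of "Suc k" j] that
      by linarith
  qed
  moreover have "orthogonal_projection (increment E (t k) (t (Suc k)))" if "k < n" for k
    using tagged_partition_cells(1)[OF assms that] by (intro increment_projection) simp
  ultimately show ?thesis by (simp add: resolution_def)
qed

lemma sum_increment_partition:
  assumes "tagged_partition d a b n t \<xi>"
  shows "(\<Sum>k<n. increment E (t k) (t (Suc k)) x) = increment E a b x"
proof -
  have "(\<Sum>k<n. increment E (t k) (t (Suc k)) x) = E (t n) x - E (t 0) x"
    unfolding increment_def by (rule sum_lessThan_telescope)
  then show ?thesis using assms by (simp add: tagged_partition_def increment_def)
qed

lemma RS_sum_increment:
  "RS_sum f (\<lambda>t. E t x) n t \<xi> = (\<Sum>k<n. complex_of_real (f (\<xi> k)) *\<^sub>C increment E (t k) (t (Suc k)) x)"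
  by (simp add: RS_sum_def increment_def scaleC_of_real)

text \<open>Both sums are refined to the products of the two families of increments, which vanish
  unless the cells meet. On cells that meet, the two values of \<open>f\<close> differ by at most the sum of
  the oscillations, and by orthogonality the squared norm of the difference is bounded by a
  multiple of the two oscillation sums for \<open>\<parallel>E(t)x\<parallel>\<^sup>2\<close>.\<close>

lemma RS_Cauchy_vector:
  assumes C: "RS_Cauchy f (\<lambda>t. (norm (E t x))\<^sup>2) a b" and B: "\<And>x. x \<in> {a..b} \<Longrightarrow> \<bar>f x\<bar> \<le> B"
  shows "RS_Cauchy f (\<lambda>t. E t x) a b"
  unfolding RS_Cauchy_def
proof (intro allI impI)
  fix \<epsilon> :: real assume \<epsilon>: "0 < \<epsilon>"
  define D where "D = \<bar>B\<bar> + 1"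
  have D: "0 < D" "B \<le> D" by (auto simp: D_def)
  have pos: "0 < \<epsilon>\<^sup>2 / (8 * D)" using \<epsilon> D by simp
  from RS_Cauchy_osc_sum[OF C B mono_norm_spectral_family pos] obtain \<delta> where \<delta>: "0 < \<delta>"
    "\<And>c d n t \<xi>. a \<le> c \<Longrightarrow> c \<le> d \<Longrightarrow> d \<le> b \<Longrightarrow> tagged_partition \<delta> c d n t \<xi> \<Longrightarrow>
    (\<Sum>k<n. osc f (t k) (t (Suc k)) * ((norm (E (t (Suc k)) x))\<^sup>2 - (norm (E (t k) x))\<^sup>2)) \<le> \<epsilon>\<^sup>2 / (8 * D)"
    by blast
  have "norm (RS_sum f (\<lambda>t. E t x) n t \<xi> - RS_sum f (\<lambda>t. E t x) n' t' \<xi>') < \<epsilon>"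
    if cd: "a \<le> c" "c \<le> d" "d \<le> b" and t: "tagged_partition \<delta> c d n t \<xi>"
      and t': "tagged_partition \<delta> c d n' t' \<xi>'" for c d n t \<xi> n' t' \<xi>'
  proof -
    define P where "P k = increment E (t k) (t (Suc k))" for k
    define Q where "Q l = increment E (t' l) (t' (Suc l))" for l
    define w where "w k = osc f (t k) (t (Suc k))" for k
    define w' where "w' l = osc f (t' l) (t' (Suc l))" for l
    have rP: "resolution {..<n} P" unfolding P_def by (rule resolution_partition[OF t])
    have rQ: "resolution {..<n'} Q" unfolding Q_def by (rule resolution_partition[OF t'])
    have comm: "P k (Q l y) = Q l (P k y)" for k l y
      unfolding P_def Q_def by (rule increment_commute)
    have rPQ: "resolution ({..<n} \<times> {..<n'}) (\<lambda>(k, l) x. P k (Q l x))"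
      by (rule resolution_product[OF rP rQ comm])
    have sumQ: "(\<Sum>l<n'. Q l (P k x)) = P k x" if "k < n" for k
      unfolding P_def Q_def sum_increment_partition[OF t']
      using tagged_partition_cells[OF t that] by (intro increment_subset) auto
    have sumP: "(\<Sum>k<n. P k (Q l x)) = Q l x" if "l < n'" for l
      unfolding P_def Q_def sum_increment_partition[OF t]
      using tagged_partition_cells[OF t' that] by (intro increment_subset) auto
    have S: "RS_sum f (\<lambda>t. E t x) n t \<xi> = (\<Sum>k<n. \<Sum>l<n'. complex_of_real (f (\<xi> k)) *\<^sub>C P k (Q l x))"
      unfolding RS_sum_increment P_def[symmetric]
      by (rule sum.cong) (auto simp: scaleC_sum_right[symmetric] comm sumQ)
    have S': "RS_sum f (\<lambda>t. E t x) n' t' \<xi>' = (\<Sum>k<n. \<Sum>l<n'. complex_of_real (f (\<xi>' l)) *\<^sub>C P k (Q l x))"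
      unfolding RS_sum_increment Q_def[symmetric]
      by (subst sum.swap, rule sum.cong) (auto simp: scaleC_sum_right[symmetric] sumP)
    have diff: "RS_sum f (\<lambda>t. E t x) n t \<xi> - RS_sum f (\<lambda>t. E t x) n' t' \<xi>' =
        (\<Sum>p\<in>{..<n} \<times> {..<n'}. complex_of_real (f (\<xi> (fst p)) - f (\<xi>' (snd p))) *\<^sub>C (\<lambda>(k, l) x. P k (Q l x)) p x)"
      unfolding S S' sum_subtractf[symmetric] sum.cartesian_product
      by (simp add: scaleC_diff_left case_prod_beta)
    have bd: "\<bar>f y\<bar> \<le> B" if "y \<in> {c..d}" for y using that cd by (intro B) auto
    have cell: "(f (\<xi> k) - f (\<xi>' l))\<^sup>2 * (norm (P k (Q l x)))\<^sup>2 \<le>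
        2 * D * (w k * (norm (P k (Q l x)))\<^sup>2 + w' l * (norm (P k (Q l x)))\<^sup>2)"
      if k: "k < n" and l: "l < n'" for k l
    proof (cases "P k (Q l x) = 0")
      case False
      note ck = tagged_partition_cells[OF t k] and cl = tagged_partition_cells[OF t' l]
      have meet: "t' l < t (Suc k)" "t k < t' (Suc l)"
        using False increment_disjoint[of "t k" "t (Suc k)" "t' l" "t' (Suc l)" x] ck(1) cl(1)
        unfolding P_def Q_def by force+
      define m where "m = max (t k) (t' l)"
      have m: "m \<in> {t k..t (Suc k)}" "m \<in> {t' l..t' (Suc l)}"
        using meet ck(1) cl(1) by (auto simp: m_def)
      have "\<bar>f (\<xi> k) - f m\<bar> \<le> w k" unfolding w_def
        by (rule diff_le_osc[where B = B]) (use bd m ck in auto)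
      moreover have "\<bar>f (\<xi>' l) - f m\<bar> \<le> w' l" unfolding w'_def
        by (rule diff_le_osc[where B = B]) (use bd m cl in auto)
      ultimately have le: "\<bar>f (\<xi> k) - f (\<xi>' l)\<bar> \<le> w k + w' l" by linarith
      have "\<bar>f (\<xi> k) - f (\<xi>' l)\<bar> \<le> 2 * D"
        using bd[of "\<xi> k"] bd[of "\<xi>' l"] ck cl D(2) by auto
      then have "\<bar>f (\<xi> k) - f (\<xi>' l)\<bar> * \<bar>f (\<xi> k) - f (\<xi>' l)\<bar> \<le> 2 * D * (w k + w' l)"
        by (intro mult_mono le) (use D in auto)
      then have "(f (\<xi> k) - f (\<xi>' l))\<^sup>2 * (norm (P k (Q l x)))\<^sup>2 \<le> 2 * D * (w k + w' l) * (norm (P k (Q l x)))\<^sup>2"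
        by (intro mult_right_mono) (simp_all add: power2_eq_square)
      then show ?thesis by (simp add: algebra_simps)
    qed simp
    have "(norm (RS_sum f (\<lambda>t. E t x) n t \<xi> - RS_sum f (\<lambda>t. E t x) n' t' \<xi>'))\<^sup>2 =
        (\<Sum>k<n. \<Sum>l<n'. (f (\<xi> k) - f (\<xi>' l))\<^sup>2 * (norm (P k (Q l x)))\<^sup>2)"
      unfolding diff resolution_norm_square[OF rPQ] sum.cartesian_product
      by (simp add: case_prod_beta del: of_real_diff)
    also have "\<dots> \<le> (\<Sum>k<n. \<Sum>l<n'. 2 * D * (w k * (norm (P k (Q l x)))\<^sup>2 + w' l * (norm (P k (Q l x)))\<^sup>2))"
      by (intro sum_mono cell) auto
    also have "\<dots> = 2 * D * ((\<Sum>k<n. \<Sum>l<n'. w k * (norm (P k (Q l x)))\<^sup>2) +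
        (\<Sum>k<n. \<Sum>l<n'. w' l * (norm (P k (Q l x)))\<^sup>2))"
      by (simp only: sum_distrib_left[symmetric] sum.distrib)
    also have "(\<Sum>k<n. \<Sum>l<n'. w' l * (norm (P k (Q l x)))\<^sup>2) =
        (\<Sum>l<n'. \<Sum>k<n. w' l * (norm (P k (Q l x)))\<^sup>2)"
      by (rule sum.swap)
    also have "\<dots> = (\<Sum>l<n'. w' l * (\<Sum>k<n. (norm (P k (Q l x)))\<^sup>2))"
      by (simp only: sum_distrib_left)
    also have "(\<Sum>k<n. \<Sum>l<n'. w k * (norm (P k (Q l x)))\<^sup>2) =
        (\<Sum>k<n. w k * (\<Sum>l<n'. (norm (P k (Q l x)))\<^sup>2))"
      by (simp only: sum_distrib_left)
    also have "(\<Sum>k<n. w k * (\<Sum>l<n'. (norm (P k (Q l x)))\<^sup>2)) = (\<Sum>k<n. w k * (norm (P k x))\<^sup>2)"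
      by (rule sum.cong) (auto simp: comm resolution_norm_square_sum[OF rQ, symmetric] sumQ)
    also have "(\<Sum>l<n'. w' l * (\<Sum>k<n. (norm (P k (Q l x)))\<^sup>2)) = (\<Sum>l<n'. w' l * (norm (Q l x))\<^sup>2)"
      by (rule sum.cong) (auto simp: resolution_norm_square_sum[OF rP, symmetric] sumP)
    also have "(\<Sum>k<n. w k * (norm (P k x))\<^sup>2) \<le> \<epsilon>\<^sup>2 / (8 * D)"
    proof -
      have "(\<Sum>k<n. w k * (norm (P k x))\<^sup>2) =
          (\<Sum>k<n. osc f (t k) (t (Suc k)) * ((norm (E (t (Suc k)) x))\<^sup>2 - (norm (E (t k) x))\<^sup>2))"
        using tagged_partition_cells(1)[OF t]
        by (intro sum.cong) (auto simp: w_def P_def norm_increment_square less_imp_le)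
      then show ?thesis using \<delta>(2)[OF cd t] by simp
    qed
    also have "(\<Sum>l<n'. w' l * (norm (Q l x))\<^sup>2) \<le> \<epsilon>\<^sup>2 / (8 * D)"
    proof -
      have "(\<Sum>l<n'. w' l * (norm (Q l x))\<^sup>2) =
          (\<Sum>k<n'. osc f (t' k) (t' (Suc k)) * ((norm (E (t' (Suc k)) x))\<^sup>2 - (norm (E (t' k) x))\<^sup>2))"
        using tagged_partition_cells(1)[OF t']
        by (intro sum.cong) (auto simp: w'_def Q_def norm_increment_square less_imp_le)
      then show ?thesis using \<delta>(2)[OF cd t'] by simp
    qed
    also have "2 * D * (\<epsilon>\<^sup>2 / (8 * D) + \<epsilon>\<^sup>2 / (8 * D)) = \<epsilon>\<^sup>2 / 2"
      using D by (simp add: field_simps)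
    also have "\<dots> < \<epsilon>\<^sup>2" using \<epsilon> by simp
    finally show ?thesis
      using \<epsilon> by (intro power2_less_imp_less[of _ \<epsilon>]) (use D in auto)
  qed
  then have "RS_sums_close f (\<lambda>t. E t x) a b \<epsilon> \<delta>" by (rule RS_sums_closeI)
  with \<delta>(1) show "\<exists>\<delta>>0. RS_sums_close f (\<lambda>t. E t x) a b \<epsilon> \<delta>" by blast
qed

text \<open>For the vector-valued integrator the same choice of tags bounds the squared oscillations, because
  the increments are orthogonal.\<close>

lemma RS_Cauchy_osc_square_sum:
  assumes C: "RS_Cauchy f (\<lambda>t. E t x) a b" and B: "\<And>x. x \<in> {a..b} \<Longrightarrow> \<bar>f x\<bar> \<le> B"
    and \<epsilon>: "0 < \<epsilon>"
  obtains \<delta> where "0 < \<delta>" "\<And>c d n t \<xi>. a \<le> c \<Longrightarrow> c \<le> d \<Longrightarrow> d \<le> b \<Longrightarrow>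
    tagged_partition \<delta> c d n t \<xi> \<Longrightarrow>
    (\<Sum>k<n. (osc f (t k) (t (Suc k)))\<^sup>2 * (norm (increment E (t k) (t (Suc k)) x))\<^sup>2) \<le> \<epsilon>"
proof -
  have "0 < sqrt (\<epsilon> / 4)" using \<epsilon> by simp
  from RS_CauchyE[OF C this] obtain \<delta> where \<delta>: "0 < \<delta>" "RS_sums_close f (\<lambda>t. E t x) a b (sqrt (\<epsilon> / 4)) \<delta>" by blast
  have main: "(\<Sum>k<n. (osc f (t k) (t (Suc k)))\<^sup>2 * (norm (increment E (t k) (t (Suc k)) x))\<^sup>2) \<le> \<epsilon>"
    if cd: "a \<le> c" "c \<le> d" "d \<le> b" and t: "tagged_partition \<delta> c d n t \<xi>" for c d n t \<xi>
  proof -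
    have bd: "\<And>x. x \<in> {c..d} \<Longrightarrow> \<bar>f x\<bar> \<le> B" using cd B by auto
    from partition_extreme_tags[where f = f, OF t bd] obtain y z where
      yz: "tagged_partition \<delta> c d n t y" "tagged_partition \<delta> c d n t z"
      "\<And>k. k < n \<Longrightarrow> osc f (t k) (t (Suc k)) \<le> 2 * (f (y k) - f (z k))"
      by blast
    let ?N = "\<lambda>k. (norm (increment E (t k) (t (Suc k)) x))\<^sup>2"
    have "(\<Sum>k<n. (osc f (t k) (t (Suc k)))\<^sup>2 * ?N k) \<le> (\<Sum>k<n. (2 * (f (y k) - f (z k)))\<^sup>2 * ?N k)"
    proof (intro sum_mono mult_right_mono power_mono)
      fix k assume "k \<in> {..<n}"
      then have k: "k < n" by simp
      show "osc f (t k) (t (Suc k)) \<le> 2 * (f (y k) - f (z k))" using yz(3) k by simp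
      show "0 \<le> osc f (t k) (t (Suc k))"
        by (rule osc_nonneg[where B = B]) (use bd tagged_partition_cells[OF t k] in auto)
    qed simp
    also have "\<dots> = 4 * (\<Sum>k<n. (cmod (complex_of_real (f (y k) - f (z k))))\<^sup>2 * ?N k)"
      by (simp add: power_mult_distrib sum_distrib_left mult.assoc
          del: of_real_diff right_diff_distrib_numeral)
    also have "\<dots> = 4 * (norm (RS_sum f (\<lambda>t. E t x) n t y - RS_sum f (\<lambda>t. E t x) n t z))\<^sup>2"
      unfolding resolution_norm_square[OF resolution_partition[OF t], symmetric] RS_sum_increment
      by (simp add: sum_subtractf scaleC_diff_left)
    also have "\<dots> \<le> 4 * (sqrt (\<epsilon> / 4))\<^sup>2"
      using less_imp_le[OF RS_sums_closeD[OF \<delta>(2) cd yz(1,2)]] by (intro mult_left_mono power_mono) auto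
    also have "\<dots> = \<epsilon>" using \<epsilon> by simp
    finally show ?thesis .
  qed
  show thesis by (rule that[OF \<delta>(1) main])
qed

end

section \<open>Lipschitz regularisation\<close>

text \<open>The smallest \<open>j\<close>-Lipschitz function above \<open>f\<close>, provided that there is one.\<close>

definition upper_envelope :: "(real \<Rightarrow> real) \<Rightarrow> real \<Rightarrow> real \<Rightarrow> real" where
  "upper_envelope f j x = (SUP y. f y - j * \<bar>x - y\<bar>)"

context
  fixes f :: "real \<Rightarrow> real" and a b j :: real
  assumes bd: "\<And>x. \<bar>f x\<bar> \<le> a + b * \<bar>x\<bar>" and j: "b \<le> j" and b: "0 \<le> b"
begin

lemma envelope_term_le: "f y - j * \<bar>x - y\<bar> \<le> a + b * \<bar>x\<bar>"
proof -
  have "b * \<bar>y\<bar> \<le> b * (\<bar>x\<bar> + \<bar>x - y\<bar>)" by (rule mult_left_mono[OF _ b]) simp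
  moreover have "b * \<bar>x - y\<bar> \<le> j * \<bar>x - y\<bar>" by (rule mult_right_mono[OF j]) simp
  moreover have "f y \<le> a + b * \<bar>y\<bar>" using bd[of y] by simp
  ultimately show ?thesis by (simp add: distrib_left)
qed

lemma bdd_above_envelope: "bdd_above (range (\<lambda>y. f y - j * \<bar>x - y\<bar>))"
  by (rule bdd_aboveI2[of _ _ "a + b * \<bar>x\<bar>"]) (rule envelope_term_le)

lemma envelope_upper: "f y - j * \<bar>x - y\<bar> \<le> upper_envelope f j x"
  unfolding upper_envelope_def by (rule cSUP_upper[OF UNIV_I bdd_above_envelope])

lemma envelope_least:
  assumes "\<And>y. f y - j * \<bar>x - y\<bar> \<le> c"
  shows "upper_envelope f j x \<le> c"
  unfolding upper_envelope_def by (rule cSUP_least) (use assms in auto)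

lemma le_upper_envelope: "f x \<le> upper_envelope f j x"
  using envelope_upper[of x x] by simp

lemma abs_upper_envelope_le: "\<bar>upper_envelope f j x\<bar> \<le> a + b * \<bar>x\<bar>"
  using envelope_least[of x, OF envelope_term_le] le_upper_envelope[of x] bd[of x] by linarith

lemma upper_envelope_Lipschitz: "upper_envelope f j x \<le> upper_envelope f j x' + j * \<bar>x - x'\<bar>"
proof (rule envelope_least)
  fix y
  have "j * \<bar>x' - y\<bar> \<le> j * (\<bar>x - y\<bar> + \<bar>x - x'\<bar>)"
    using j b by (intro mult_left_mono) auto
  then show "f y - j * \<bar>x - y\<bar> \<le> upper_envelope f j x' + j * \<bar>x - x'\<bar>"
    using envelope_upper[of y x'] by (simp add: distrib_left)
qed

lemma continuous_upper_envelope: "continuous_on UNIV (upper_envelope f j)"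
  unfolding continuous_on_iff
proof (intro ballI allI impI)
  fix x \<epsilon> :: real assume \<epsilon>: "0 < \<epsilon>"
  have j0: "0 \<le> j" using j b by linarith
  have "dist (upper_envelope f j x') (upper_envelope f j x) < \<epsilon>" if "dist x' x < \<epsilon> / (j + 1)" for x'
  proof -
    have "dist (upper_envelope f j x') (upper_envelope f j x) \<le> j * \<bar>x - x'\<bar>"
      using upper_envelope_Lipschitz[of x x'] upper_envelope_Lipschitz[of x' x]
      by (simp add: dist_real_def abs_minus_commute abs_le_iff)
    also have "\<dots> \<le> (j + 1) * \<bar>x - x'\<bar>" by (intro mult_right_mono) auto
    also have "\<dots> < \<epsilon>"
      using that j0 by (simp add: dist_real_def abs_minus_commute pos_less_divide_eq mult.commute)
    finally show ?thesis .
  qed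
  moreover have "0 < \<epsilon> / (j + 1)" using \<epsilon> j0 by simp
  ultimately show "\<exists>d>0. \<forall>x'\<in>UNIV. dist x' x < d \<longrightarrow>
      dist (upper_envelope f j x') (upper_envelope f j x) < \<epsilon>" by blast
qed

text \<open>For steep cones only the points near \<open>x\<close> compete in the supremum.\<close>

lemma envelope_localised:
  assumes "0 \<le> h" "2 * (a + b * \<bar>x\<bar>) \<le> (j - b) * h"
  shows "\<exists>y'. \<bar>x - y'\<bar> \<le> h \<and> f y - j * \<bar>x - y\<bar> \<le> f y'"
proof (cases "\<bar>x - y\<bar> \<le> h")
  case True
  then show ?thesis using j b by (intro exI[of _ y]) simp
next
  case False
  have "b * \<bar>y\<bar> \<le> b * (\<bar>x\<bar> + \<bar>x - y\<bar>)" by (rule mult_left_mono[OF _ b]) simp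
  moreover have "(j - b) * h \<le> (j - b) * \<bar>x - y\<bar>"
    using False j by (intro mult_left_mono) auto
  moreover have "f y \<le> a + b * \<bar>y\<bar>" "- (a + b * \<bar>x\<bar>) \<le> f x" using bd[of y] bd[of x] by auto
  ultimately have "f y - j * \<bar>x - y\<bar> \<le> f x" using assms(2) by (simp add: algebra_simps)
  then show ?thesis using assms(1) by (intro exI[of _ x]) simp
qed

end

lemma envelope_gap_le_osc:
  assumes bd: "\<And>x. \<bar>f x\<bar> \<le> a + b * \<bar>x\<bar>" and j: "b \<le> j" "0 \<le> b"
    and h: "0 \<le> h" "2 * (a + b * \<bar>x\<bar>) \<le> (j - b) * h"
    and I: "s \<le> x - h" "x + h \<le> t"
  shows "upper_envelope f j x + upper_envelope (\<lambda>y. - f y) j x \<le> osc f s t"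
proof -
  have bd': "\<bar>- f x\<bar> \<le> a + b * \<bar>x\<bar>" for x using bd by simp
  have B: "\<bar>f y\<bar> \<le> a + b * max \<bar>s\<bar> \<bar>t\<bar>" if "y \<in> {s..t}" for y
  proof -
    have "b * \<bar>y\<bar> \<le> b * max \<bar>s\<bar> \<bar>t\<bar>" using that j(2) by (intro mult_left_mono) auto
    then show ?thesis using bd[of y] by linarith
  qed
  have le: "(f y - j * \<bar>x - y\<bar>) + (- f z - j * \<bar>x - z\<bar>) \<le> osc f s t" for y z
  proof -
    obtain y' where y': "\<bar>x - y'\<bar> \<le> h" "f y - j * \<bar>x - y\<bar> \<le> f y'"
      using envelope_localised[of f, OF bd j h] by blast
    obtain z' where z': "\<bar>x - z'\<bar> \<le> h" "- f z - j * \<bar>x - z\<bar> \<le> - f z'"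
      using envelope_localised[of "\<lambda>y. - f y", OF bd' j h] by blast
    have "\<bar>f y' - f z'\<bar> \<le> osc f s t"
      by (rule diff_le_osc[OF B]) (use y'(1) z'(1) I in auto)
    then show ?thesis using y'(2) z'(2) by linarith
  qed
  have "upper_envelope f j x \<le> osc f s t - (- f z - j * \<bar>x - z\<bar>)" for z
    by (rule envelope_least[of f, OF bd j]) (use le[of _ z] in \<open>simp add: algebra_simps\<close>)
  then have "upper_envelope (\<lambda>y. - f y) j x \<le> osc f s t - upper_envelope f j x"
    by (intro envelope_least[of "\<lambda>y. - f y", OF bd' j]) (simp add: algebra_simps)
  then show ?thesis by linarith
qed

section \<open>Discretisation of a spectral family on a grid\<close>

lemma sum_int_interval_nat:
  "(\<Sum>z\<in>{a..<a + int n}. F z) = (\<Sum>k<n. F (a + int k) :: 'a::comm_monoid_add)"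
proof (induction n)
  case (Suc n)
  have "{a..<a + int (Suc n)} = insert (a + int n) {a..<a + int n}" by auto
  then show ?case using Suc by (simp add: add.commute)
qed simp

lemma sum_int_interval_group:
  fixes F :: "int \<Rightarrow> 'a::comm_monoid_add"
  assumes "a \<le> b" "0 \<le> p"
  shows "(\<Sum>z\<in>{a * p..<b * p}. F z) = (\<Sum>l\<in>{a..<b}. \<Sum>z\<in>{l * p..<(l + 1) * p}. F z)"
  using assms(1)
proof (induction b rule: int_ge_induct)
  case (step i)
  have "a * p \<le> i * p" "i * p \<le> (i + 1) * p" using step assms(2) by (auto intro: mult_right_mono)
  then have "{a * p..<(i + 1) * p} = {a * p..<i * p} \<union> {i * p..<(i + 1) * p}" by auto
  then have "(\<Sum>z\<in>{a * p..<(i + 1) * p}. F z) =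
      (\<Sum>z\<in>{a * p..<i * p}. F z) + (\<Sum>z\<in>{i * p..<(i + 1) * p}. F z)"
    by (simp add: sum.union_disjoint)
  moreover have "{a..<i + 1} = insert i {a..<i}" using step by auto
  ultimately show ?case using step by (simp add: add.commute)
qed simp

definition grid_increment :: "(real \<Rightarrow> 'h::chilbert_space \<Rightarrow> 'h) \<Rightarrow> nat \<Rightarrow> int \<Rightarrow> 'h \<Rightarrow> 'h" where
  "grid_increment E q z = increment E (z / q) ((z + 1) / q)"

text \<open>The grid points are multiples of \<open>1 / q\<close> and are indexed by integers, so that the grids for all
  \<open>R\<close> are parts of one grid, and the grid of a multiple of \<open>q\<close> refines it by division of indices.\<close>

definition grid_calculus ::
    "(real \<Rightarrow> 'h::chilbert_space \<Rightarrow> 'h) \<Rightarrow> nat \<Rightarrow> nat \<Rightarrow> (real \<Rightarrow> complex) \<Rightarrow> 'h \<Rightarrow> 'h" where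
  "grid_calculus E q R =
     spectral_sum {- (int R * int q)..<int R * int q} (\<lambda>z. z / q) (grid_increment E q)"

lemma grid_partition:
  assumes "0 < q" "1 / real q < d"
  shows "tagged_partition d (real_of_int a / q) (real_of_int (a + int n) / q) n
    (\<lambda>k. real_of_int (a + int k) / q) (\<lambda>k. real_of_int (a + int k) / q)"
  using assms unfolding tagged_partition_def
  by (auto simp: divide_strict_right_mono divide_right_mono diff_divide_distrib[symmetric])

context
  fixes E :: "real \<Rightarrow> 'h::chilbert_space \<Rightarrow> 'h"
  assumes E: "spectral_family E"
begin

lemma grid_cell: "0 < q \<Longrightarrow> real_of_int z / real q \<le> (real_of_int z + 1) / real q"
  by (simp add: divide_right_mono)

lemma resolution_grid:
  assumes "0 < q"
  shows "resolution {a..<b} (grid_increment E q)"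
proof -
  have "grid_increment E q z (grid_increment E q w x) = 0" if "z \<noteq> w" for z w x
    unfolding grid_increment_def
  proof (rule increment_disjoint[OF E grid_cell[OF assms] grid_cell[OF assms]])
    have "z + 1 \<le> w \<or> w + 1 \<le> z" using that by linarith
    then have "real_of_int z + 1 \<le> w \<or> real_of_int w + 1 \<le> z" by linarith
    then show "(real_of_int z + 1) / q \<le> w / q \<or> (real_of_int w + 1) / q \<le> z / q"
      by (auto intro: divide_right_mono)
  qed
  then show ?thesis
    using increment_projection[OF E grid_cell[OF assms]]
    by (simp add: resolution_def grid_increment_def)
qed

lemma functional_calculus_grid: "0 < q \<Longrightarrow> functional_calculus (grid_calculus E q R)"
  unfolding grid_calculus_def by (intro functional_calculus_spectral_sum resolution_grid)

lemma grid_calculus_norm_square: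
  assumes "0 < q"
  shows "(norm (grid_calculus E q R g x))\<^sup>2 =
    (\<Sum>z\<in>{- (int R * int q)..<int R * int q}. (cmod (g (z / q)))\<^sup>2 * (norm (grid_increment E q z x))\<^sup>2)"
  unfolding grid_calculus_def spectral_sum_def
  by (rule resolution_norm_square[OF resolution_grid[OF assms]])

lemma grid_calculus_RS_sum:
  assumes q: "0 < q" and d: "1 / real q < d"
  shows "\<exists>n t. tagged_partition d (- real R) (real R) n t t \<and>
    (\<forall>f. grid_calculus E q R (\<lambda>t. complex_of_real (f t)) x = RS_sum f (\<lambda>t. E t x) n t t)"
proof -
  define a where "a = - (int R * int q)"
  define n where "n = 2 * R * q"
  have an: "a + int n = int R * int q" by (simp add: a_def n_def)
  define t where "t k = real_of_int (a + int k) / q" for k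
  have "real_of_int a / q = - real R" "real_of_int (a + int n) / q = real R"
    unfolding an using q by (simp_all add: a_def)
  then have "tagged_partition d (- real R) (real R) n t t"
    using grid_partition[OF q d, of a n] by (simp add: t_def[abs_def])
  moreover have "grid_calculus E q R (\<lambda>t. complex_of_real (f t)) x = RS_sum f (\<lambda>t. E t x) n t t" for f
  proof -
    have "grid_calculus E q R (\<lambda>t. complex_of_real (f t)) x =
        (\<Sum>z\<in>{a..<a + int n}. complex_of_real (f (z / q)) *\<^sub>C grid_increment E q z x)"
      unfolding grid_calculus_def spectral_sum_def an by (simp add: a_def)
    also have "\<dots> = RS_sum f (\<lambda>t. E t x) n t t"
      unfolding sum_int_interval_nat RS_sum_increment[OF E]
      by (simp add: t_def grid_increment_def add.commute add.left_commute)
    finally show ?thesis .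
  qed
  ultimately show ?thesis by blast
qed

lemma grid_calculus_one:
  assumes "0 < q"
  shows "grid_calculus E q R (\<lambda>_. 1) x = E R x - E (- R) x"
proof -
  have "1 / real q < 1 / q + 1" by simp
  from grid_calculus_RS_sum[OF assms this, of R x] obtain n t where
    t: "tagged_partition (1 / q + 1) (- real R) (real R) n t t" and
    eq: "\<And>f. grid_calculus E q R (\<lambda>t. complex_of_real (f t)) x = RS_sum f (\<lambda>t. E t x) n t t"
    by blast
  have "grid_calculus E q R (\<lambda>_. 1) x = (\<Sum>k<n. increment E (t k) (t (Suc k)) x)"
    using eq[of "\<lambda>_. 1"] by (simp add: RS_sum_increment[OF E])
  also have "\<dots> = increment E (- real R) (real R) x"
    by (rule sum_increment_partition[OF E t])
  finally show ?thesis by (simp add: increment_def)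
qed

lemma grid_calculus_tendsto:
  assumes "has_RS_integral f (\<lambda>t. E t x) (- real R) (real R) J" "0 < \<epsilon>"
  shows "\<forall>\<^sub>F q in sequentially. norm (grid_calculus E q R (\<lambda>t. complex_of_real (f t)) x - J) < \<epsilon>"
proof -
  from has_RS_integralE[OF assms] obtain \<delta> where \<delta>: "0 < \<delta>"
    "\<And>n t \<xi>. tagged_partition \<delta> (- real R) (real R) n t \<xi> \<Longrightarrow>
      norm (RS_sum f (\<lambda>t. E t x) n t \<xi> - J) < \<epsilon>" by blast
  have "\<forall>\<^sub>F q in sequentially. 1 / real q < \<delta>"
    by (rule order_tendstoD(2)[OF lim_1_over_n \<delta>(1)])
  moreover have "\<forall>\<^sub>F q :: nat in sequentially. 0 < q" by (rule eventually_gt_at_top)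
  ultimately show ?thesis
  proof eventually_elim
    case (elim q)
    from grid_calculus_RS_sum[OF elim(2) elim(1), of R x] obtain n t where
      "tagged_partition \<delta> (- real R) (real R) n t t"
      "grid_calculus E q R (\<lambda>t. complex_of_real (f t)) x = RS_sum f (\<lambda>t. E t x) n t t" by blast
    then show ?case using \<delta>(2) by simp
  qed
qed

text \<open>As \<open>S\<close> is an integer, \<open>- S\<close> and \<open>S\<close> are grid points, and the grid over \<open>[-R, R]\<close> just loses cells.\<close>

lemma grid_calculus_cutoff:
  assumes q: "0 < q" and SR: "S \<le> R"
  shows "grid_calculus E q R (\<lambda>t. g t * indicator {- real S..<real S} t) x = grid_calculus E q S g x"
proof -
  have mem: "indicator {- real S..<real S} (real_of_int z / q) =
      (if z \<in> {- (int S * int q)..<int S * int q} then 1 else (0 :: complex))" for z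
  proof -
    have "- real S \<le> real_of_int z / q \<longleftrightarrow> real_of_int (- (int S * int q)) \<le> real_of_int z"
      using q by (simp add: pos_le_divide_eq)
    moreover have "real_of_int z / q < real S \<longleftrightarrow> real_of_int z < real_of_int (int S * int q)"
      using q by (simp add: pos_divide_less_eq)
    ultimately show ?thesis by (simp only: of_int_le_iff of_int_less_iff indicator_def
          atLeastLessThan_iff) simp
  qed
  have "int S * int q \<le> int R * int q" using SR by (intro mult_right_mono) auto
  then have sub: "{- (int S * int q)..<int S * int q} \<subseteq> {- (int R * int q)..<int R * int q}" by auto
  show ?thesis
    unfolding grid_calculus_def spectral_sum_def mem
    by (rule sum.mono_neutral_cong_right[OF _ sub]) auto
qed

text \<open>The cells of the fine grid group into those of the coarse one, and within a coarse cell the squared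
  norms of the increments add up.\<close>

lemma grid_calculus_coarse_bound:
  assumes q: "0 < q" and p: "0 < p"
    and w: "\<And>l t. l \<in> {- (int S * int q)..<int S * int q} \<Longrightarrow>
      real_of_int l / q \<le> t \<Longrightarrow> t \<le> (real_of_int l + 1) / q \<Longrightarrow> cmod (g t) \<le> w l"
  shows "(norm (grid_calculus E (q * p) S g x))\<^sup>2 \<le>
    (\<Sum>l\<in>{- (int S * int q)..<int S * int q}. (w l)\<^sup>2 * (norm (grid_increment E q l x))\<^sup>2)"
proof -
  let ?I = "{- (int S * int q)..<int S * int q}"
  let ?N = "\<lambda>z. (norm (grid_increment E (q * p) z x))\<^sup>2"
  have qp: "0 < q * p" using q p by simp
  have eq: "{- (int S * int (q * p))..<int S * int (q * p)} =
      {- (int S * int q) * int p..<int S * int q * int p}"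
    by (simp only: of_nat_mult mult.assoc mult_minus_left)
  have "(norm (grid_calculus E (q * p) S g x))\<^sup>2 =
      (\<Sum>l\<in>?I. \<Sum>z\<in>{l * int p..<(l + 1) * int p}. (cmod (g (z / (q * p))))\<^sup>2 * ?N z)"
    unfolding grid_calculus_norm_square[OF qp] eq
    by (subst sum_int_interval_group) auto
  also have "\<dots> \<le> (\<Sum>l\<in>?I. (w l)\<^sup>2 * (norm (grid_increment E q l x))\<^sup>2)"
  proof (rule sum_mono)
    fix l assume l: "l \<in> ?I"
    have "(\<Sum>z\<in>{l * int p..<(l + 1) * int p}. (cmod (g (z / (q * p))))\<^sup>2 * ?N z) \<le>
        (\<Sum>z\<in>{l * int p..<(l + 1) * int p}. (w l)\<^sup>2 * ?N z)"
    proof (intro sum_mono mult_right_mono power_mono w[OF l])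
      fix z assume z: "z \<in> {l * int p..<(l + 1) * int p}"
      have "real_of_int (l * int p) \<le> z" "real_of_int z \<le> real_of_int ((l + 1) * int p)"
        using z by (auto simp del: of_int_mult)
      then show "real_of_int l / q \<le> z / (q * p)" "z / (q * p) \<le> (real_of_int l + 1) / q"
        using q p by (simp_all add: field_simps)
    qed auto
    also have "\<dots> = (w l)\<^sup>2 * (\<Sum>z\<in>{l * int p..<l * int p + int p}. ?N z)"
      by (simp add: sum_distrib_left distrib_right)
    also have "(\<Sum>z\<in>{l * int p..<l * int p + int p}. ?N z) = (norm (grid_increment E q l x))\<^sup>2"
    proof -
      let ?r = "\<lambda>k. (norm (E ((real_of_int (l * int p) + real k) / (q * p)) x))\<^sup>2"
      have "(\<Sum>z\<in>{l * int p..<l * int p + int p}. ?N z) = (\<Sum>k<p. ?r (Suc k) - ?r k)"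
        unfolding sum_int_interval_nat
      proof (rule sum.cong[OF refl])
        fix k
        show "?N (l * int p + int k) = ?r (Suc k) - ?r k"
          unfolding grid_increment_def norm_increment_square[OF E grid_cell[OF qp]]
          by (simp add: add.assoc add.commute[of 1])
      qed
      also have "\<dots> = ?r p - ?r 0" by (rule sum_lessThan_telescope)
      also have "(real_of_int (l * int p) + real p) / (q * p) = (real_of_int l + 1) / q"
        using q p by (simp add: field_simps)
      also have "(real_of_int (l * int p) + real 0) / (q * p) = real_of_int l / q"
        using q p by (simp add: field_simps)
      finally show ?thesis
        unfolding grid_increment_def norm_increment_square[OF E grid_cell[OF q]] .
    qed
    finally show "(\<Sum>z\<in>{l * int p..<(l + 1) * int p}. (cmod (g (z / (q * p))))\<^sup>2 * ?N z) \<le>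
        (w l)\<^sup>2 * (norm (grid_increment E q l x))\<^sup>2" .
  qed
  finally show ?thesis .
qed

text \<open>Three neighbouring cells of a fine uniform grid form one cell of a grid with triple mesh,
  in three different ways. This bounds the sum with the oscillations over triples of cells by
  three oscillation sums.\<close>

lemma grid_osc_triple_sum:
  assumes C: "RS_Cauchy f (\<lambda>t. E t x) (- (real S + 1)) (real S + 1)"
    and B: "\<And>t. t \<in> {- (real S + 1)..real S + 1} \<Longrightarrow> \<bar>f t\<bar> \<le> B" and \<epsilon>: "0 < \<epsilon>"
  shows "\<exists>q>0. (\<Sum>l\<in>{- (int S * int q)..<int S * int q}.
    (osc f ((real_of_int l - 1) / q) ((real_of_int l + 2) / q))\<^sup>2 * (norm (grid_increment E q l x))\<^sup>2) \<le> \<epsilon>"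
proof -
  have "0 < \<epsilon> / 3" using \<epsilon> by simp
  from RS_Cauchy_osc_square_sum[OF E C B this] obtain \<delta> where \<delta>: "0 < \<delta>"
    "\<And>c d n t \<xi>. - (real S + 1) \<le> c \<Longrightarrow> c \<le> d \<Longrightarrow> d \<le> real S + 1 \<Longrightarrow> tagged_partition \<delta> c d n t \<xi> \<Longrightarrow>
    (\<Sum>k<n. (osc f (t k) (t (Suc k)))\<^sup>2 * (norm (increment E (t k) (t (Suc k)) x))\<^sup>2) \<le> \<epsilon> / 3"
    by blast
  obtain r0 where r0: "1 / real (Suc r0) < \<delta>" using \<delta>(1) nat_approx_posE by blast
  define r where "r = Suc r0"
  define q where "q = 3 * r"
  define N where "N = 2 * S * r"
  have r: "0 < r" "1 / real r < \<delta>" using r0 by (simp_all add: r_def)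
  have q: "0 < q" "real q = 3 * real r" using r by (simp_all add: q_def)
  define a where "a = - (int S * int q)"
  have aN: "a + int (N * 3) = int S * int q" by (simp add: a_def N_def q_def)
  define G where "G l = (osc f ((real_of_int l - 1) / q) ((real_of_int l + 2) / q))\<^sup>2 *
    (norm (grid_increment E q l x))\<^sup>2" for l
  have bound: "(\<Sum>i<N. G (a + int (i * 3 + c))) \<le> \<epsilon> / 3" if c: "c < 3" for c
  proof -
    define t where "t i = (real_of_int a + 3 * real i + real c - 1) / q" for i
    have step: "t (Suc i) - t i = 1 / r" for i
      unfolding t_def diff_divide_distrib[symmetric] using r by (simp add: q)
    have "tagged_partition \<delta> (t 0) (t N) N t t"
    proof -
      have "t i < t (Suc i) \<and> t (Suc i) - t i < \<delta>" for i
        using step[of i] r zero_less_divide_1_iff[of "real r"] by linarith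
      then show ?thesis unfolding tagged_partition_def by (auto simp: less_imp_le)
    qed
    moreover have "- (real S + 1) \<le> t 0"
    proof -
      have "- (real S + 1) * q \<le> real_of_int a + real c - 1"
        using q r by (simp add: a_def algebra_simps)
      then show ?thesis using q by (simp add: t_def pos_le_divide_eq)
    qed
    moreover have "t N \<le> real S + 1"
    proof -
      have "real_of_int a + 3 * real N = real S * q"
        using arg_cong[OF aN, of real_of_int] by simp
      then have "real_of_int a + 3 * real N + real c - 1 \<le> (real S + 1) * q"
        using q r c by (simp add: algebra_simps)
      then show ?thesis using q by (simp add: t_def pos_divide_le_eq)
    qed
    moreover have "t 0 \<le> t N"
      unfolding t_def by (intro divide_right_mono) auto
    ultimately have "(\<Sum>i<N. (osc f (t i) (t (Suc i)))\<^sup>2 * (norm (increment E (t i) (t (Suc i)) x))\<^sup>2) \<le> \<epsilon> / 3"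
      using \<delta>(2) by blast
    moreover have le: "G (a + int (i * 3 + c)) \<le>
        (osc f (t i) (t (Suc i)))\<^sup>2 * (norm (increment E (t i) (t (Suc i)) x))\<^sup>2" for i
    proof -
      let ?l = "a + int (i * 3 + c)"
      have t: "t i = (real_of_int ?l - 1) / q" "t (Suc i) = (real_of_int ?l + 2) / q"
        by (simp_all add: t_def algebra_simps)
      have le: "t i \<le> ?l / q" "?l / q \<le> (real_of_int ?l + 1) / q" "(real_of_int ?l + 1) / q \<le> t (Suc i)"
        unfolding t by (intro divide_right_mono; simp)+
      have "(norm (grid_increment E q ?l x))\<^sup>2 \<le> (norm (increment E (t i) (t (Suc i)) x))\<^sup>2"
        unfolding grid_increment_def
        using norm_increment_square[OF E le(2), of x] norm_increment_square[OF E, of "t i" "t (Suc i)" x]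
          monoD[OF mono_norm_spectral_family[OF E, of x] le(1)] monoD[OF mono_norm_spectral_family[OF E, of x] le(3)] le by linarith
      then show ?thesis unfolding G_def t by (intro mult_left_mono) auto
    qed
    ultimately show ?thesis
      by (intro order_trans[OF sum_mono[OF le]])
  qed
  have "(\<Sum>l\<in>{- (int S * int q)..<int S * int q}. G l) = (\<Sum>k<N * 3. G (a + int k))"
    unfolding sum_int_interval_nat[symmetric] aN by (simp add: a_def)
  also have "\<dots> = (\<Sum>i<N. \<Sum>k\<in>{i * 3..<i * 3 + 3}. G (a + int k))"
    by (rule sum.nat_group[symmetric])
  also have "\<dots> = (\<Sum>i<N. \<Sum>c<3. G (a + int (i * 3 + c)))"
  proof (rule sum.cong[OF refl])
    fix i :: nat
    show "(\<Sum>k\<in>{i * 3..<i * 3 + 3}. G (a + int k)) = (\<Sum>c<3. G (a + int (i * 3 + c)))"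
      using sum.shift_bounds_nat_ivl[of "\<lambda>k. G (a + int k)" 0 "i * 3" 3]
      by (simp add: add.commute lessThan_atLeast0)
  qed
  also have "\<dots> = (\<Sum>c<3. \<Sum>i<N. G (a + int (i * 3 + c)))" by (rule sum.swap)
  also have "\<dots> \<le> (\<Sum>c<3 :: nat. \<epsilon> / 3)" by (intro sum_mono bound) simp
  also have "\<dots> = \<epsilon>" by simp
  finally show ?thesis using q(1) unfolding G_def by blast
qed

end

section \<open>Convergence to the spectral integral\<close>

lemma has_spectral_integralE:
  assumes "has_spectral_integral E f x y"
  obtains J where "\<And>a b. a < b \<Longrightarrow> has_RS_integral f (\<lambda>t. E t x) a b (J a b)"
    and "((\<lambda>(a, b). J a b) \<longlongrightarrow> y) (at_bot \<times>\<^sub>F at_top)"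
  using assms unfolding has_spectral_integral_def by auto

lemma tendsto_symmetric_limit:
  fixes J :: "real \<Rightarrow> real \<Rightarrow> 'b::topological_space"
  assumes J: "((\<lambda>(a, b). J a b) \<longlongrightarrow> y) (at_bot \<times>\<^sub>F at_top)"
    and R: "filterlim R at_top sequentially"
  shows "(\<lambda>m. J (- real (R m)) (real (R m))) \<longlonglongrightarrow> y"
proof -
  have R: "filterlim (\<lambda>m. real (R m)) at_top sequentially"
    by (rule filterlim_compose[OF filterlim_real_sequentially R])
  then have "filterlim (\<lambda>m. - real (R m)) at_bot sequentially"
    by (rule filterlim_compose[OF filterlim_uminus_at_bot_at_top])
  from filterlim_compose[OF J filterlim_Pair[OF this R]] show ?thesis by simp
qed

lemma tendsto_if_close:
  fixes X Y :: "nat \<Rightarrow> 'a::real_normed_vector"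
  assumes "Y \<longlonglongrightarrow> l" and close: "\<forall>\<^sub>F m in sequentially. norm (X m - Y m) < 1 / (real m + 1)"
  shows "X \<longlonglongrightarrow> l"
proof -
  have "(\<lambda>m. 1 / (real m + 1)) \<longlonglongrightarrow> 0"
    using LIMSEQ_Suc[OF lim_1_over_n] by (simp add: add.commute)
  then have "(\<lambda>m. X m - Y m) \<longlonglongrightarrow> 0"
    by (rule Lim_null_comparison[rotated]) (use close in \<open>eventually_elim, simp\<close>)
  from tendsto_add[OF this assms(1)] show ?thesis by simp
qed

text \<open>The span is generated by countably many vectors, so the mesh chosen at stage \<open>m\<close> has to serve
  only the first \<open>m + 1\<close> of them, besides the two integrals of \<open>v\<close>. Restricting the mesh to
  fractions of \<open>1 / q\<close> makes all grids refine a prescribed coarse one.\<close>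

lemma grid_sequence_exists:
  fixes E :: "real \<Rightarrow> 'h::chilbert_space \<Rightarrow> 'h" and e :: "nat \<Rightarrow> 'h"
  assumes Psi: "calculus_sequence \<Psi> C A" and C: "C = {v. \<exists>c n. v = (\<Sum>i<n. c i *\<^sub>C e i)}"
    and A: "\<And>c n. A (\<Sum>i<n. c i *\<^sub>C e i) = (\<Sum>i<n. c i *\<^sub>C A (e i))"
    and E: "spectral_family E" and id: "\<And>i. has_spectral_integral E (\<lambda>t. t) (e i) (A (e i))"
    and f: "has_spectral_integral E f v y"
    and Jv: "has_RS_integral (\<lambda>t. t) (\<lambda>t. E t v) (- real S) (real S) Jv" and q: "0 < q"
  shows "\<exists>p R. (\<forall>m. 0 < p m \<and> S \<le> R m) \<and>
    calculus_sequence (\<lambda>m. grid_calculus E (q * p m) (R m)) C A \<and>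
    (\<lambda>m. grid_calculus E (q * p m) (R m) (\<lambda>t. complex_of_real (f t)) v) \<longlonglongrightarrow> y \<and>
    (\<lambda>m. grid_calculus E (q * p m) S complex_of_real v) \<longlonglongrightarrow> Jv"
proof -
  have "\<forall>i. \<exists>J. (\<forall>a b. a < b \<longrightarrow> has_RS_integral (\<lambda>t. t) (\<lambda>t. E t (e i)) a b (J a b)) \<and>
      ((\<lambda>(a, b). J a b) \<longlongrightarrow> A (e i)) (at_bot \<times>\<^sub>F at_top)"
    using id unfolding has_spectral_integral_def by blast
  from choice[OF this] obtain J where
    J: "\<And>i a b. a < b \<Longrightarrow> has_RS_integral (\<lambda>t. t) (\<lambda>t. E t (e i)) a b (J i a b)"
    and Jlim: "\<And>i. ((\<lambda>(a, b). J i a b) \<longlongrightarrow> A (e i)) (at_bot \<times>\<^sub>F at_top)"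
    by blast
  obtain K where K: "\<And>a b. a < b \<Longrightarrow> has_RS_integral f (\<lambda>t. E t v) a b (K a b)"
    and Klim: "((\<lambda>(a, b). K a b) \<longlongrightarrow> y) (at_bot \<times>\<^sub>F at_top)"
    using has_spectral_integralE[OF f] by blast
  define R where "R m = S + m + 1" for m
  have R: "filterlim R at_top sequentially"
    by (rule filterlim_at_top_mono[OF filterlim_ident]) (simp add: R_def)
  have RR: "- real (R m) < real (R m)" for m by (simp add: R_def)
  let ?a = "\<lambda>m i n. norm (grid_calculus E n (R m) complex_of_real (e i) - J i (- real (R m)) (real (R m)))"
  let ?b = "\<lambda>m n. norm (grid_calculus E n (R m) (\<lambda>t. complex_of_real (f t)) v - K (- real (R m)) (real (R m)))"
  let ?c = "\<lambda>n. norm (grid_calculus E n S complex_of_real v - Jv)"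
  let ?good = "\<lambda>m n. (\<forall>i\<in>{..m}. ?a m i n < 1 / (real m + 1)) \<and> ?b m n < 1 / (real m + 1) \<and> ?c n < 1 / (real m + 1)"
  have "\<exists>p>0. ?good m (q * p)" for m
  proof -
    have pos: "0 < 1 / (real m + 1)" by simp
    have "\<forall>\<^sub>F n in sequentially. \<forall>i\<in>{..m}. ?a m i n < 1 / (real m + 1)"
      by (intro eventually_ball_finite ballI grid_calculus_tendsto[OF E J[OF RR] pos]) simp
    moreover note grid_calculus_tendsto[OF E K[OF RR[of m]] pos]
    moreover note grid_calculus_tendsto[OF E Jv pos]
    ultimately have "\<forall>\<^sub>F n in sequentially. ?good m n"
      by eventually_elim blast
    then obtain N where N: "\<And>n. n \<ge> N \<Longrightarrow> ?good m n"
      unfolding eventually_sequentially by blast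
    have "N \<le> q * Suc N" using q by (cases q) auto
    from N[OF this] show ?thesis by (intro exI[of _ "Suc N"]) simp
  qed
  then have "\<forall>m. \<exists>p>0. ?good m (q * p)" by blast
  from choice[OF this] obtain p where p: "\<And>m. 0 < p m" "\<And>m i. i \<le> m \<Longrightarrow> ?a m i (q * p m) < 1 / (real m + 1)"
    "\<And>m. ?b m (q * p m) < 1 / (real m + 1)" "\<And>m. ?c (q * p m) < 1 / (real m + 1)"
    by auto
  let ?G = "\<lambda>m. grid_calculus E (q * p m) (R m)"
  have qp: "0 < q * p m" for m using q p(1) by simp
  have calc: "functional_calculus (?G m)" for m
    by (rule functional_calculus_grid[OF E qp])
  have unit: "(\<lambda>m. ?G m (\<lambda>_. 1) x) \<longlonglongrightarrow> x" for x
  proof -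
    have top: "((\<lambda>t. E t x) \<longlongrightarrow> x) at_top" and bot: "((\<lambda>t. E t x) \<longlongrightarrow> 0) at_bot"
      using E by (simp_all add: spectral_family_def)
    have R': "filterlim (\<lambda>m. real (R m)) at_top sequentially"
      by (rule filterlim_compose[OF filterlim_real_sequentially R])
    then have "filterlim (\<lambda>m. - real (R m)) at_bot sequentially"
      by (rule filterlim_compose[OF filterlim_uminus_at_bot_at_top])
    from tendsto_diff[OF filterlim_compose[OF top R'] filterlim_compose[OF bot this]]
    show ?thesis by (simp add: grid_calculus_one[OF E qp])
  qed
  have id_e: "(\<lambda>m. ?G m complex_of_real (e i)) \<longlonglongrightarrow> A (e i)" for i
  proof (rule tendsto_if_close)
    show "(\<lambda>m. J i (- real (R m)) (real (R m))) \<longlonglongrightarrow> A (e i)"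
      by (rule tendsto_symmetric_limit[OF Jlim R])
    show "\<forall>\<^sub>F m in sequentially. norm (?G m complex_of_real (e i)
        - J i (- real (R m)) (real (R m))) < 1 / (real m + 1)"
      using eventually_ge_at_top[of i] by eventually_elim (rule p(2))
  qed
  have "(\<lambda>m. ?G m complex_of_real u) \<longlonglongrightarrow> A u" if uC: "u \<in> C" for u
  proof -
    obtain c n where u: "u = (\<Sum>i<n. c i *\<^sub>C e i)" using uC unfolding C by auto
    have "(\<lambda>m. \<Sum>i<n. c i *\<^sub>C ?G m complex_of_real (e i)) \<longlonglongrightarrow> (\<Sum>i<n. c i *\<^sub>C A (e i))"
      by (intro tendsto_sum bounded_linear.tendsto[OF bounded_linear_scaleC] id_e)
    then show ?thesis
      by (simp add: u A clinear_onD[OF functional_calculus.linear[OF calc]])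
  qed
  then have "calculus_sequence ?G C A"
    using Psi unfolding calculus_sequence_def by (auto intro: calc unit)
  moreover have "(\<lambda>m. ?G m (\<lambda>t. complex_of_real (f t)) v) \<longlonglongrightarrow> y"
    by (rule tendsto_if_close[OF tendsto_symmetric_limit[OF Klim R]]) (simp add: p(3))
  moreover have "(\<lambda>m. grid_calculus E (q * p m) S complex_of_real v) \<longlonglongrightarrow> Jv"
    by (rule tendsto_if_close[OF tendsto_const]) (simp add: p(4))
  moreover have "\<forall>m. 0 < p m \<and> S \<le> R m" using p(1) by (simp add: R_def)
  ultimately show ?thesis by (intro exI[of _ p] exI[of _ R] conjI)
qed

text \<open>The envelopes \<open>L \<le> f \<le> U\<close> are continuous, so the discretised spectral family and the
  given calculi have a common limit on them. The size of \<open>U - L\<close> is read off from the former: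
  on a bounded interval it is an oscillation sum of \<open>f\<close>, outside it is controlled by the
  convergence of \<open>\<integral> t dE(t)v\<close>. Since the calculi are monotone, \<open>f\<close> itself is squeezed.\<close>

theorem calculus_tendsto_spectral_integral:
  fixes E :: "real \<Rightarrow> 'h::chilbert_space \<Rightarrow> 'h" and e :: "nat \<Rightarrow> 'h"
  assumes Psi: "calculus_sequence \<Psi> C A" and C: "C = {v. \<exists>c n. v = (\<Sum>i<n. c i *\<^sub>C e i)}"
    and A: "\<And>c n. A (\<Sum>i<n. c i *\<^sub>C e i) = (\<Sum>i<n. c i *\<^sub>C A (e i))"
    and E: "spectral_family E" and id: "\<And>u. u \<in> C \<Longrightarrow> has_spectral_integral E (\<lambda>t. t) u (A u)"
    and v: "v \<in> C" and bd: "\<And>x. \<bar>f x\<bar> \<le> a + b * \<bar>x\<bar>" and ab: "0 < a" "0 < b"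
    and f: "has_spectral_integral E f v y"
  shows "(\<lambda>n. \<Psi> n (\<lambda>t. complex_of_real (f t)) v) \<longlonglongrightarrow> y"
proof -
  have eC: "e i \<in> C" for i
    unfolding C mem_Collect_eq
    by (rule exI[of _ "\<lambda>k. if k = i then 1 else 0"], rule exI[of _ "Suc i"])
      (simp add: if_distrib[of "\<lambda>c. c *\<^sub>C _"] cong: if_cong)
  have close: "\<forall>\<^sub>F n in sequentially. norm (\<Psi> n (\<lambda>t. complex_of_real (f t)) v - y) < 6 * \<epsilon>"
    if \<epsilon>: "0 < \<epsilon>" for \<epsilon>
  proof -
    \<comment> \<open>A constant with \<open>U t - L t \<le> c * \<bar>t\<bar>\<close> for \<open>\<bar>t\<bar> \<ge> 1\<close>, where \<open>L\<close> and \<open>U\<close> are the envelopes below.\<close>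
    define c where "c = 2 * (a + b)"
    have c: "0 < c" using ab by (simp add: c_def)
    obtain J where J: "\<And>a b. a < b \<Longrightarrow> has_RS_integral (\<lambda>t. t) (\<lambda>t. E t v) a b (J a b)"
      and Jlim: "((\<lambda>(a, b). J a b) \<longlongrightarrow> A v) (at_bot \<times>\<^sub>F at_top)"
      using has_spectral_integralE[OF id[OF v]] by blast
    have "(\<lambda>m. J (- real m) (real m)) \<longlonglongrightarrow> A v"
      by (rule tendsto_symmetric_limit[OF Jlim filterlim_ident])
    from tendstoD[OF this, of "\<epsilon> / c"] \<epsilon> c
    have "\<forall>\<^sub>F m in sequentially. dist (J (- real m) (real m)) (A v) < \<epsilon> / c" by simp
    with eventually_ge_at_top[of 1] have "\<forall>\<^sub>F m in sequentially. 1 \<le> m \<and>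
        dist (J (- real m) (real m)) (A v) < \<epsilon> / c"
      by eventually_elim simp
    then obtain S where S: "1 \<le> S" "dist (J (- real S) (real S)) (A v) < \<epsilon> / c"
      using eventually_happens'[OF sequentially_bot] by blast
    let ?Jv = "J (- real S) (real S)"
    have Jv: "has_RS_integral (\<lambda>t. t) (\<lambda>t. E t v) (- real S) (real S) ?Jv"
      using S(1) by (intro J) simp

    obtain K where "\<And>a b. a < b \<Longrightarrow> has_RS_integral f (\<lambda>t. E t v) a b (K a b)"
      using has_spectral_integralE[OF f] by blast
    then have RSC: "RS_Cauchy f (\<lambda>t. E t v) (- (real S + 1)) (real S + 1)"
      by (intro has_RS_integral_imp_Cauchy[of _ _ _ _ "K (- (real S + 1)) (real S + 1)"]) simp
    have Bf: "\<bar>f t\<bar> \<le> a + b * (real S + 1)" if "t \<in> {- (real S + 1)..real S + 1}" for t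
    proof -
      have "b * \<bar>t\<bar> \<le> b * (real S + 1)" using that ab by (intro mult_left_mono) auto
      then show ?thesis using bd[of t] by linarith
    qed
    obtain q where q: "0 < q" and osc: "(\<Sum>l\<in>{- (int S * int q)..<int S * int q}.
        (osc f ((real_of_int l - 1) / q) ((real_of_int l + 2) / q))\<^sup>2 *
        (norm (grid_increment E q l v))\<^sup>2) \<le> \<epsilon>\<^sup>2"
      using grid_osc_triple_sum[OF E RSC Bf, of "\<epsilon>\<^sup>2"] \<epsilon> by auto

    \<comment> \<open>With this slope the envelopes at points of \<open>[-S, S]\<close> depend only on values of \<open>f\<close> at distance
      at most \<open>1 / q\<close>, that is, in the same cell of the coarse grid or in a neighbouring one.\<close>
    define j where "j = b + 2 * (a + b * real S) * q"
    have j: "b \<le> j" "0 \<le> b" using ab by (simp_all add: j_def)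
    have bd': "\<bar>- f x\<bar> \<le> a + b * \<bar>x\<bar>" for x using bd by simp
    define U where "U = upper_envelope f j"
    define L where "L x = - upper_envelope (\<lambda>y. - f y) j x" for x
    define d where "d x = U x - L x" for x
    have L_le: "L x \<le> f x" and U_ge: "f x \<le> U x" for x
      using le_upper_envelope[of f, OF bd j, of x] le_upper_envelope[of "\<lambda>y. - f y", OF bd' j, of x]
      by (auto simp: U_def L_def)
    have Ubd: "\<bar>U x\<bar> \<le> a + b * \<bar>x\<bar>" and Lbd: "\<bar>L x\<bar> \<le> a + b * \<bar>x\<bar>" for x
      using abs_upper_envelope_le[of f, OF bd j, of x] abs_upper_envelope_le[of "\<lambda>y. - f y", OF bd' j, of x]
      by (auto simp: U_def L_def)
    have contU: "continuous_on UNIV U" and contL: "continuous_on UNIV L"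
      unfolding U_def L_def[abs_def]
      using continuous_upper_envelope[of f, OF bd j] continuous_upper_envelope[of "\<lambda>y. - f y", OF bd' j]
      by (auto intro: continuous_on_minus)
    have contd: "continuous_on UNIV d"
      unfolding d_def[abs_def] by (intro continuous_on_diff contU contL)
    have d0: "0 \<le> d x" for x using L_le[of x] U_ge[of x] by (simp add: d_def)
    have dbd: "\<bar>d x\<bar> \<le> 2 * a + 2 * b * \<bar>x\<bar>" for x
      using Ubd[of x] Lbd[of x] by (simp add: d_def)
    have d_osc: "cmod (complex_of_real (d t)) \<le> osc f ((real_of_int l - 1) / q) ((real_of_int l + 2) / q)"
      if l: "l \<in> {- (int S * int q)..<int S * int q}"
        and t: "real_of_int l / q \<le> t" "t \<le> (real_of_int l + 1) / q" for l t
    proof -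
      have "- (real S * q) \<le> real_of_int l" "real_of_int l + 1 \<le> real S * q"
      proof -
        have "- (int S * int q) \<le> l" "l + 1 \<le> int S * int q" using l by auto
        then have "real_of_int (- (int S * int q)) \<le> real_of_int l"
          "real_of_int (l + 1) \<le> real_of_int (int S * int q)"
          by (simp_all only: of_int_le_iff)
        then show "- (real S * q) \<le> real_of_int l" "real_of_int l + 1 \<le> real S * q" by simp_all
      qed
      then have "- real S \<le> real_of_int l / q" "(real_of_int l + 1) / q \<le> real S"
        using q by (simp_all add: pos_le_divide_eq pos_divide_le_eq)
      then have "\<bar>t\<bar> \<le> real S" using t by linarith
      then have "2 * (a + b * \<bar>t\<bar>) \<le> 2 * (a + b * real S)" using ab by simp
      also have "\<dots> = (j - b) * (1 / q)" using q by (simp add: j_def)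
      finally have h: "2 * (a + b * \<bar>t\<bar>) \<le> (j - b) * (1 / q)" .
      have "upper_envelope f j t + upper_envelope (\<lambda>y. - f y) j t \<le>
          osc f ((real_of_int l - 1) / q) ((real_of_int l + 2) / q)"
        by (rule envelope_gap_le_osc[OF bd j _ h])
          (use t in \<open>simp_all add: diff_divide_distrib add_divide_distrib\<close>)
      then have "d t \<le> osc f ((real_of_int l - 1) / q) ((real_of_int l + 2) / q)"
        by (simp add: d_def U_def L_def)
      then show ?thesis using d0[of t] by (simp only: norm_of_real abs_of_nonneg)
    qed

    obtain p R where pR: "\<And>m. 0 < p m" "\<And>m. S \<le> R m" and
      G: "calculus_sequence (\<lambda>m. grid_calculus E (q * p m) (R m)) C A" and
      Gf: "(\<lambda>m. grid_calculus E (q * p m) (R m) (\<lambda>t. complex_of_real (f t)) v) \<longlonglongrightarrow> y" and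
      Gid: "(\<lambda>m. grid_calculus E (q * p m) S complex_of_real v) \<longlonglongrightarrow> ?Jv"
      using grid_sequence_exists[OF Psi C A E id[OF eC] f Jv q] by auto
    let ?G = "\<lambda>m. grid_calculus E (q * p m) (R m)"
    have qp: "0 < q * p m" for m using q pR by simp
    interpret G: calculus_sequence ?G C A by (rule G)
    interpret Psi: calculus_sequence \<Psi> C A by (rule Psi)
    obtain yd where yd: "(\<lambda>n. \<Psi> n (\<lambda>t. complex_of_real (d t)) v) \<longlonglongrightarrow> yd"
      "(\<lambda>m. ?G m (\<lambda>t. complex_of_real (d t)) v) \<longlonglongrightarrow> yd"
      using calculus_sequence_same_limit[OF Psi G contd dbd v] by (elim exE conjE) (rule that)
    obtain yL where yL: "(\<lambda>n. \<Psi> n (\<lambda>t. complex_of_real (L t)) v) \<longlonglongrightarrow> yL"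
      "(\<lambda>m. ?G m (\<lambda>t. complex_of_real (L t)) v) \<longlonglongrightarrow> yL"
      using calculus_sequence_same_limit[OF Psi G contL Lbd v] by (elim exE conjE) (rule that)

    have Gd: "norm (?G m (\<lambda>t. complex_of_real (d t)) v) \<le>
        \<epsilon> + c * norm (?G m complex_of_real v - grid_calculus E (q * p m) S complex_of_real v)" for m
    proof -
      let ?i = "indicator {- real S..<real S} :: real \<Rightarrow> complex"
      have split: "?G m (\<lambda>t. complex_of_real (d t)) v =
          ?G m (\<lambda>t. complex_of_real (d t) * ?i t) v + ?G m (\<lambda>t. complex_of_real (d t) * (1 - ?i t)) v"
        unfolding G.add[symmetric] by (simp add: algebra_simps)
      have "(norm (?G m (\<lambda>t. complex_of_real (d t) * ?i t) v))\<^sup>2 \<le> \<epsilon>\<^sup>2"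
        unfolding grid_calculus_cutoff[OF E qp pR(2)]
        using grid_calculus_coarse_bound[OF E q pR(1) d_osc, of S] osc by (rule order_trans)
      then have "norm (?G m (\<lambda>t. complex_of_real (d t) * ?i t) v) \<le> \<epsilon>"
        by (rule power2_le_imp_le) (use \<epsilon> in simp)
      moreover have "norm (?G m (\<lambda>t. complex_of_real (d t) * (1 - ?i t)) v) \<le>
          norm (?G m (\<lambda>t. complex_of_real c * (complex_of_real t - complex_of_real t * ?i t)) v)"
      proof (rule functional_calculus.mono[OF G.calculus])
        fix t
        show "cmod (complex_of_real (d t) * (1 - ?i t)) \<le>
            cmod (complex_of_real c * (complex_of_real t - complex_of_real t * ?i t))"
        proof (cases "t \<in> {- real S..<real S}")
          case False
          then have "1 \<le> \<bar>t\<bar>" using S(1) by auto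
          then have "2 * a * 1 \<le> 2 * a * \<bar>t\<bar>" using ab by (intro mult_left_mono) auto
          then have "\<bar>d t\<bar> \<le> c * \<bar>t\<bar>" using dbd[of t] by (simp add: c_def algebra_simps)
          then show ?thesis using False c by (simp add: norm_mult)
        qed simp
      qed
      moreover have "?G m (\<lambda>t. complex_of_real c * (complex_of_real t - complex_of_real t * ?i t)) v =
          complex_of_real c *\<^sub>C (?G m complex_of_real v - grid_calculus E (q * p m) S complex_of_real v)"
        unfolding G.scale G.minus grid_calculus_cutoff[OF E qp pR(2)] ..
      moreover have "norm (complex_of_real c *\<^sub>C w) = c * norm w" for w :: 'h
        using c by (simp add: norm_scaleC)
      ultimately show ?thesis
        unfolding split by (simp only: norm_triangle_le add_mono)
    qed
    have "norm yd \<le> \<epsilon> + c * norm (A v - ?Jv)"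
      by (rule LIMSEQ_le[OF tendsto_norm[OF yd(2)]
            tendsto_add[OF tendsto_const tendsto_mult[OF tendsto_const
              tendsto_norm[OF tendsto_diff[OF G.id_core[OF v] Gid]]]]])
        (use Gd in blast)
    also have "c * norm (A v - ?Jv) \<le> c * (\<epsilon> / c)"
      using S(2) c by (intro mult_left_mono) (auto simp: dist_norm norm_minus_commute)
    finally have yd_le: "norm yd \<le> 2 * \<epsilon>" using c by simp

    have squeeze: "cmod (complex_of_real (f t) - complex_of_real (L t)) \<le> cmod (complex_of_real (d t))" for t
      unfolding of_real_diff[symmetric] norm_of_real using L_le[of t] U_ge[of t] by (simp add: d_def)
    have "norm (y - yL) \<le> norm yd"
    proof (rule LIMSEQ_le[OF tendsto_norm[OF tendsto_diff[OF Gf yL(2)]] tendsto_norm[OF yd(2)]])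
      show "\<exists>N. \<forall>m\<ge>N. norm (?G m (\<lambda>t. complex_of_real (f t)) v - ?G m (\<lambda>t. complex_of_real (L t)) v) \<le>
          norm (?G m (\<lambda>t. complex_of_real (d t)) v)"
        unfolding G.minus[symmetric]
        by (intro exI allI impI functional_calculus.mono[OF G.calculus] squeeze)
    qed
    then have yL_le: "norm (yL - y) \<le> 2 * \<epsilon>" using yd_le by (simp add: norm_minus_commute)
    have "norm yd < 3 * \<epsilon>" using yd_le \<epsilon> by linarith
    from order_tendstoD(2)[OF tendsto_norm[OF yd(1)] this]
    have "\<forall>\<^sub>F n in sequentially. norm (\<Psi> n (\<lambda>t. complex_of_real (d t)) v) < 3 * \<epsilon>" .
    moreover from tendstoD[OF yL(1) \<epsilon>]
    have "\<forall>\<^sub>F n in sequentially. norm (\<Psi> n (\<lambda>t. complex_of_real (L t)) v - yL) < \<epsilon>"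
      by (simp add: dist_norm)
    ultimately show ?thesis
    proof eventually_elim
      case (elim n)
      have "norm (\<Psi> n (\<lambda>t. complex_of_real (f t)) v - \<Psi> n (\<lambda>t. complex_of_real (L t)) v) < 3 * \<epsilon>"
        unfolding Psi.minus[symmetric]
        using functional_calculus.mono[OF Psi.calculus, of "\<lambda>t. complex_of_real (f t) - complex_of_real (L t)"
            "\<lambda>t. complex_of_real (d t)" n v] squeeze elim(1) by (meson le_less_trans)
      then have "dist (\<Psi> n (\<lambda>t. complex_of_real (f t)) v) y < 3 * \<epsilon> + (\<epsilon> + 2 * \<epsilon>)"
        using elim(2) yL_le \<epsilon>
          dist_triangle[of "\<Psi> n (\<lambda>t. complex_of_real (f t)) v" y "\<Psi> n (\<lambda>t. complex_of_real (L t)) v"]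
          dist_triangle[of "\<Psi> n (\<lambda>t. complex_of_real (L t)) v" y yL]
        unfolding dist_norm by linarith
      then show ?case by (simp add: dist_norm)
    qed
  qed
  show ?thesis
  proof (rule tendstoI)
    fix \<epsilon> :: real assume "0 < \<epsilon>"
    then have "0 < \<epsilon> / 6" by simp
    from close[OF this] show "\<forall>\<^sub>F n in sequentially. dist (\<Psi> n (\<lambda>t. complex_of_real (f t)) v) y < \<epsilon>"
      by (simp add: dist_norm)
  qed
qed

section \<open>Coordinates in the sequence space\<close>

lemma coord_add [simp]: "coord (x + y) i = coord x i + coord y i"
  by (simp add: plus_ell2.rep_eq)

lemma coord_zero [simp]: "coord 0 i = 0"
  by (simp add: zero_ell2.rep_eq)

lemma coord_diff [simp]: "coord (x - y) i = coord x i - coord y i"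
  by (simp add: minus_ell2.rep_eq)

lemma coord_scaleC [simp]: "coord (c *\<^sub>C x) i = c * coord x i"
  by (simp add: scaleC_ell2.rep_eq)

lemma coord_sum [simp]: "coord (\<Sum>k\<in>K. x k) i = (\<Sum>k\<in>K. coord (x k) i)"
  by (induction K rule: infinite_finite_induct) auto

lemma coord_basis [simp]: "coord (ell2_basis i) j = (if j = i then 1 else 0)"
  by (simp add: ell2_basis.rep_eq)

lemma coord_ell2_of_vec [simp]: "coord (ell2_of_vec w) i = (if i < dim_vec w then vec_index w i else 0)"
  by (simp add: ell2_of_vec.rep_eq)

lemma ell2_eqI: "(\<And>i. coord x i = coord y i) \<Longrightarrow> x = y"
  by (simp add: coord_inject[symmetric] fun_eq_iff)

lemma coord_span: "coord (\<Sum>i<n. c i *\<^sub>C ell2_basis i) j = (if j < n then c j else 0)"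
  by (simp add: if_distrib[of "\<lambda>z. _ * z"] cong: if_cong)

lemma cinner_finite_support:
  assumes "\<And>i. i \<ge> N \<Longrightarrow> coord x i = 0"
  shows "cinner x y = (\<Sum>i<N. cnj (coord x i) * coord y i)"
  unfolding cinner_ell2.rep_eq by (rule suminf_finite) (use assms in \<open>auto simp: not_less\<close>)

lemma cinner_finite_support_right:
  assumes "\<And>i. i \<ge> N \<Longrightarrow> coord y i = 0"
  shows "cinner x y = (\<Sum>i<N. cnj (coord x i) * coord y i)"
  unfolding cinner_ell2.rep_eq by (rule suminf_finite) (use assms in \<open>auto simp: not_less\<close>)

lemma cinner_basis: "cinner (ell2_basis i) x = coord x i"
proof -
  have "cinner (ell2_basis i) x = (\<Sum>j<Suc i. cnj (coord (ell2_basis i) j) * coord x j)"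
    by (rule cinner_finite_support) auto
  also have "\<dots> = coord x i"
    by (simp add: if_distrib[of cnj] if_distrib[of "\<lambda>z. z * _"] cong: if_cong)
  finally show ?thesis .
qed

lemma finite_support_span:
  assumes "\<And>i. i \<ge> N \<Longrightarrow> coord x i = 0"
  shows "x = (\<Sum>i<N. coord x i *\<^sub>C ell2_basis i)"
  by (rule ell2_eqI, subst coord_span) (use assms in auto)

lemma truncation_tendsto: "(\<lambda>n. ell2_of_vec (trunc_vec x n)) \<longlonglongrightarrow> x"
proof -
  let ?s = "\<lambda>i. (cmod (coord x i))\<^sup>2"
  have s: "summable ?s" by (rule summable_coord)
  have "(norm (ell2_of_vec (trunc_vec x n) - x))\<^sup>2 = suminf ?s - (\<Sum>i<Suc n. ?s i)" for n
  proof -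
    have "(norm (ell2_of_vec (trunc_vec x n) - x))\<^sup>2 = (\<Sum>i. if i < Suc n then 0 else ?s i)"
      unfolding norm_ell2.rep_eq
      by (subst real_sqrt_pow2, rule suminf_nonneg[OF summable_coord]) (auto simp: trunc_vec_def intro!: suminf_cong)
    also have "\<dots> = (\<Sum>i. ?s i - (if i < Suc n then ?s i else 0))"
      by (rule suminf_cong) auto
    also have "\<dots> = suminf ?s - (\<Sum>i. if i < Suc n then ?s i else 0)"
      by (rule suminf_diff[symmetric, OF s]) (rule summable_finite[of "{..<Suc n}"], auto)
    also have "(\<Sum>i. if i < Suc n then ?s i else 0) = (\<Sum>i<Suc n. ?s i)"
      by (subst suminf_finite[of "{..<Suc n}"]) auto
    finally show ?thesis .
  qed
  moreover have "(\<lambda>n. suminf ?s - (\<Sum>i<Suc n. ?s i)) \<longlonglongrightarrow> suminf ?s - suminf ?s"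
    by (intro tendsto_diff tendsto_const LIMSEQ_Suc[OF summable_LIMSEQ[OF s]])
  ultimately have "(\<lambda>n. (norm (ell2_of_vec (trunc_vec x n) - x))\<^sup>2) \<longlonglongrightarrow> 0" by simp
  from tendsto_real_sqrt[OF this] have "(\<lambda>n. norm (ell2_of_vec (trunc_vec x n) - x)) \<longlonglongrightarrow> 0" by simp
  then show ?thesis by (simp add: tendsto_norm_zero_iff LIM_zero_iff)
qed

section \<open>Hermitian matrices\<close>

text \<open>Padding the system with zero equations gives a singular square matrix.\<close>

lemma homogeneous_system_nontrivial:
  fixes a :: "nat \<Rightarrow> nat \<Rightarrow> complex"
  assumes "m < N"
  shows "\<exists>c. (\<exists>j<N. c j \<noteq> 0) \<and> (\<forall>i<m. (\<Sum>j<N. a i j * c j) = 0)"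
proof -
  define B where "B = Matrix.mat N N (\<lambda>(i, j). if i < m then a i j else 0)"
  have B: "B \<in> carrier_mat N N" by (simp add: B_def)
  have "det B = 0"
    unfolding det_def'[OF B]
  proof (rule sum.neutral, rule ballI)
    fix p assume "p \<in> {p. p permutes {0..<N}}"
    then have "p m < N" using assms permutes_in_image[of p "{0..<N}" m] by auto
    then have "B $$ (m, p m) = 0" using assms by (simp add: B_def)
    then have "(\<Prod>i = 0..<N. B $$ (i, p i)) = 0" using assms by (intro prod_zero) auto
    then show "signof p * (\<Prod>i = 0..<N. B $$ (i, p i)) = 0" by simp
  qed
  then obtain w where w: "w \<in> carrier_vec N" "w \<noteq> 0\<^sub>v N" "B *\<^sub>v w = 0\<^sub>v N"
    using det_0_iff_vec_prod_zero_field[OF B] by blast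
  have "\<exists>j<N. vec_index w j \<noteq> 0"
  proof (rule ccontr)
    assume "\<not> (\<exists>j<N. vec_index w j \<noteq> 0)"
    then have "w = 0\<^sub>v N" using w(1) by (intro eq_vecI) auto
    with w(2) show False by simp
  qed
  moreover have "(\<Sum>j<N. a i j * vec_index w j) = 0" if "i < m" for i
  proof -
    have "vec_index (B *\<^sub>v w) i = (\<Sum>j<N. a i j * vec_index w j)"
      using that assms w(1) by (simp add: B_def scalar_prod_def lessThan_atLeast0)
    then show ?thesis using that assms w(3) by simp
  qed
  ultimately show ?thesis by blast
qed

text \<open>A polynomial of minimal degree annihilating \<open>x\<close> under \<open>T\<close> splits off a root \<open>r\<close>, and the
  cofactor, applied to \<open>x\<close>, is an eigenvector by minimality.\<close>

lemma eigenvector_in_cyclic_subspace: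
  fixes T :: "'h::chilbert_space \<Rightarrow> 'h" and p :: "complex poly"
  assumes T: "clinear_on UNIV T" and V: "csubspace V" and inv: "\<And>y. y \<in> V \<Longrightarrow> T y \<in> V"
    and x: "x \<in> V" "x \<noteq> 0"
    and p: "p \<noteq> 0" "(\<Sum>k\<le>degree p. coeff p k *\<^sub>C (T ^^ k) x) = 0"
  shows "\<exists>y r. y \<in> V \<and> y \<noteq> 0 \<and> T y = r *\<^sub>C y"
proof -
  let ?app = "\<lambda>p :: complex poly. \<Sum>k\<le>degree p. coeff p k *\<^sub>C (T ^^ k) x"
  have "\<exists>y r. y \<in> V \<and> y \<noteq> 0 \<and> T y = r *\<^sub>C y" if "p \<noteq> 0" "?app p = 0" for p :: "complex poly"
    using that
  proof (induction "degree p" arbitrary: p rule: less_induct)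
    case less
    have "degree p \<noteq> 0"
    proof
      assume 0: "degree p = 0"
      then have "coeff p 0 \<noteq> 0" using less.prems(1) by (metis leading_coeff_0_iff)
      then have "(1 / coeff p 0) *\<^sub>C coeff p 0 *\<^sub>C x = x" by (simp add: scaleC_scaleC)
      with less.prems(2) 0 x(2) show False by simp
    qed
    then have "\<not> constant (poly p)" by (simp add: constant_degree)
    then obtain r where "poly p r = 0" using fundamental_theorem_of_algebra by blast
    then obtain q where q: "p = [:- r, 1:] * q" by (auto simp: poly_eq_0_iff_dvd)
    have q0: "q \<noteq> 0" using q less.prems(1) by auto
    have deg: "degree p = Suc (degree q)"
      unfolding q using q0 by (subst degree_mult_eq) auto
    show ?case
    proof (cases "?app q = 0")
      case True
      then show ?thesis using less.hyps[OF _ q0] deg by simp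
    next
      case False
      define c where "c k = (case k of 0 \<Rightarrow> 0 | Suc j \<Rightarrow> coeff q j)" for k
      have coeff: "coeff p k = c k - r * coeff q k" for k
        unfolding q c_def by (cases k) auto
      have "?app p = (\<Sum>k\<le>Suc (degree q). c k *\<^sub>C (T ^^ k) x) -
          (\<Sum>k\<le>Suc (degree q). (r * coeff q k) *\<^sub>C (T ^^ k) x)"
        unfolding deg coeff scaleC_diff_left by (rule sum_subtractf)
      also have "(\<Sum>k\<le>Suc (degree q). c k *\<^sub>C (T ^^ k) x) = T (?app q)"
        unfolding sum.atMost_Suc_shift by (simp add: c_def clinear_onD[OF T])
      also have "(\<Sum>k\<le>Suc (degree q). (r * coeff q k) *\<^sub>C (T ^^ k) x) = r *\<^sub>C ?app q"
        by (simp add: coeff_eq_0 scaleC_sum_right scaleC_scaleC)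
      finally have "T (?app q) = r *\<^sub>C ?app q" using less.prems(2) by simp
      moreover have "?app q \<in> V"
      proof (rule csubspace_sum[OF V])
        fix k
        have "(T ^^ k) x \<in> V" by (induction k) (use x inv in auto)
        then show "coeff q k *\<^sub>C (T ^^ k) x \<in> V" using V by (simp add: csubspace_def)
      qed
      ultimately show ?thesis using False by blast
    qed
  qed
  from this[OF p] show ?thesis .
qed

definition matrix_map :: "(nat \<Rightarrow> nat \<Rightarrow> complex) \<Rightarrow> nat \<Rightarrow> ell2 \<Rightarrow> ell2" where
  "matrix_map M N x = (\<Sum>i<N. (\<Sum>j<N. M i j * coord x j) *\<^sub>C ell2_basis i)"

lemma coord_matrix_map: "coord (matrix_map M N x) i = (if i < N then \<Sum>j<N. M i j * coord x j else 0)"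
  unfolding matrix_map_def coord_span by simp

lemma clinear_matrix_map: "clinear_on UNIV (matrix_map M N)"
  unfolding clinear_on_def
  by (auto intro!: ell2_eqI simp: coord_matrix_map sum.distrib sum_distrib_left algebra_simps)

lemma matrix_map_symmetric:
  assumes "\<And>i j. M i j = cnj (M j i)"
  shows "cinner (matrix_map M N x) y = cinner x (matrix_map M N y)"
proof -
  have "cinner (matrix_map M N x) y = (\<Sum>i<N. \<Sum>j<N. M j i * cnj (coord x j) * coord y i)"
    by (subst cinner_finite_support[of N])
      (auto simp: coord_matrix_map sum_distrib_right assms[symmetric] intro!: sum.cong)
  also have "\<dots> = (\<Sum>j<N. \<Sum>i<N. M j i * cnj (coord x j) * coord y i)" by (rule sum.swap)
  also have "\<dots> = cinner x (matrix_map M N y)"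
    by (subst cinner_finite_support_right[of N])
      (auto simp: coord_matrix_map sum_distrib_left intro!: sum.cong)
  finally show ?thesis .
qed

text \<open>As long as fewer than \<open>N\<close> eigenvectors are found, their orthogonal complement among the vectors
  supported in the first \<open>N\<close> coordinates is invariant and nonzero, and contains another one.\<close>

lemma hermitian_orthonormal_eigenvectors:
  assumes M: "\<And>i j. M i j = cnj (M j i)" and "m \<le> N"
  shows "\<exists>u d. (\<forall>k<m. \<forall>i\<ge>N. coord (u k) i = 0) \<and>
    (\<forall>k<m. \<forall>l<m. cinner (u k) (u l) = (if k = l then 1 else 0)) \<and>
    (\<forall>k<m. matrix_map M N (u k) = complex_of_real (d k) *\<^sub>C u k)"
  using assms(2)
proof (induction m)
  case (Suc m)
  let ?T = "matrix_map M N"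
  note sym = matrix_map_symmetric[where M = M, OF M]
  have "m \<le> N" using Suc.prems by simp
  from Suc.IH[OF this] obtain u d where "\<forall>k<m. \<forall>i\<ge>N. coord (u k) i = 0"
    "\<forall>k<m. \<forall>l<m. cinner (u k) (u l) = (if k = l then 1 else 0)"
    "\<forall>k<m. ?T (u k) = complex_of_real (d k) *\<^sub>C u k"
    by (elim exE conjE) (rule that)
  then have u: "\<And>k i. k < m \<Longrightarrow> i \<ge> N \<Longrightarrow> coord (u k) i = 0"
    "\<And>k l. k < m \<Longrightarrow> l < m \<Longrightarrow> cinner (u k) (u l) = (if k = l then 1 else 0)"
    "\<And>k. k < m \<Longrightarrow> ?T (u k) = complex_of_real (d k) *\<^sub>C u k"
    by simp_all
  define V where "V = {y. (\<forall>i\<ge>N. coord y i = 0) \<and> (\<forall>k<m. cinner (u k) y = 0)}"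
  have V: "csubspace V"
    by (auto simp: V_def csubspace_def cinner_add_right cinner_scaleC_right)
  have inv: "?T y \<in> V" if "y \<in> V" for y
    using that by (auto simp: V_def coord_matrix_map sym[symmetric] u(3) cinner_scaleC_left)

  \<comment> \<open>Orthogonality to fewer than \<open>N\<close> vectors is a homogeneous system in \<open>N\<close> unknowns.\<close>
  obtain c where c: "\<exists>j<N. c j \<noteq> 0" "\<And>i. i < m \<Longrightarrow> (\<Sum>j<N. cnj (coord (u i) j) * c j) = 0"
    using homogeneous_system_nontrivial[of m N "\<lambda>i j. cnj (coord (u i) j)"] Suc.prems by auto
  define x where "x = (\<Sum>j<N. c j *\<^sub>C ell2_basis j)"
  have cx: "coord x j = (if j < N then c j else 0)" for j unfolding x_def by (rule coord_span)
  have x: "x \<in> V"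
    by (auto simp: V_def cx cinner_finite_support[OF u(1)] c(2) intro!: sum.neutral)
  have x0: "x \<noteq> 0" using c(1) cx by (metis coord_zero)

  \<comment> \<open>The \<open>N + 1\<close> iterates of \<open>x\<close> have \<open>N\<close> coordinates and are therefore dependent.\<close>
  obtain b where b: "\<exists>j<Suc N. b j \<noteq> 0" "\<And>i. i < N \<Longrightarrow> (\<Sum>j<Suc N. coord ((?T ^^ j) x) i * b j) = 0"
    using homogeneous_system_nontrivial[of N "Suc N" "\<lambda>i j. coord ((?T ^^ j) x) i"] by auto
  define p where "p = (\<Sum>k<Suc N. monom (b k) k)"
  have cp: "coeff p k = (if k < Suc N then b k else 0)" for k
    by (simp add: p_def coeff_sum del: sum.lessThan_Suc)
  have p0: "p \<noteq> 0" using b(1) cp by (metis coeff_0)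
  have iter: "(?T ^^ k) x \<in> V" for k by (induction k) (use x inv in auto)
  have deg: "degree p \<le> N" by (rule degree_le) (simp add: cp)
  have "(\<Sum>k\<le>degree p. coeff p k *\<^sub>C (?T ^^ k) x) = (\<Sum>k<Suc N. b k *\<^sub>C (?T ^^ k) x)"
  proof (rule sum.mono_neutral_cong_left)
    show "\<forall>k\<in>{..<Suc N} - {..degree p}. b k *\<^sub>C (?T ^^ k) x = 0"
    proof
      fix k assume "k \<in> {..<Suc N} - {..degree p}"
      then show "b k *\<^sub>C (?T ^^ k) x = 0" using coeff_eq_0[of p k] cp[of k] by simp
    qed
  qed (use deg in \<open>auto simp: cp\<close>)
  also have "\<dots> = 0"
  proof (rule ell2_eqI)
    fix i
    show "coord (\<Sum>k<Suc N. b k *\<^sub>C (?T ^^ k) x) i = coord 0 i"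
    proof (cases "i < N")
      case True
      then show ?thesis using b(2)[OF True] by (simp add: mult.commute)
    next
      case False
      then have "coord ((?T ^^ k) x) i = 0" for k using iter[of k] by (simp add: V_def)
      then show ?thesis by simp
    qed
  qed
  finally obtain y r where y: "y \<in> V" "y \<noteq> 0" "?T y = r *\<^sub>C y"
    using eigenvector_in_cyclic_subspace[OF clinear_matrix_map V inv x x0 p0] by blast
  have "cnj r * cinner y y = r * cinner y y"
    using sym[of N y y] unfolding y(3) cinner_scaleC_left cinner_scaleC_right .
  then have r: "complex_of_real (Re r) = r"
    using y(2) by (simp add: cinner_self complex_eq_iff)
  define w where "w = (1 / complex_of_real (norm y)) *\<^sub>C y"
  have wV: "w \<in> V" using V y(1) by (simp add: w_def csubspace_def)
  have w1: "cinner w w = 1"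
  proof -
    have "norm w = 1" using y(2) by (simp add: w_def norm_scaleC norm_divide)
    then show ?thesis by (simp add: cinner_self)
  qed
  have Tw: "?T w = r *\<^sub>C w"
    by (simp add: w_def clinear_onD[OF clinear_matrix_map] y(3) scaleC_scaleC mult.commute)
  define u' where "u' k = (if k < m then u k else w)" for k
  define d' where "d' k = (if k < m then d k else Re r)" for k
  have "cinner (u' k) (u' l) = (if k = l then 1 else 0)" if "k < Suc m" "l < Suc m" for k l
  proof -
    have "cinner w (u l) = cnj (cinner (u l) w)" for l by (rule cinner_commute)
    then show ?thesis
      using that wV w1 u(2)[of k l] by (auto simp: u'_def V_def not_less less_Suc_eq)
  qed
  moreover have "coord (u' k) i = 0" if "k < Suc m" "i \<ge> N" for k i
    using that u(1) wV by (simp add: u'_def V_def)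
  moreover have "?T (u' k) = complex_of_real (d' k) *\<^sub>C u' k" if "k < Suc m" for k
    using that u(3) Tw r by (simp add: u'_def d'_def)
  ultimately show ?case by blast
qed simp

lemma mat_adjoint_carrier: "P \<in> carrier_mat n n \<Longrightarrow> mat_adjoint P \<in> carrier_mat n n"
  by (auto simp: mat_adjoint_def)

lemma mat_adjoint_index:
  "P \<in> carrier_mat n n \<Longrightarrow> i < n \<Longrightarrow> j < n \<Longrightarrow> mat_adjoint P $$ (i, j) = cnj (P $$ (j, i))"
  for P :: "complex mat"
  by (simp add: mat_adjoint_def mat_of_rows_index)

lemma mat_diag_mult_vec_index:
  assumes w: "w \<in> carrier_vec n" and k: "k < n"
  shows "vec_index (mat_diag n g *\<^sub>v w) k = g k * vec_index w k"
proof -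
  have "vec_index (mat_diag n g *\<^sub>v w) k = (\<Sum>j<n. (if k = j then g j else 0) * vec_index w j)"
    using assms by (simp add: mat_diag_def scalar_prod_def lessThan_atLeast0)
  also have "\<dots> = g k * vec_index w k"
    using k by (simp add: if_distrib[of "\<lambda>z. z * _"] cong: if_cong)
  finally show ?thesis .
qed

text \<open>Two diagonalisations are related by \<open>C = P\<^sup>* P'\<close>, whose entries intertwine the two sets of
  eigenvalues; hence they vanish unless the eigenvalues agree, and intertwine their images
  under \<open>f\<close> as well.\<close>

lemma hermitian_mat_fun_eq:
  assumes P: "P \<in> carrier_mat n n" and unit: "mat_adjoint P * P = 1\<^sub>m n"
    and A: "A = P * mat_diag n (\<lambda>i. complex_of_real (d i)) * mat_adjoint P"
  shows "hermitian_mat_fun f A = P * mat_diag n (\<lambda>i. complex_of_real (f (d i))) * mat_adjoint P"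
proof -
  have dimA: "dim_row A = n" using P by (simp add: A)
  let ?diag = "\<lambda>d. mat_diag n (\<lambda>i. complex_of_real (d i))"
  have uniq: "P' * ?diag (\<lambda>i. f (d' i)) * mat_adjoint P' = P * ?diag (\<lambda>i. f (d i)) * mat_adjoint P"
    if P': "P' \<in> carrier_mat n n" and unit': "mat_adjoint P' * P' = 1\<^sub>m n"
      and A': "A = P' * ?diag d' * mat_adjoint P'" for P' d'
  proof -
    let ?Q = "mat_adjoint P" and ?Q' = "mat_adjoint P'"
    have Q: "?Q \<in> carrier_mat n n" and Q': "?Q' \<in> carrier_mat n n"
      using P P' by (auto intro: mat_adjoint_carrier)
    have D: "?diag g \<in> carrier_mat n n" for g by simp
    have PQ: "P * ?Q = 1\<^sub>m n" by (rule mat_mult_left_right_inverse[OF Q P unit])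
    have PQ': "P' * ?Q' = 1\<^sub>m n" by (rule mat_mult_left_right_inverse[OF Q' P' unit'])
    define C where "C = ?Q * P'"
    have C: "C \<in> carrier_mat n n" using Q P' by (simp add: C_def)
    have "?diag d * C = ?Q * (P * ?diag d * ?Q) * P'"
    proof -
      have "?Q * (P * ?diag d * ?Q) * P' = (?Q * P) * ?diag d * (?Q * P')"
        using P Q P' by (simp add: assoc_mult_mat[of _ n n _ n _ n] mult_carrier_mat[of _ n n _ n])
      then show ?thesis using Q P' by (simp add: unit C_def left_mult_one_mat[of _ n n])
    qed
    also have "P * ?diag d * ?Q = P' * ?diag d' * ?Q'" using A A' by simp
    also have "?Q * (P' * ?diag d' * ?Q') * P' = C * ?diag d' * (?Q' * P')"
      unfolding C_def using Q P' Q' by (simp add: assoc_mult_mat[of _ n n _ n _ n] mult_carrier_mat[of _ n n _ n])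
    also have "\<dots> = C * ?diag d'"
      unfolding unit' using C by (simp add: right_mult_one_mat[of _ n n])
    finally have comm: "?diag d * C = C * ?diag d'" .
    have ent: "complex_of_real (f (d i)) * C $$ (i, j) = C $$ (i, j) * complex_of_real (f (d' j))"
      if "i < n" "j < n" for i j
    proof -
      have "complex_of_real (d i) * C $$ (i, j) = C $$ (i, j) * complex_of_real (d' j)"
        using arg_cong[OF comm, of "\<lambda>X. X $$ (i, j)"] that
        by (simp add: mat_diag_mult_left[OF C] mat_diag_mult_right[OF C])
      then have "C $$ (i, j) = 0 \<or> d i = d' j" by auto
      then show ?thesis by auto
    qed
    have fcomm: "?diag (\<lambda>i. f (d i)) * C = C * ?diag (\<lambda>i. f (d' i))"
      unfolding mat_diag_mult_left[OF C] mat_diag_mult_right[OF C]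
      by (rule eq_matI) (auto simp: ent)
    have "P' * ?diag (\<lambda>i. f (d' i)) * ?Q' = (P * ?Q) * P' * ?diag (\<lambda>i. f (d' i)) * ?Q'"
      unfolding PQ using P' by (simp add: left_mult_one_mat[of _ n n])
    also have "\<dots> = P * (C * ?diag (\<lambda>i. f (d' i))) * ?Q'"
      unfolding C_def using P Q P' Q' by (simp add: assoc_mult_mat[of _ n n _ n _ n] mult_carrier_mat[of _ n n _ n])
    also have "\<dots> = P * (?diag (\<lambda>i. f (d i)) * C) * ?Q'" by (simp add: fcomm)
    also have "\<dots> = P * ?diag (\<lambda>i. f (d i)) * ?Q * (P' * ?Q')"
      unfolding C_def using P Q P' Q' by (simp add: assoc_mult_mat[of _ n n _ n _ n] mult_carrier_mat[of _ n n _ n])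
    also have "\<dots> = P * ?diag (\<lambda>i. f (d i)) * ?Q"
      unfolding PQ' using P Q by (simp add: right_mult_one_mat[of _ n n])
    finally show ?thesis .
  qed
  show ?thesis
    unfolding hermitian_mat_fun_def dimA
  proof (rule the_equality)
    show "\<exists>P' d'. P' \<in> carrier_mat n n \<and> mat_adjoint P' * P' = 1\<^sub>m n \<and>
        A = P' * ?diag d' * mat_adjoint P' \<and>
        P * ?diag (\<lambda>i. f (d i)) * mat_adjoint P = P' * ?diag (\<lambda>i. f (d' i)) * mat_adjoint P'"
      using P unit A by blast
  qed (use uniq in blast)
qed

text \<open>The orthogonal family consists of the projections onto the eigenvectors of the truncated matrix,
  extended by zero.\<close>

lemma truncation_calculus:
  assumes M: "\<And>i j. M i j = cnj (M j i)"
  shows "\<exists>\<Phi>. functional_calculus \<Phi> \<and>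
    (\<forall>f x. \<Phi> (\<lambda>t. complex_of_real (f t)) x =
      ell2_of_vec (hermitian_mat_fun f (trunc_matrix M n) *\<^sub>v trunc_vec x n)) \<and>
    (\<forall>x. \<Phi> (\<lambda>_. 1) x = ell2_of_vec (trunc_vec x n)) \<and>
    (\<forall>x. \<Phi> complex_of_real x = matrix_map M (Suc n) x)"
proof -
  define N where "N = Suc n"
  from hermitian_orthonormal_eigenvectors[where M = M and m = N, OF M order_refl]
  obtain u d where "\<forall>k<N. \<forall>i\<ge>N. coord (u k) i = 0"
    "\<forall>k<N. \<forall>l<N. cinner (u k) (u l) = (if k = l then 1 else 0)"
    "\<forall>k<N. matrix_map M N (u k) = complex_of_real (d k) *\<^sub>C u k"
    by (elim exE conjE) (rule that)
  then have u: "\<And>k i. k < N \<Longrightarrow> i \<ge> N \<Longrightarrow> coord (u k) i = 0"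
    "\<And>k l. k < N \<Longrightarrow> l < N \<Longrightarrow> cinner (u k) (u l) = (if k = l then 1 else 0)"
    "\<And>k. k < N \<Longrightarrow> matrix_map M N (u k) = complex_of_real (d k) *\<^sub>C u k"
    by simp_all
  define Q where "Q k x = cinner (u k) x *\<^sub>C u k" for k and x :: ell2
  have res: "resolution {..<N} Q"
    unfolding Q_def[abs_def] by (rule resolution_orthonormal) (auto simp: u(2))
  define \<Phi> where "\<Phi> = spectral_sum {..<N} d Q"
  have coord_\<Phi>: "coord (\<Phi> g x) i = (if i < N then
      \<Sum>k<N. coord (u k) i * (g (d k) * (\<Sum>j<N. cnj (coord (u k) j) * coord x j)) else 0)" for g x i
    unfolding \<Phi>_def spectral_sum_def Q_def
    by (auto simp: cinner_finite_support[OF u(1)] u(1) mult_ac intro!: sum.cong sum.neutral)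

  define P where "P = Matrix.mat N N (\<lambda>(i, k). coord (u k) i)"
  let ?diag = "\<lambda>d. mat_diag N (\<lambda>i. complex_of_real (d i))"
  have P: "P \<in> carrier_mat N N" by (simp add: P_def)
  have adj: "mat_adjoint P = Matrix.mat N N (\<lambda>(k, i). cnj (coord (u k) i))"
  proof (rule eq_matI)
    fix k i assume "k < dim_row (Matrix.mat N N (\<lambda>(k, i). cnj (coord (u k) i)))"
      "i < dim_col (Matrix.mat N N (\<lambda>(k, i). cnj (coord (u k) i)))"
    then have ki: "k < N" "i < N" by auto
    show "mat_adjoint P $$ (k, i) = Matrix.mat N N (\<lambda>(k, i). cnj (coord (u k) i)) $$ (k, i)"
      unfolding mat_adjoint_index[OF P ki] using ki by (simp add: P_def)
  qed (use mat_adjoint_carrier[OF P] in auto)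
  have unit: "mat_adjoint P * P = 1\<^sub>m N"
  proof (rule eq_matI)
    fix k l assume "k < dim_row (1\<^sub>m N :: complex mat)" "l < dim_col (1\<^sub>m N :: complex mat)"
    then have kl: "k < N" "l < N" by auto
    then have "(mat_adjoint P * P) $$ (k, l) = (\<Sum>i<N. cnj (coord (u k) i) * coord (u l) i)"
      unfolding adj unfolding P_def by (simp add: scalar_prod_def lessThan_atLeast0)
    also have "\<dots> = cinner (u k) (u l)" by (rule cinner_finite_support[OF u(1), symmetric]) (use kl in auto)
    finally show "(mat_adjoint P * P) $$ (k, l) = 1\<^sub>m N $$ (k, l)" using kl u(2) by simp
  qed (use P mat_adjoint_carrier[OF P] in auto)
  have unit': "P * mat_adjoint P = 1\<^sub>m N"
    by (rule mat_mult_left_right_inverse[OF mat_adjoint_carrier[OF P] P unit])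
  have tm: "trunc_matrix M n \<in> carrier_mat N N" by (simp add: trunc_matrix_def N_def)
  have "trunc_matrix M n * P = P * ?diag d"
    unfolding mat_diag_mult_right[OF P]
  proof (rule eq_matI)
    fix i k assume "i < dim_row (Matrix.mat N N (\<lambda>(i, j). P $$ (i, j) * complex_of_real (d j)))"
      "k < dim_col (Matrix.mat N N (\<lambda>(i, j). P $$ (i, j) * complex_of_real (d j)))"
    then have ik: "i < N" "k < N" by auto
    then have "(trunc_matrix M n * P) $$ (i, k) = coord (matrix_map M N (u k)) i"
      by (simp add: trunc_matrix_def P_def coord_matrix_map scalar_prod_def lessThan_atLeast0 N_def)
    then show "(trunc_matrix M n * P) $$ (i, k) =
        Matrix.mat N N (\<lambda>(i, j). P $$ (i, j) * complex_of_real (d j)) $$ (i, k)"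
      using ik by (simp add: u(3) P_def mult.commute)
  qed (use P in \<open>auto simp: trunc_matrix_def N_def\<close>)
  then have diag: "trunc_matrix M n = P * ?diag d * mat_adjoint P"
    using assoc_mult_mat[OF tm P mat_adjoint_carrier[OF P]] tm by (simp add: unit')

  have f: "\<Phi> (\<lambda>t. complex_of_real (f t)) x =
      ell2_of_vec (hermitian_mat_fun f (trunc_matrix M n) *\<^sub>v trunc_vec x n)" for f x
  proof (rule ell2_eqI)
    fix i
    have v: "trunc_vec x n \<in> carrier_vec N" by (simp add: trunc_vec_def N_def)
    let ?w = "mat_adjoint P *\<^sub>v trunc_vec x n"
    have w: "?w \<in> carrier_vec N" using mat_adjoint_carrier[OF P] v by auto
    have "hermitian_mat_fun f (trunc_matrix M n) *\<^sub>v trunc_vec x n =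
        P *\<^sub>v (?diag (\<lambda>i. f (d i)) *\<^sub>v ?w)"
      unfolding hermitian_mat_fun_eq[OF P unit diag]
      using P mat_adjoint_carrier[OF P] v by (simp add: assoc_mult_mat_vec[of _ N N _ N])
    moreover have "vec_index ?w k = (\<Sum>j<N. cnj (coord (u k) j) * coord x j)" if "k < N" for k
      using that unfolding adj by (simp add: trunc_vec_def scalar_prod_def lessThan_atLeast0 N_def)
    moreover have "vec_index (?diag (\<lambda>i. f (d i)) *\<^sub>v ?w) k = complex_of_real (f (d k)) * vec_index ?w k"
      if "k < N" for k
      using that by (rule mat_diag_mult_vec_index[OF w])
    moreover have "dim_vec (?diag (\<lambda>i. f (d i)) *\<^sub>v ?w) = N" by (simp add: mat_diag_def)
    ultimately show "coord (\<Phi> (\<lambda>t. complex_of_real (f t)) x) i =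
        coord (ell2_of_vec (hermitian_mat_fun f (trunc_matrix M n) *\<^sub>v trunc_vec x n)) i"
      unfolding coord_\<Phi> using P by (auto simp: P_def scalar_prod_def lessThan_atLeast0)
  qed
  have vec_eq: "hermitian_mat_fun (\<lambda>_. 1) (trunc_matrix M n) = 1\<^sub>m N"
    unfolding hermitian_mat_fun_eq[OF P unit diag] using P by (simp add: unit' right_mult_one_mat[of _ N N])
  have one: "\<Phi> (\<lambda>_. 1) x = ell2_of_vec (trunc_vec x n)" for x
    using f[of "\<lambda>_. 1" x] by (simp add: vec_eq trunc_vec_def N_def)
  have "hermitian_mat_fun (\<lambda>t. t) (trunc_matrix M n) = trunc_matrix M n"
    unfolding hermitian_mat_fun_eq[OF P unit diag] diag[symmetric] ..
  then have id: "\<Phi> complex_of_real x = matrix_map M N x" for x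
    using f[of "\<lambda>t. t" x]
    by (intro ell2_eqI) (auto simp: coord_matrix_map trunc_matrix_def trunc_vec_def scalar_prod_def
        lessThan_atLeast0 N_def)
  have "functional_calculus \<Phi>"
    unfolding \<Phi>_def by (rule functional_calculus_spectral_sum[OF res])
  with f one id show ?thesis unfolding N_def by blast
qed

section \<open>Unitary equivalence\<close>

locale unitary_pair =
  fixes U :: "'a::chilbert_space \<Rightarrow> 'b::chilbert_space" and V :: "'b \<Rightarrow> 'a"
  assumes U_add: "U (x + y) = U x + U y" and U_scaleC: "U (c *\<^sub>C x) = c *\<^sub>C U x"
    and UV [simp]: "U (V z) = z" and VU [simp]: "V (U x) = x"
    and norm_U [simp]: "norm (U x) = norm x"
begin

lemma inverse: "unitary_pair V U"
proof
  fix w z :: 'b and c x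
  show "V (w + z) = V w + V z"
    using VU[of "V w + V z"] by (simp add: U_add)
  show "V (c *\<^sub>C w) = c *\<^sub>C V w"
    using VU[of "c *\<^sub>C V w"] by (simp add: U_scaleC)
  show "norm (V w) = norm w"
    using norm_U[of "V w"] by simp
qed simp_all

lemma U_zero: "U 0 = 0"
  using U_add[of 0 0] by simp

lemma bounded_linear_U: "bounded_linear U"
proof (rule bounded_linear_intro)
  fix x y :: 'a and r :: real
  show "U (x + y) = U x + U y" by (rule U_add)
  show "U (r *\<^sub>R x) = r *\<^sub>R U x" unfolding scaleC_of_real[symmetric] by (rule U_scaleC)
  show "norm (U x) \<le> norm x * 1" by simp
qed

lemma cinner_U: "cinner (U x) (U y) = cinner x y"
proof -
  have Re: "Re (cinner (U x) (U y)) = Re (cinner x y)" for x y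
    using norm_add_square[of "U x" "U y"] norm_add_square[of x y] by (simp add: U_add[symmetric])
  have "Re (cinner (U x) (U (\<i> *\<^sub>C y))) = Re (cinner x (\<i> *\<^sub>C y))" by (rule Re)
  then have "Im (cinner (U x) (U y)) = Im (cinner x y)"
    by (simp add: U_scaleC cinner_scaleC_right)
  with Re show ?thesis by (simp add: complex_eq_iff)
qed

lemma cinner_V: "cinner (U x) z = cinner x (V z)"
  using cinner_U[of x "V z"] by simp

lemma has_spectral_integral_transport:
  assumes "has_spectral_integral E f x y"
  shows "has_spectral_integral (\<lambda>t z. U (E t (V z))) f (U x) (U y)"
proof -
  obtain J where J: "\<And>a b. a < b \<Longrightarrow> has_RS_integral f (\<lambda>t. E t x) a b (J a b)"
    and lim: "((\<lambda>(a, b). J a b) \<longlongrightarrow> y) (at_bot \<times>\<^sub>F at_top)"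
    using has_spectral_integralE[OF assms] by blast
  have "has_RS_integral f (\<lambda>t. U (E t (V (U x)))) a b (U (J a b))" if "a < b" for a b
    using has_RS_integral_bounded_linear[OF J[OF that] bounded_linear_U] by simp
  moreover have "((\<lambda>(a, b). U (J a b)) \<longlongrightarrow> U y) (at_bot \<times>\<^sub>F at_top)"
    using bounded_linear.tendsto[OF bounded_linear_U lim] by (simp add: case_prod_unfold)
  ultimately show ?thesis
    unfolding has_spectral_integral_def by (intro exI[of _ "\<lambda>a b. U (J a b)"]) simp
qed

lemma spectral_family_transport:
  assumes E: "spectral_family E"
  shows "spectral_family (\<lambda>t z. U (E t (V z)))"
proof -
  interpret inv: unitary_pair V U by (rule inverse)
  have tendsto: "((\<lambda>t. U (E t (V z))) \<longlongrightarrow> U w) F" if "((\<lambda>t. E t (V z)) \<longlongrightarrow> w) F" for z w F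
    using bounded_linear.tendsto[OF bounded_linear_U that] .
  have "orthogonal_projection (\<lambda>z. U (E t (V z)))" for t
    unfolding orthogonal_projection_def clinear_on_def
    using spectral_family_projection[OF E, of t]
    by (simp add: spectral_family_linear[OF E] inv.U_add inv.U_scaleC U_add U_scaleC cinner_V inv.cinner_V[symmetric]
        orthogonal_projectionD)
  moreover have "U (E s (V (U (E t (V z))))) = U (E s (V z))" if "s \<le> t" for s t z
    using E that by (simp add: spectral_family_def)
  moreover have "((\<lambda>s. U (E s (V z))) \<longlongrightarrow> U (E t (V z))) (at_right t)" for t z
    using E by (intro tendsto) (simp add: spectral_family_def)
  moreover have "((\<lambda>t. U (E t (V z))) \<longlongrightarrow> 0) at_bot" for z
    using E tendsto[of z 0] by (simp add: spectral_family_def U_zero)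
  moreover have "((\<lambda>t. U (E t (V z))) \<longlongrightarrow> z) at_top" for z
    using E tendsto[of z "V z"] by (simp add: spectral_family_def)
  ultimately show ?thesis unfolding spectral_family_def by blast
qed

end

lemma spectral_family_of_transport:
  assumes "unitary_pair U V" and D: "D = U ` D'" and A: "\<And>x. x \<in> D' \<Longrightarrow> U (A' x) = A (U x)"
    and E: "spectral_family_of D A E"
  shows "spectral_family_of D' A' (\<lambda>t x. V (E t (U x)))"
proof -
  interpret unitary_pair U V by fact
  interpret inv: unitary_pair V U by (rule inverse)
  have "has_spectral_integral (\<lambda>t x. V (E t (U x))) (\<lambda>t. t) x y \<longleftrightarrow>
      has_spectral_integral E (\<lambda>t. t) (U x) (U y)" for x y
    using inv.has_spectral_integral_transport[of E "\<lambda>t. t" "U x" "U y"]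
      has_spectral_integral_transport[of "\<lambda>t x. V (E t (U x))" "\<lambda>t. t" x y] by auto
  moreover have "U x \<in> D \<and> A (U x) = U y \<longleftrightarrow> x \<in> D' \<and> A' x = y" for x y
  proof -
    have "U x \<in> D \<longleftrightarrow> x \<in> D'" unfolding D by (metis VU image_iff)
    moreover have "A' x = y \<longleftrightarrow> U (A' x) = U y" by (metis VU)
    ultimately show ?thesis using A by auto
  qed
  ultimately show ?thesis
    using E inv.spectral_family_transport unfolding spectral_family_of_def by simp
qed

context
  fixes \<phi> :: "nat \<Rightarrow> 'h::chilbert_space"
  assumes basis: "orthonormal_basis \<phi>"
begin

lemma basis_orthonormal: "cinner (\<phi> i) (\<phi> j) = (if i = j then 1 else 0)"
  using basis by (simp add: orthonormal_basis_def)

lemma basis_expansion: "(\<lambda>i. cinner (\<phi> i) x *\<^sub>C \<phi> i) sums x"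
  using basis by (simp add: orthonormal_basis_def)

lemma summable_basis_coeffs: "summable (\<lambda>i. (cmod (cinner (\<phi> i) x))\<^sup>2)"
proof (rule summableI_nonneg_bounded[of _ "(norm x)\<^sup>2"])
  fix n
  have res: "resolution {..<n} (\<lambda>k x. cinner (\<phi> k) x *\<^sub>C \<phi> k)"
    by (rule resolution_orthonormal) (auto simp: basis_orthonormal)
  have "norm (\<phi> i) = 1" for i
    using basis_orthonormal[of i i] by (simp add: norm_eq_sqrt_cinner)
  then have "(\<Sum>i<n. (cmod (cinner (\<phi> i) x))\<^sup>2) = (norm (\<Sum>i<n. cinner (\<phi> i) x *\<^sub>C \<phi> i))\<^sup>2"
    unfolding resolution_norm_square_sum[OF res] by (simp add: norm_scaleC)
  also have "\<dots> \<le> (norm x)\<^sup>2"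
    using resolution_contraction[OF res, of x] by (intro power_mono) auto
  finally show "(\<Sum>i<n. (cmod (cinner (\<phi> i) x))\<^sup>2) \<le> (norm x)\<^sup>2" .
qed simp

definition basis_coords :: "'h \<Rightarrow> ell2" where
  "basis_coords x = Abs_ell2 (\<lambda>i. cinner (\<phi> i) x)"

lemma coord_basis_coords: "coord (basis_coords x) i = cinner (\<phi> i) x"
  unfolding basis_coords_def by (subst Abs_ell2_inverse) (auto simp: summable_basis_coeffs)

lemma norm_basis_sum:
  "finite K \<Longrightarrow> (norm (\<Sum>i\<in>K. c i *\<^sub>C \<phi> i))\<^sup>2 = (\<Sum>i\<in>K. (cmod (c i))\<^sup>2)"
proof -
  have "norm (\<phi> i) = 1" for i
    using basis_orthonormal[of i i] by (simp add: norm_eq_sqrt_cinner)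
  then show ?thesis if "finite K"
    using that by (subst norm_sum_orthogonal_square)
      (auto simp: cinner_scaleC_left cinner_scaleC_right basis_orthonormal norm_scaleC)
qed

text \<open>By orthonormality the norms of the blocks of this series are those of the coordinate sequence,
  which makes the partial sums Cauchy.\<close>

lemma basis_iso_sums: "(\<lambda>i. coord v i *\<^sub>C \<phi> i) sums basis_iso \<phi> v"
proof -
  have "summable (\<lambda>i. coord v i *\<^sub>C \<phi> i)"
    unfolding summable_Cauchy
  proof (intro allI impI)
    fix e :: real assume e: "0 < e"
    then have "0 < e\<^sup>2" by simp
    then obtain N where N: "\<And>m n. m \<ge> N \<Longrightarrow> norm (\<Sum>i\<in>{m..<n}. (cmod (coord v i))\<^sup>2) < e\<^sup>2"
      using summable_coord[of v] unfolding summable_Cauchy by blast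
    have "norm (\<Sum>i\<in>{m..<n}. coord v i *\<^sub>C \<phi> i) < e" if "m \<ge> N" for m n
    proof (rule power2_less_imp_less[of _ e])
      show "(norm (\<Sum>i\<in>{m..<n}. coord v i *\<^sub>C \<phi> i))\<^sup>2 < e\<^sup>2"
        using N[OF that, of n] by (simp add: norm_basis_sum sum_nonneg)
    qed (use e in simp)
    then show "\<exists>N. \<forall>m\<ge>N. \<forall>n. norm (\<Sum>i\<in>{m..<n}. coord v i *\<^sub>C \<phi> i) < e" by blast
  qed
  then show ?thesis unfolding basis_iso_def by (rule summable_sums)
qed

lemma cinner_basis_iso: "cinner (\<phi> j) (basis_iso \<phi> v) = coord v j"
proof -
  have "(\<lambda>i. cinner (\<phi> j) (coord v i *\<^sub>C \<phi> i)) sums cinner (\<phi> j) (basis_iso \<phi> v)"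
    by (rule bounded_linear.sums[OF bounded_linear_cinner basis_iso_sums])
  moreover have "(\<lambda>i. cinner (\<phi> j) (coord v i *\<^sub>C \<phi> i)) = (\<lambda>i. if i = j then coord v i else 0)"
    by (auto simp: cinner_scaleC_right basis_orthonormal)
  ultimately show ?thesis using sums_single[of j "coord v"] sums_unique2 by metis
qed

lemma unitary_pair_basis_iso: "unitary_pair (basis_iso \<phi>) basis_coords"
proof -
  have VU: "basis_coords (basis_iso \<phi> v) = v" for v
    by (rule ell2_eqI) (simp add: coord_basis_coords cinner_basis_iso)
  have UV: "basis_iso \<phi> (basis_coords x) = x" for x
    using basis_iso_sums[of "basis_coords x"] basis_expansion[of x] sums_unique2
    by (simp add: coord_basis_coords) blast
  have V_add: "basis_coords (x + y) = basis_coords x + basis_coords y" for x y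
    by (rule ell2_eqI) (simp add: coord_basis_coords cinner_add_right)
  have V_scaleC: "basis_coords (c *\<^sub>C x) = c *\<^sub>C basis_coords x" for c x
    by (rule ell2_eqI) (simp add: coord_basis_coords cinner_scaleC_right)
  have norm: "norm (basis_iso \<phi> v) = norm v" for v
  proof -
    have "(\<lambda>n. (norm (\<Sum>i<n. coord v i *\<^sub>C \<phi> i))\<^sup>2) \<longlonglongrightarrow> (norm (basis_iso \<phi> v))\<^sup>2"
      by (intro tendsto_power tendsto_norm) (use basis_iso_sums in \<open>simp add: sums_def\<close>)
    moreover have "(\<lambda>n. \<Sum>i<n. (cmod (coord v i))\<^sup>2) \<longlonglongrightarrow> (\<Sum>i. (cmod (coord v i))\<^sup>2)"
      by (rule summable_LIMSEQ[OF summable_coord])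
    ultimately have "(norm (basis_iso \<phi> v))\<^sup>2 = (\<Sum>i. (cmod (coord v i))\<^sup>2)"
      by (simp add: norm_basis_sum LIMSEQ_unique)
    then show ?thesis
      by (simp add: norm_ell2.rep_eq real_sqrt_unique)
  qed
  show ?thesis
  proof
    fix v w :: ell2 and c
    show "basis_iso \<phi> (v + w) = basis_iso \<phi> v + basis_iso \<phi> w"
      using UV[of "basis_iso \<phi> v + basis_iso \<phi> w"] by (simp add: V_add VU)
    show "basis_iso \<phi> (c *\<^sub>C v) = c *\<^sub>C basis_iso \<phi> v"
      using UV[of "c *\<^sub>C basis_iso \<phi> v"] by (simp add: V_scaleC VU)
  qed (simp_all add: UV VU norm)
qed

lemma basis_iso_ell2_basis: "basis_iso \<phi> (ell2_basis i) = \<phi> i"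
proof -
  interpret unitary_pair "basis_iso \<phi>" basis_coords by (rule unitary_pair_basis_iso)
  have "basis_coords (\<phi> i) = ell2_basis i"
    by (rule ell2_eqI) (simp add: coord_basis_coords basis_orthonormal)
  then show ?thesis using UV[of "\<phi> i"] by simp
qed

end

section \<open>Existence of the spectral integral\<close>

lemma selfadjoint_symmetric:
  assumes "selfadjoint D A" "x \<in> D" "y \<in> D"
  shows "cinner y (A x) = cinner (A y) x"
proof -
  have "(y, A y) \<in> adjoint_graph D A" using assms by (simp add: selfadjoint_def)
  then show ?thesis using assms(2) by (simp add: adjoint_graph_def)
qed

text \<open>Eigenvectors to distinct eigenvalues are orthogonal, so by Bessel's inequality each basis
  vector is non-orthogonal to at most countably many of them.\<close>

lemma countable_eigenvalues:
  fixes A :: "'h::chilbert_space \<Rightarrow> 'h" and \<phi> :: "nat \<Rightarrow> 'h"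
  assumes \<phi>: "orthonormal_basis \<phi>" and A: "selfadjoint D A"
  shows "countable {l. eigenvalue_on D A l}"
proof -
  let ?L = "{l. eigenvalue_on D A l}"
  have "\<forall>l. \<exists>x. l \<in> ?L \<longrightarrow> x \<in> D \<and> norm x = 1 \<and> A x = l *\<^sub>R x"
  proof
    fix l
    show "\<exists>x. l \<in> ?L \<longrightarrow> x \<in> D \<and> norm x = 1 \<and> A x = l *\<^sub>R x"
    proof (cases "l \<in> ?L")
      case True
      then obtain x where x: "x \<in> D" "x \<noteq> 0" "A x = l *\<^sub>R x" by (auto simp: eigenvalue_on_def)
      define c where "c = complex_of_real (1 / norm x)"
      have "c *\<^sub>C x \<in> D \<and> A (c *\<^sub>C x) = c *\<^sub>C A x"
        using A x(1) by (simp add: selfadjoint_def clinear_on_def)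
      moreover have "norm (c *\<^sub>C x) = 1" using x(2) by (simp add: norm_scaleC c_def norm_divide)
      moreover have "c *\<^sub>C A x = l *\<^sub>R (c *\<^sub>C x)"
        by (simp add: x(3) scaleC_of_real[symmetric] scaleC_scaleC mult.commute)
      ultimately show ?thesis by (intro exI[of _ "c *\<^sub>C x"]) simp
    qed simp
  qed
  from choice[OF this] obtain x where
    x: "\<And>l. l \<in> ?L \<Longrightarrow> x l \<in> D \<and> norm (x l) = 1 \<and> A (x l) = l *\<^sub>R x l" by blast
  have ortho: "cinner (x k) (x l) = (if k = l then 1 else 0)" if "k \<in> ?L" "l \<in> ?L" for k l
  proof (cases "k = l")
    case True
    then show ?thesis using x[OF that(1)] by (simp add: cinner_self)
  next
    case False
    have "cinner (x k) (A (x l)) = cinner (A (x k)) (x l)"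
      using x that by (intro selfadjoint_symmetric[OF A]) auto
    then have "complex_of_real l * cinner (x k) (x l) = complex_of_real k * cinner (x k) (x l)"
      using x[OF that(1)] x[OF that(2)]
      by (simp add: scaleC_of_real[symmetric] cinner_scaleC_left cinner_scaleC_right)
    then show ?thesis using False by simp
  qed
  have "countable {l \<in> ?L. (cmod (cinner (x l) (\<phi> i)))\<^sup>2 \<noteq> 0}" for i
  proof (rule summable_countable_real, rule nonneg_bdd_above_summable_on)
    show "bdd_above (sum (\<lambda>l. (cmod (cinner (x l) (\<phi> i)))\<^sup>2) ` {F. F \<subseteq> ?L \<and> finite F})"
    proof (rule bdd_aboveI2)
      fix F assume "F \<in> {F. F \<subseteq> ?L \<and> finite F}"
      then have F: "finite F" "F \<subseteq> ?L" by auto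
      have res: "resolution F (\<lambda>l y. cinner (x l) y *\<^sub>C x l)"
        by (rule resolution_orthonormal[OF F(1)]) (use F(2) ortho in blast)
      have "(\<Sum>l\<in>F. (cmod (cinner (x l) (\<phi> i)))\<^sup>2) = (norm (\<Sum>l\<in>F. cinner (x l) (\<phi> i) *\<^sub>C x l))\<^sup>2"
        unfolding resolution_norm_square_sum[OF res]
        by (rule sum.cong) (use F(2) x in \<open>auto simp: norm_scaleC\<close>)
      also have "\<dots> \<le> (norm (\<phi> i))\<^sup>2"
        using resolution_contraction[OF res] by (intro power_mono) auto
      finally show "(\<Sum>l\<in>F. (cmod (cinner (x l) (\<phi> i)))\<^sup>2) \<le> (norm (\<phi> i))\<^sup>2" .
    qed
  qed simp
  then have "countable (\<Union>i. {l \<in> ?L. (cmod (cinner (x l) (\<phi> i)))\<^sup>2 \<noteq> 0})" by simp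
  moreover have "?L \<subseteq> (\<Union>i. {l \<in> ?L. (cmod (cinner (x l) (\<phi> i)))\<^sup>2 \<noteq> 0})"
  proof
    fix l assume l: "l \<in> ?L"
    have "\<exists>i. cinner (x l) (\<phi> i) \<noteq> 0"
    proof (rule ccontr)
      assume "\<not> (\<exists>i. cinner (x l) (\<phi> i) \<noteq> 0)"
      then have "cinner (\<phi> i) (x l) = 0" for i
        by (subst cinner_commute) simp
      then have "(\<lambda>i. 0) sums x l" using basis_expansion[OF \<phi>, of "x l"] by simp
      then have "x l = 0" using sums_unique2[OF _ sums_zero] by blast
      then show False using x[OF l] by simp
    qed
    then show "l \<in> (\<Union>i. {l \<in> ?L. (cmod (cinner (x l) (\<phi> i)))\<^sup>2 \<noteq> 0})" using l by simp
  qed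
  ultimately show ?thesis using countable_subset by blast
qed

text \<open>Away from the origin a linearly bounded function is dominated by a multiple of the identity,
  whose integral converges at the vectors of the domain.\<close>

lemma RS_integral_dominated:
  fixes E :: "real \<Rightarrow> 'h::chilbert_space \<Rightarrow> 'h"
  assumes E: "spectral_family E" and J: "has_RS_integral f (\<lambda>t. E t x) a b J"
    and I: "has_RS_integral (\<lambda>t. t) (\<lambda>t. E t x) a b I" and ab: "a \<le> b"
    and le: "\<And>t. a \<le> t \<Longrightarrow> t \<le> b \<Longrightarrow> \<bar>f t\<bar> \<le> c * \<bar>t\<bar>" and c: "0 \<le> c"
  shows "norm J \<le> c * norm I"
proof (rule field_le_epsilon)
  fix \<epsilon> :: real assume "0 < \<epsilon>"
  then have e: "0 < \<epsilon> / (c + 1)" using c by simp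
  from has_RS_integralE[OF J e] obtain d1 where d1: "0 < d1"
    "\<And>n t \<xi>. tagged_partition d1 a b n t \<xi> \<Longrightarrow> norm (RS_sum f (\<lambda>t. E t x) n t \<xi> - J) < \<epsilon> / (c + 1)" by blast
  from has_RS_integralE[OF I e] obtain d2 where d2: "0 < d2"
    "\<And>n t \<xi>. tagged_partition d2 a b n t \<xi> \<Longrightarrow> norm (RS_sum (\<lambda>t. t) (\<lambda>t. E t x) n t \<xi> - I) < \<epsilon> / (c + 1)" by blast
  obtain n t where t: "tagged_partition (min d1 d2) a b n t t"
    using tagged_partition_exists[OF ab, of "min d1 d2"] d1(1) d2(1) by auto
  let ?F = "RS_sum f (\<lambda>t. E t x) n t t" and ?I = "RS_sum (\<lambda>t. t) (\<lambda>t. E t x) n t t"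
  note res = resolution_partition[OF E t]
  let ?N = "\<lambda>k. (norm (increment E (t k) (t (Suc k)) x))\<^sup>2"
  have "(norm ?F)\<^sup>2 = (\<Sum>k<n. (cmod (complex_of_real (f (t k))))\<^sup>2 * ?N k)"
    unfolding RS_sum_increment[OF E] by (rule resolution_norm_square[OF res])
  also have "\<dots> \<le> (\<Sum>k<n. (c * cmod (complex_of_real (t k)))\<^sup>2 * ?N k)"
  proof (intro sum_mono mult_right_mono power_mono)
    fix k assume "k \<in> {..<n}"
    then have "a \<le> t k" "t k \<le> b"
      using tagged_partition_cells[OF t, of k] by auto
    then show "cmod (complex_of_real (f (t k))) \<le> c * cmod (complex_of_real (t k))"
      using le by simp
  qed auto
  also have "\<dots> = c\<^sup>2 * (\<Sum>k<n. (cmod (complex_of_real (t k)))\<^sup>2 * ?N k)"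
    by (simp only: power_mult_distrib sum_distrib_left mult.assoc)
  also have "\<dots> = (c * norm ?I)\<^sup>2"
    unfolding RS_sum_increment[OF E] power_mult_distrib by (simp only: resolution_norm_square[OF res])
  finally have "(norm ?F)\<^sup>2 \<le> (c * norm ?I)\<^sup>2" .
  then have "norm ?F \<le> c * norm ?I" by (rule power2_le_imp_le) (use c in simp)
  moreover have "norm (?F - J) < \<epsilon> / (c + 1)" by (rule d1(2)[OF tagged_partition_finer[OF t]]) simp
  moreover have "norm (?I - I) < \<epsilon> / (c + 1)" by (rule d2(2)[OF tagged_partition_finer[OF t]]) simp
  ultimately have "norm J \<le> c * (norm I + \<epsilon> / (c + 1)) + \<epsilon> / (c + 1)"
  proof -
    assume a1: "norm ?F \<le> c * norm ?I" and a2: "norm (?F - J) < \<epsilon> / (c + 1)"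
      and a3: "norm (?I - I) < \<epsilon> / (c + 1)"
    have "norm ?I \<le> norm I + \<epsilon> / (c + 1)"
      using norm_triangle_sub[of ?I I] a3 by linarith
    then have "c * norm ?I \<le> c * (norm I + \<epsilon> / (c + 1))" using c by (rule mult_left_mono)
    moreover have "norm J \<le> norm ?F + \<epsilon> / (c + 1)"
      using norm_triangle_sub[of J ?F] a2 by (simp add: norm_minus_commute)
    ultimately show ?thesis using a1 by linarith
  qed
  also have "\<dots> = c * norm I + \<epsilon>"
    using c by (simp add: field_simps add_nonneg_eq_0_iff)
  finally show "norm J \<le> c * norm I + \<epsilon>" .
qed

lemma spectral_integral_exists:
  fixes E :: "real \<Rightarrow> 'h::chilbert_space \<Rightarrow> 'h"
  assumes E: "spectral_family E" and id: "has_spectral_integral E (\<lambda>t. t) x z"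
    and bd: "\<And>t. \<bar>f t\<bar> \<le> \<alpha> + \<beta> * \<bar>t\<bar>" and \<alpha>\<beta>: "0 < \<alpha>" "0 < \<beta>"
    and C: "\<And>a b. a < b \<Longrightarrow> RS_Cauchy f (\<lambda>t. (norm (E t x))\<^sup>2) a b"
  shows "\<exists>y. has_spectral_integral E f x y"
proof -
  have "\<exists>J. has_RS_integral f (\<lambda>t. E t x) a b J" if "a < b" for a b
  proof (rule RS_Cauchy_imp_integral[OF RS_Cauchy_vector[OF E C[OF that]]])
    fix t assume t: "t \<in> {a..b}"
    then have "\<beta> * \<bar>t\<bar> \<le> \<beta> * max \<bar>a\<bar> \<bar>b\<bar>" using \<alpha>\<beta> by (intro mult_left_mono) auto
    then show "\<bar>f t\<bar> \<le> \<alpha> + \<beta> * max \<bar>a\<bar> \<bar>b\<bar>" using bd[of t] by linarith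
  qed (use that in simp)
  then have "\<forall>p. \<exists>J. fst p < snd p \<longrightarrow> has_RS_integral f (\<lambda>t. E t x) (fst p) (snd p) J" by blast
  from choice[OF this] obtain J0 where
    J0: "\<And>p. fst p < snd p \<Longrightarrow> has_RS_integral f (\<lambda>t. E t x) (fst p) (snd p) (J0 p)" by blast
  define J where "J a b = J0 (a, b)" for a b
  have J: "has_RS_integral f (\<lambda>t. E t x) a b (J a b)" if "a < b" for a b
    using J0[of "(a, b)"] that by (simp add: J_def)
  obtain I where I: "\<And>a b. a < b \<Longrightarrow> has_RS_integral (\<lambda>t. t) (\<lambda>t. E t x) a b (I a b)"
    and Ilim: "((\<lambda>(a, b). I a b) \<longlongrightarrow> z) (at_bot \<times>\<^sub>F at_top)"
    using has_spectral_integralE[OF id] by blast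
  define c where "c = \<alpha> + \<beta>"
  have c: "0 < c" using \<alpha>\<beta> by (simp add: c_def)
  have dom: "norm (J a b) \<le> c * norm (I a b)" if "a < b" "1 \<le> a \<or> b \<le> -1" for a b
  proof (rule RS_integral_dominated[OF E J I])
    fix t assume "a \<le> t" "t \<le> b"
    then have "1 \<le> \<bar>t\<bar>" using that by auto
    then have "\<alpha> * 1 \<le> \<alpha> * \<bar>t\<bar>" using \<alpha>\<beta> by (intro mult_left_mono) auto
    then show "\<bar>f t\<bar> \<le> c * \<bar>t\<bar>" using bd[of t] by (simp add: c_def distrib_right)
  qed (use that c in auto)
  \<comment> \<open>Enlarging \<open>[p, q]\<close> adds integrals over intervals away from the origin, and these are dominated
    by the corresponding integrals of the identity, which converge.\<close>
  have tail: "\<exists>p q. p < q \<and> (\<forall>a b. a \<le> p \<longrightarrow> q \<le> b \<longrightarrow> norm (J a b - J p q) \<le> \<epsilon>)"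
    if \<epsilon>: "0 < \<epsilon>" for \<epsilon>
  proof -
    define e where "e = \<epsilon> / (4 * c)"
    have e: "0 < e" using \<epsilon> c by (simp add: e_def)
    have "\<forall>\<^sub>F p in at_bot \<times>\<^sub>F at_top. dist (case p of (a, b) \<Rightarrow> I a b) z < e"
      by (rule tendstoD[OF Ilim e])
    then obtain P Q where P: "eventually P at_bot" and Q: "eventually Q at_top"
      and PQ: "\<And>a b. P a \<Longrightarrow> Q b \<Longrightarrow> dist (I a b) z < e"
      unfolding eventually_prod_filter by auto
    obtain p0 where p0: "\<And>a. a \<le> p0 \<Longrightarrow> P a" using P unfolding eventually_at_bot_linorder by blast
    obtain q0 where q0: "\<And>b. q0 \<le> b \<Longrightarrow> Q b" using Q unfolding eventually_at_top_linorder by blast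
    define p where "p = min p0 (- 1)"
    define q where "q = max q0 1"
    have pq: "p < q" "p \<le> -1" "1 \<le> q" by (auto simp: p_def q_def)
    have near: "dist (I a b) z < e" if "a \<le> p" "q \<le> b" for a b
      using that by (intro PQ p0 q0) (auto simp: p_def q_def)
    have ebound: "norm (I a b - I a' b') \<le> 2 * e" if "a \<le> p" "q \<le> b" "a' \<le> p" "q \<le> b'" for a b a' b'
      using near[OF that(1,2)] near[OF that(3,4)] dist_triangle2[of "I a b" "I a' b'" z]
      unfolding dist_norm by linarith
    have right: "norm (J p b - J p q) \<le> \<epsilon> / 2" if "q \<le> b" for b
    proof (cases "q = b")
      case False
      then have qb: "q < b" using that by simp
      have "I p b = I p q + I q b"
        by (rule has_RS_integral_additive[OF I I I]) (use pq qb in auto)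
      then have "norm (I q b) \<le> 2 * e" using ebound[of p b p q] that by simp
      then have "c * norm (I q b) \<le> c * (2 * e)" using c by (intro mult_left_mono) auto
      moreover have "J p b = J p q + J q b"
        by (rule has_RS_integral_additive[OF J J J]) (use pq qb in auto)
      ultimately show ?thesis using dom[OF qb] pq c by (simp add: e_def)
    qed (use \<epsilon> in simp)
    have left: "norm (J a b - J p b) \<le> \<epsilon> / 2" if "a \<le> p" "q \<le> b" for a b
    proof (cases "a = p")
      case False
      then have ap: "a < p" using that by simp
      have "I a b = I a p + I p b"
        by (rule has_RS_integral_additive[OF I I I]) (use pq ap that in auto)
      then have "norm (I a p) \<le> 2 * e" using ebound[of a b p b] that by simp
      then have "c * norm (I a p) \<le> c * (2 * e)" using c by (intro mult_left_mono) auto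
      moreover have "J a b = J a p + J p b"
        by (rule has_RS_integral_additive[OF J J J]) (use pq ap that in auto)
      ultimately show ?thesis using dom[OF ap] pq c by (simp add: e_def)
    qed (use \<epsilon> in simp)
    have "norm (J a b - J p q) \<le> \<epsilon>" if "a \<le> p" "q \<le> b" for a b
      using left[OF that] right[OF that(2)] norm_triangle_ineq[of "J a b - J p b" "J p b - J p q"] by simp
    with pq(1) show ?thesis by blast
  qed
  have "Cauchy (\<lambda>n. J (- real n) (real n))"
  proof (rule metric_CauchyI)
    fix \<epsilon> :: real assume "0 < \<epsilon>"
    then have "0 < \<epsilon> / 3" by simp
    from tail[OF this] obtain p q where pq: "\<And>a b. a \<le> p \<Longrightarrow> q \<le> b \<Longrightarrow> norm (J a b - J p q) \<le> \<epsilon> / 3"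
      by blast
    obtain N where N: "max (- p) q \<le> real N" using real_arch_simple by blast
    have close: "norm (J (- real n) (real n) - J p q) \<le> \<epsilon> / 3" if "n \<ge> N" for n
    proof (rule pq)
      have "real N \<le> real n" using that by simp
      then show "- real n \<le> p" "q \<le> real n" using N by linarith+
    qed
    have "dist (J (- real m) (real m)) (J (- real n) (real n)) < \<epsilon>" if "m \<ge> N" "n \<ge> N" for m n
      using close[OF that(1)] close[OF that(2)] \<open>0 < \<epsilon>\<close>
        dist_triangle2[of "J (- real m) (real m)" "J (- real n) (real n)" "J p q"]
      unfolding dist_norm by linarith
    then show "\<exists>M. \<forall>m\<ge>M. \<forall>n\<ge>M. dist (J (- real m) (real m)) (J (- real n) (real n)) < \<epsilon>" by blast
  qed
  then obtain y where y: "(\<lambda>n. J (- real n) (real n)) \<longlonglongrightarrow> y"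
    by (auto simp: Cauchy_convergent_iff convergent_def)
  have "((\<lambda>(a, b). J a b) \<longlongrightarrow> y) (at_bot \<times>\<^sub>F at_top)"
  proof (rule tendstoI)
    fix \<epsilon> :: real assume "0 < \<epsilon>"
    then have "0 < \<epsilon> / 3" by simp
    from tail[OF this] obtain p q where pq: "\<And>a b. a \<le> p \<Longrightarrow> q \<le> b \<Longrightarrow> norm (J a b - J p q) \<le> \<epsilon> / 3"
      by blast
    obtain N where N: "max (- p) q \<le> real N" using real_arch_simple by blast
    have "norm (y - J p q) \<le> \<epsilon> / 3"
    proof (rule LIMSEQ_le_const2[OF tendsto_norm[OF tendsto_diff[OF y tendsto_const]]])
      have "norm (J (- real n) (real n) - J p q) \<le> \<epsilon> / 3" if "n \<ge> N" for n
      proof (rule pq)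
        have "real N \<le> real n" using that by simp
        then show "- real n \<le> p" "q \<le> real n" using N by linarith+
      qed
      then show "\<exists>N. \<forall>n\<ge>N. norm (J (- real n) (real n) - J p q) \<le> \<epsilon> / 3" by blast
    qed
    then have "dist (J a b) y < \<epsilon>" if "a \<le> p" "q \<le> b" for a b
      using pq[OF that] \<open>0 < \<epsilon>\<close> dist_triangle2[of "J a b" y "J p q"] unfolding dist_norm by linarith
    then show "\<forall>\<^sub>F p in at_bot \<times>\<^sub>F at_top. dist (case p of (a, b) \<Rightarrow> J a b) y < \<epsilon>"
      unfolding eventually_prod_filter
      by (intro exI[of _ "\<lambda>a. a \<le> p"] exI[of _ "\<lambda>b. q \<le> b"])
        (auto simp: eventually_le_at_bot eventually_ge_at_top)
  qed
  with J show ?thesis unfolding has_spectral_integral_def by blast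
qed

section \<open>Self-adjoint matrix operators\<close>

lemma in_ell2_0_iff: "x \<in> ell2_0 \<longleftrightarrow> (\<exists>N. \<forall>i\<ge>N. coord x i = 0)"
proof
  assume "x \<in> ell2_0"
  then obtain c n where "x = (\<Sum>i<n. c i *\<^sub>C ell2_basis i)" unfolding ell2_0_def by blast
  then have "coord x i = (if i < n then c i else 0)" for i by (simp only: coord_span)
  then show "\<exists>N. \<forall>i\<ge>N. coord x i = 0" by (intro exI[of _ n]) simp
next
  assume "\<exists>N. \<forall>i\<ge>N. coord x i = 0"
  then obtain N where "\<And>i. i \<ge> N \<Longrightarrow> coord x i = 0" by blast
  from finite_support_span[OF this] show "x \<in> ell2_0"
    unfolding ell2_0_def by (intro CollectI exI[of _ "coord x"] exI[of _ N])
qed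

lemma ell2_basis_in_ell2_0: "ell2_basis i \<in> ell2_0"
  unfolding in_ell2_0_iff by (intro exI[of _ "Suc i"]) simp

lemma truncation_in_ell2_0: "ell2_of_vec w \<in> ell2_0"
  unfolding in_ell2_0_iff by (intro exI[of _ "dim_vec w"]) simp

lemma csubspace_ell2_0: "csubspace ell2_0"
proof -
  have "x + y \<in> ell2_0" if x: "x \<in> ell2_0" and y: "y \<in> ell2_0" for x y
  proof -
    obtain N where N: "\<forall>i\<ge>N. coord x i = 0" using x unfolding in_ell2_0_iff ..
    obtain N' where N': "\<forall>i\<ge>N'. coord y i = 0" using y unfolding in_ell2_0_iff ..
    show ?thesis
      unfolding in_ell2_0_iff by (intro exI[of _ "max N N'"]) (simp add: N N')
  qed
  moreover have "c *\<^sub>C x \<in> ell2_0" if x: "x \<in> ell2_0" for c x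
  proof -
    obtain N where N: "\<forall>i\<ge>N. coord x i = 0" using x unfolding in_ell2_0_iff ..
    show ?thesis
      unfolding in_ell2_0_iff by (intro exI[of _ N]) (simp add: N)
  qed
  moreover have "0 \<in> ell2_0" unfolding in_ell2_0_iff by simp
  ultimately show ?thesis by (simp add: csubspace_def)
qed

lemma closure_ell2_0: "closure ell2_0 = UNIV"
proof -
  have "x \<in> closure ell2_0" for x
    unfolding closure_sequential
    using truncation_in_ell2_0 truncation_tendsto[of x] by (intro exI[of _ "\<lambda>n. ell2_of_vec (trunc_vec x n)"]) simp
  then show ?thesis by blast
qed

lemma clinear_on_span:
  fixes n :: nat
  assumes A: "clinear_on D A" and e: "\<And>i. e i \<in> D"
  shows "(\<Sum>i<n. c i *\<^sub>C e i) \<in> D \<and> A (\<Sum>i<n. c i *\<^sub>C e i) = (\<Sum>i<n. c i *\<^sub>C A (e i))"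
proof (induction n)
  case 0
  have "0 *\<^sub>C e 0 \<in> D \<and> A (0 *\<^sub>C e 0) = 0 *\<^sub>C A (e 0)"
    using A e unfolding clinear_on_def by blast
  then show ?case by simp
next
  case (Suc n)
  have "c n *\<^sub>C e n \<in> D \<and> A (c n *\<^sub>C e n) = c n *\<^sub>C A (e n)"
    using A e unfolding clinear_on_def by blast
  then show ?case using A Suc unfolding clinear_on_def by simp
qed

locale selfadjoint_matrix =
  fixes M :: "nat \<Rightarrow> nat \<Rightarrow> complex"
  assumes hermitian: "M i j = cnj (M j i)"
    and selfadjoint: "selfadjoint (inf_matrix_dom M) (inf_matrix_op M)"
    and basis_in_dom: "ell2_basis i \<in> inf_matrix_dom M"
begin

lemma linear: "clinear_on (inf_matrix_dom M) (inf_matrix_op M)"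
  using selfadjoint by (simp add: selfadjoint_def)

lemma coord_op:
  assumes "v \<in> inf_matrix_dom M"
  shows "coord (inf_matrix_op M v) i = (\<Sum>j. M i j * coord v j)"
  using assms unfolding inf_matrix_op_def inf_matrix_dom_def by (subst Abs_ell2_inverse) auto

lemma coord_op_basis: "coord (inf_matrix_op M (ell2_basis j)) i = M i j"
  unfolding coord_op[OF basis_in_dom]
  by (subst suminf_finite[of "{j}"]) auto

lemma ell2_0_op:
  "(\<Sum>i<n. c i *\<^sub>C ell2_basis i) \<in> inf_matrix_dom M"
  "inf_matrix_op M (\<Sum>i<n. c i *\<^sub>C ell2_basis i) = (\<Sum>i<n. c i *\<^sub>C inf_matrix_op M (ell2_basis i))"
  using clinear_on_span[OF linear basis_in_dom, where c = c and n = n] by auto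

lemma ell2_0_subset: "ell2_0 \<subseteq> inf_matrix_dom M"
  unfolding ell2_0_def using ell2_0_op(1) by auto

text \<open>A vector orthogonal to the range of \<open>M - z\<close> on \<open>\<ell>\<^sup>2\<^sub>0\<close> satisfies the rowwise equations of
  an eigenvector of the maximal operator to the eigenvalue \<open>cnj z\<close>. A self-adjoint operator has
  only real eigenvalues.\<close>

lemma shifted_range_dense:
  assumes z: "z \<noteq> cnj z"
  shows "closure ((\<lambda>u. inf_matrix_op M u - z *\<^sub>C u) ` ell2_0) = UNIV"
proof (rule csubspace_dense)
  let ?A = "inf_matrix_op M" and ?D = "inf_matrix_dom M"
  have add: "?A (x + y) = ?A x + ?A y" if "x \<in> ell2_0" "y \<in> ell2_0" for x y
    using linear that ell2_0_subset unfolding clinear_on_def by blast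
  have scale: "?A (c *\<^sub>C x) = c *\<^sub>C ?A x" if "x \<in> ell2_0" for c x
    using linear that ell2_0_subset unfolding clinear_on_def by blast
  show "csubspace ((\<lambda>u. ?A u - z *\<^sub>C u) ` ell2_0)"
    unfolding csubspace_def
  proof (intro conjI ballI allI)
    have "?A 0 = 0" using scale[of 0 0] csubspace_ell2_0 by (simp add: csubspace_def)
    then have "0 = ?A 0 - z *\<^sub>C 0" by simp
    moreover have "0 \<in> ell2_0" using csubspace_ell2_0 by (simp add: csubspace_def)
    ultimately show "0 \<in> (\<lambda>u. ?A u - z *\<^sub>C u) ` ell2_0" by (rule image_eqI)
  next
    fix x y assume "x \<in> (\<lambda>u. ?A u - z *\<^sub>C u) ` ell2_0" "y \<in> (\<lambda>u. ?A u - z *\<^sub>C u) ` ell2_0"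
    then obtain u w where u: "u \<in> ell2_0" "x = ?A u - z *\<^sub>C u" and w: "w \<in> ell2_0" "y = ?A w - z *\<^sub>C w"
      by blast
    have "x + y = ?A (u + w) - z *\<^sub>C (u + w)"
      by (simp add: u w add scaleC_add_right)
    moreover have "u + w \<in> ell2_0" using csubspace_ell2_0 u w by (simp add: csubspace_def)
    ultimately show "x + y \<in> (\<lambda>u. ?A u - z *\<^sub>C u) ` ell2_0" by (rule image_eqI)
  next
    fix c x assume "x \<in> (\<lambda>u. ?A u - z *\<^sub>C u) ` ell2_0"
    then obtain u where u: "u \<in> ell2_0" "x = ?A u - z *\<^sub>C u" by blast
    have "c *\<^sub>C x = ?A (c *\<^sub>C u) - z *\<^sub>C (c *\<^sub>C u)"
      by (simp add: u scale scaleC_diff_right scaleC_scaleC mult.commute)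
    moreover have "c *\<^sub>C u \<in> ell2_0" using csubspace_ell2_0 u by (simp add: csubspace_def)
    ultimately show "c *\<^sub>C x \<in> (\<lambda>u. ?A u - z *\<^sub>C u) ` ell2_0" by (rule image_eqI)
  qed
next
  let ?A = "inf_matrix_op M" and ?D = "inf_matrix_dom M"
  fix y assume orth: "\<forall>x\<in>(\<lambda>u. ?A u - z *\<^sub>C u) ` ell2_0. cinner x y = 0"
  have row: "summable (\<lambda>i. M j i * coord y i) \<and> (\<Sum>i. M j i * coord y i) = cnj z * coord y j" for j
  proof -
    have eq: "(\<lambda>i. cnj (coord (?A (ell2_basis j)) i) * coord y i) = (\<lambda>i. M j i * coord y i)"
      unfolding coord_op_basis using hermitian by metis
    have "summable (\<lambda>i. cnj (coord (?A (ell2_basis j)) i) * coord y i)"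
      by (rule summable_cinner_ell2) (rule summable_coord)+
    moreover have "cinner (?A (ell2_basis j) - z *\<^sub>C ell2_basis j) y = 0"
      using orth ell2_basis_in_ell2_0 by blast
    then have "cinner (?A (ell2_basis j)) y = cnj z * coord y j"
      by (simp add: cinner_diff_left cinner_scaleC_left cinner_basis)
    then have "(\<Sum>i. cnj (coord (?A (ell2_basis j)) i) * coord y i) = cnj z * coord y j"
      by (simp add: cinner_ell2.rep_eq)
    ultimately show ?thesis unfolding eq by blast
  qed
  have "summable (\<lambda>i. (cmod (cnj z * coord y i))\<^sup>2)"
    using summable_coord[of "cnj z *\<^sub>C y"] by simp
  then have y: "y \<in> ?D" using row by (simp add: inf_matrix_dom_def)
  have Ay: "?A y = cnj z *\<^sub>C y"
    by (rule ell2_eqI) (simp add: coord_op[OF y] row)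
  have "cinner y (?A y) = cinner (?A y) y" by (rule selfadjoint_symmetric[OF selfadjoint y y])
  then have "cnj z * cinner y y = z * cinner y y"
    unfolding Ay cinner_scaleC_left cinner_scaleC_right by simp
  then show "y = 0" using z by (auto simp: cinner_self)
qed

lemma truncations_calculus_sequence:
  "\<exists>\<Psi>. calculus_sequence \<Psi> ell2_0 (inf_matrix_op M) \<and>
    (\<forall>n f x. \<Psi> n (\<lambda>t. complex_of_real (f t)) x =
      ell2_of_vec (hermitian_mat_fun f (trunc_matrix M n) *\<^sub>v trunc_vec x n))"
proof -
  have "\<forall>n. \<exists>\<Phi>. functional_calculus \<Phi> \<and>
    (\<forall>f x. \<Phi> (\<lambda>t. complex_of_real (f t)) x =
      ell2_of_vec (hermitian_mat_fun f (trunc_matrix M n) *\<^sub>v trunc_vec x n)) \<and>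
    (\<forall>x. \<Phi> (\<lambda>_. 1) x = ell2_of_vec (trunc_vec x n)) \<and>
    (\<forall>x. \<Phi> complex_of_real x = matrix_map M (Suc n) x)"
    by (intro allI truncation_calculus hermitian)
  from choice[OF this] obtain \<Psi> where \<Psi>: "\<forall>n. functional_calculus (\<Psi> n) \<and>
    (\<forall>f x. \<Psi> n (\<lambda>t. complex_of_real (f t)) x =
      ell2_of_vec (hermitian_mat_fun f (trunc_matrix M n) *\<^sub>v trunc_vec x n)) \<and>
    (\<forall>x. \<Psi> n (\<lambda>_. 1) x = ell2_of_vec (trunc_vec x n)) \<and>
    (\<forall>x. \<Psi> n complex_of_real x = matrix_map M (Suc n) x)" ..
  have calc: "functional_calculus (\<Psi> n)" for n
    by (rule \<Psi>[THEN spec, THEN conjunct1])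
  have f: "\<forall>n f x. \<Psi> n (\<lambda>t. complex_of_real (f t)) x =
      ell2_of_vec (hermitian_mat_fun f (trunc_matrix M n) *\<^sub>v trunc_vec x n)"
    using \<Psi>[THEN spec, THEN conjunct2, THEN conjunct1] by (rule allI)
  have one: "\<Psi> n (\<lambda>_. 1) x = ell2_of_vec (trunc_vec x n)" for n x
    by (rule \<Psi>[THEN spec, THEN conjunct2, THEN conjunct2, THEN conjunct1, THEN spec])
  have id: "\<Psi> n complex_of_real x = matrix_map M (Suc n) x" for n x
    by (rule \<Psi>[THEN spec, THEN conjunct2, THEN conjunct2, THEN conjunct2, THEN spec])
  have basis: "(\<lambda>n. matrix_map M (Suc n) (ell2_basis j)) \<longlonglongrightarrow> inf_matrix_op M (ell2_basis j)" for j
  proof (rule Lim_transform_eventually[OF truncation_tendsto])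
    show "\<forall>\<^sub>F n in sequentially. ell2_of_vec (trunc_vec (inf_matrix_op M (ell2_basis j)) n) =
        matrix_map M (Suc n) (ell2_basis j)"
      using eventually_ge_at_top[of j]
    proof eventually_elim
      case (elim n)
      then show ?case
        by (intro ell2_eqI)
          (simp add: coord_matrix_map coord_op_basis trunc_vec_def if_distrib[of "\<lambda>z. _ * z"]
            del: sum.lessThan_Suc cong: if_cong)
    qed
  qed
  have "(\<lambda>n. matrix_map M (Suc n) u) \<longlonglongrightarrow> inf_matrix_op M u" if u: "u \<in> ell2_0" for u
  proof -
    obtain c m where um: "u = (\<Sum>i<m. c i *\<^sub>C ell2_basis i)" using u unfolding ell2_0_def by blast
    have "(\<lambda>n. \<Sum>i<m. c i *\<^sub>C matrix_map M (Suc n) (ell2_basis i)) \<longlonglongrightarrow>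
        (\<Sum>i<m. c i *\<^sub>C inf_matrix_op M (ell2_basis i))"
      by (intro tendsto_sum bounded_linear.tendsto[OF bounded_linear_scaleC] basis)
    then show ?thesis
      by (simp add: um ell2_0_op(2) clinear_onD[OF clinear_matrix_map])
  qed
  moreover have "closure ((\<lambda>u. inf_matrix_op M u - \<i> *\<^sub>C u) ` ell2_0) = UNIV"
    by (rule shifted_range_dense) (simp add: complex_eq_iff)
  moreover have "closure ((\<lambda>u. inf_matrix_op M u + \<i> *\<^sub>C u) ` ell2_0) = UNIV"
    using shifted_range_dense[of "- \<i>"] by (simp add: complex_eq_iff scaleC_minus_left)
  ultimately have "calculus_sequence \<Psi> ell2_0 (inf_matrix_op M)"
    by (intro calculus_sequence.intro calc closure_ell2_0) (simp_all add: one id truncation_tendsto)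
  with f show ?thesis by (intro exI[of _ \<Psi>] conjI)
qed

lemma truncations_tendsto_spectral_integral:
  assumes E: "spectral_family_of (inf_matrix_dom M) (inf_matrix_op M) E"
    and v: "v \<in> ell2_0" and bd: "\<And>x. \<bar>f x\<bar> \<le> a + b * \<bar>x\<bar>" and ab: "0 < a" "0 < b"
    and y: "has_spectral_integral E f v y"
  shows "(\<lambda>n. ell2_of_vec (hermitian_mat_fun f (trunc_matrix M n) *\<^sub>v trunc_vec v n)) \<longlonglongrightarrow> y"
proof -
  obtain \<Psi> where \<Psi>: "calculus_sequence \<Psi> ell2_0 (inf_matrix_op M)" and
    f: "\<And>n f x. \<Psi> n (\<lambda>t. complex_of_real (f t)) x =
      ell2_of_vec (hermitian_mat_fun f (trunc_matrix M n) *\<^sub>v trunc_vec x n)"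
    using truncations_calculus_sequence by blast
  have "(\<lambda>n. \<Psi> n (\<lambda>t. complex_of_real (f t)) v) \<longlonglongrightarrow> y"
  proof (rule calculus_tendsto_spectral_integral[OF \<Psi> ell2_0_def ell2_0_op(2) _ _ v bd ab y])
    show "spectral_family E" using E by (simp add: spectral_family_of_def)
    show "has_spectral_integral E (\<lambda>t. t) u (inf_matrix_op M u)" if "u \<in> ell2_0" for u
      using E that ell2_0_subset by (auto simp: spectral_family_of_def)
  qed
  then show ?thesis by (simp only: f)
qed

end

text \<open>Every \<open>\<phi>\<^sub>i\<close> lies in \<open>D\<close>, the image of the maximal domain under an injective map, and is the image
  of \<open>e\<^sub>i\<close> under it. Hence \<open>e\<^sub>i\<close> lies in the maximal domain.\<close>

lemma has_infinite_matrix_selfadjoint_matrix: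
  assumes A: "selfadjoint D A" and m: "has_infinite_matrix D A \<phi>"
  shows "selfadjoint_matrix (inf_matrix A \<phi>)"
proof
  let ?M = "inf_matrix A \<phi>"
  have basis: "orthonormal_basis \<phi>" and \<phi>D: "\<And>i. \<phi> i \<in> D"
    and sa: "selfadjoint (inf_matrix_dom ?M) (inf_matrix_op ?M)"
    and img: "basis_iso \<phi> ` inf_matrix_dom ?M = D"
    using m unfolding has_infinite_matrix_def Let_def by blast+
  show "?M i j = cnj (?M j i)" for i j
  proof -
    have "?M i j = cinner (A (\<phi> i)) (\<phi> j)"
      unfolding inf_matrix_def by (rule selfadjoint_symmetric[OF A \<phi>D \<phi>D])
    then show ?thesis unfolding inf_matrix_def by (subst (asm) (2) cinner_commute)
  qed
  show "selfadjoint (inf_matrix_dom ?M) (inf_matrix_op ?M)" by (rule sa)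
  show "ell2_basis i \<in> inf_matrix_dom ?M" for i
  proof -
    interpret unitary_pair "basis_iso \<phi>" "basis_coords \<phi>"
      by (rule unitary_pair_basis_iso[OF basis])
    obtain u where u: "u \<in> inf_matrix_dom ?M" "basis_iso \<phi> u = basis_iso \<phi> (ell2_basis i)"
      using \<phi>D[of i] img unfolding basis_iso_ell2_basis[OF basis] by (metis imageE)
    then have "u = ell2_basis i" by (metis VU)
    with u show ?thesis by simp
  qed
qed

text \<open>An interval whose endpoints are eigenvalues lies in one whose endpoints are not, as there
  are only countably many eigenvalues.\<close>

lemma RS_integrable_imp_Cauchy:
  assumes countable: "countable {l. eigenvalue_on D A l}"
    and int: "\<And>a b. a < b \<Longrightarrow> \<not> eigenvalue_on D A a \<Longrightarrow> \<not> eigenvalue_on D A b \<Longrightarrow> RS_integrable f \<rho> a b"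
    and ab: "a < b"
  shows "RS_Cauchy f \<rho> a b"
proof -
  have "\<exists>s\<in>{c<..<c + 1}. \<not> eigenvalue_on D A s" for c :: real
  proof (rule ccontr)
    assume "\<not> ?thesis"
    then have "{c<..<c + 1} \<subseteq> {l. eigenvalue_on D A l}" by auto
    with countable have "countable {c<..<c + 1}" by (rule countable_subset[rotated])
    then show False using uncountable_open_interval[of c "c + 1"] by simp
  qed
  then obtain s t where s: "s \<in> {a - 1<..<a - 1 + 1}" "\<not> eigenvalue_on D A s"
    and t: "t \<in> {b<..<b + 1}" "\<not> eigenvalue_on D A t" by blast
  then have st: "s \<le> a" "b \<le> t" "s < t" using ab by auto
  obtain I where "has_RS_integral f \<rho> s t I"
    using int[OF st(3) s(2) t(2)] unfolding RS_integrable_def by blast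
  from RS_Cauchy_subinterval[OF has_RS_integral_imp_Cauchy[OF this] st(1,2)] show ?thesis .
qed

theorem theorem16:
  fixes D :: "'h::chilbert_space set" and A :: "'h \<Rightarrow> 'h" and \<phi> :: "nat \<Rightarrow> 'h"
    and v :: ell2 and f :: "real \<Rightarrow> real"
  assumes "selfadjoint D A"
    and "has_infinite_matrix D A \<phi>"
    and "v \<in> ell2_0"
    and "RS_integrable_operator f D A"
    and "\<exists>a>0. \<exists>b>0. \<forall>x. \<bar>f x\<bar> \<le> a + b * \<bar>x\<bar>"
  defines "M \<equiv> inf_matrix A \<phi>"
  shows "(\<lambda>n. ell2_of_vec (hermitian_mat_fun f (trunc_matrix M n) *\<^sub>v trunc_vec v n))
    \<longlonglongrightarrow> operator_fun f (inf_matrix_dom M) (inf_matrix_op M) v"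
proof -
  interpret selfadjoint_matrix M
    unfolding M_def by (rule has_infinite_matrix_selfadjoint_matrix[OF assms(1,2)])
  have basis: "orthonormal_basis \<phi>" and img: "basis_iso \<phi> ` inf_matrix_dom M = D"
    and inter: "\<And>w. w \<in> inf_matrix_dom M \<Longrightarrow> basis_iso \<phi> (inf_matrix_op M w) = A (basis_iso \<phi> w)"
    using assms(2) unfolding has_infinite_matrix_def Let_def M_def by blast+
  interpret unitary_pair "basis_iso \<phi>" "basis_coords \<phi>"
    by (rule unitary_pair_basis_iso[OF basis])
  interpret inv: unitary_pair "basis_coords \<phi>" "basis_iso \<phi>" by (rule inverse)
  obtain a b where ab: "0 < a" "0 < b" and bd: "\<And>x. \<bar>f x\<bar> \<le> a + b * \<bar>x\<bar>"
    using assms(5) by blast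
  let ?X = "\<lambda>n. ell2_of_vec (hermitian_mat_fun f (trunc_matrix M n) *\<^sub>v trunc_vec v n)"

  obtain E where E: "spectral_family_of D A E"
    and int: "\<And>a b x. a < b \<Longrightarrow> \<not> eigenvalue_on D A a \<Longrightarrow> \<not> eigenvalue_on D A b \<Longrightarrow>
      RS_integrable f (\<lambda>t. (norm (E t x))\<^sup>2) a b"
    using assms(4) unfolding RS_integrable_operator_def by blast
  have "v \<in> inf_matrix_dom M" using assms(3) ell2_0_subset by blast
  then have "basis_iso \<phi> v \<in> D" using img by blast
  then have "has_spectral_integral E (\<lambda>t. t) (basis_iso \<phi> v) (A (basis_iso \<phi> v))"
    using E by (simp add: spectral_family_of_def)
  moreover have "spectral_family E" using E by (simp add: spectral_family_of_def)
  moreover note RS_integrable_imp_Cauchy[OF countable_eigenvalues[OF basis assms(1)] int]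
  ultimately obtain z where "has_spectral_integral E f (basis_iso \<phi> v) z"
    using spectral_integral_exists[OF _ _ bd ab] by blast
  from inv.has_spectral_integral_transport[OF this]
  have "has_spectral_integral (\<lambda>t x. basis_coords \<phi> (E t (basis_iso \<phi> x))) f v (basis_coords \<phi> z)"
    by simp
  moreover have "spectral_family_of (inf_matrix_dom M) (inf_matrix_op M)
      (\<lambda>t x. basis_coords \<phi> (E t (basis_iso \<phi> x)))"
    by (rule spectral_family_of_transport[OF unitary_pair_axioms img[symmetric] inter E])
  ultimately have ex: "\<exists>E. spectral_family_of (inf_matrix_dom M) (inf_matrix_op M) E \<and>
      has_spectral_integral E f v (basis_coords \<phi> z)" by blast

  have lim: "?X \<longlonglongrightarrow> y"
    if "\<exists>E. spectral_family_of (inf_matrix_dom M) (inf_matrix_op M) E \<and> has_spectral_integral E f v y" for y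
    using that truncations_tendsto_spectral_integral[OF _ assms(3) bd ab] by blast
  \<comment> \<open>All candidates for the value of \<open>f(M)v\<close> are limits of the same sequence.\<close>
  have "operator_fun f (inf_matrix_dom M) (inf_matrix_op M) v = basis_coords \<phi> z"
    unfolding operator_fun_def
    by (rule the_equality, rule ex) (rule LIMSEQ_unique[OF lim lim[OF ex]])
  with lim[OF ex] show ?thesis by simp
qed

end
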